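(* Fix any $p>1$. Let $Y_1,\ldots,Y_n$ be i.i.d. from $f_G$ with $G\in\mathcal{G}_p(M_p)$, and let $H$ be any (random) distribution on $\mathbb{R}_+$ that only depends on $Y^{n-1}=(Y_1,\ldots,Y_{n-1})$. For any real $\rho>0$ and integer $y_0\ge 1$, let $$\mathcal{R}(y_0,\rho)=M_p^{1/p}\exp(-c_0y_0)+y_0\rho^{10}+y_0^2\rho\log^2(1/\rho),$$ where $c_0>0$ is some universal constant. There exists some universal $K>0$ such that $$\mathbb{E}_{Y_n\sim f_G}\big(\hat\theta_n^{\mathsf g}(Y_n;H,\rho)-\theta_G(Y_n)\big)^2\ \le\ K\cdot\inf_{y_0\ge 1}\Big[\log^4(1/\rho)\Big(M_py_0^{-(p-1)}+y_0H^2(f_G,f_H)\Big)+\mathcal{R}(y_0,\rho)\Big],$$ where the expectation is over $Y_n\sim f_G$ only, with $Y^{n-1}$ (hence $H$) held fixed. Consequently, if $H$ satisfies $$\mathbb{E}_{Y^{n-1}\stackrel{\text{i.i.d.}}{\sim}f_G}H^2(f_G,f_H)\le c_1\big(n^{-2p/(2p+1)}M_p^{1/(2p+1)}\vee n^{-1}\big)(\log n)^{\kappa}$$ for some positive $c_1$ and $\kappa$, uniformly over $G\in\mathcal{G}_p(M_p)$, then upon choosing $\rho=c_2n^{-10}$ for some universal $c_2>0$, there exists some universal $C=C(c_1,c_2)>0$ such that the estimator $\hat\theta_n^{\mathsf g}=\hat\theta_n^{\mathsf g}(Y_n;H,\rho)$ satisfies $$\mathsf{Regret}_n\big(\hat\theta_n^{\mathsf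 g};\mathcal{G}_p(M_p)\big)\le C\big(n^{-\frac{2(p-1)}{2p+1}}M_p^{\frac{3}{2p+1}}\vee n^{-1}\big)(\log n)^{\kappa+4}.$$
   Context: $\mathbb{R}_+=[0,\infty)$, $\mathbb{Z}_+=\{0,1,2,\ldots\}$, $a\vee b=\max\{a,b\}$. $M_p>0$ is a real number and $n$ is the sample size. $\mathcal{P}(\mathbb{R}_+)$ is the set of Borel probability measures on $\mathbb{R}_+$. $\mathrm{Poi}(y;\theta)=e^{-\theta}\theta^y/y!$ (with $0^0=1$). For $G\in\mathcal{P}(\mathbb{R}_+)$: $f_G(y)=\int\mathrm{Poi}(y;\theta)G(d\theta)$ for $y\in\mathbb{Z}_+$, $m_p(G)=\int u^pG(du)$, $\mathcal{G}_p(M_p)=\{G\in\mathcal{P}(\mathbb{R}_+):m_p(G)\le M_p\}$, $\Delta f_G(y)=f_G(y+1)-f_G(y)$. The Bayes rule (posterior mean) is $\theta_G(y)=\mathbb{E}_G[\theta\mid Y=y]=(y+1)f_G(y+1)/f_G(y)$, where $\theta\sim G$, $Y\mid\theta\sim\mathrm{Poi}(\theta)$. The $\rho$-regularized Bayes rule is $$\theta_G(y;\rho)=(y+1)\Big(\frac{\Delta f_G(y)}{f_G(y)\vee\rho}+1\Big),$$ and the $g$-modeling estimator is $\hat\theta_n^{\mathsf g}(Y_n;H,\rho)=\theta_H(Y_n;\rho)$. $H^2(f,g)=\sum_{y\ge0}(\sqrt{f(y)}-\sqrt{g(y)})^2$ is the squared Hellinger distance (not to be confused with the distribution $H$). In the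 Poisson empirical Bayes model, $\theta_1,\ldots,\theta_n$ are i.i.d. from $G$ and, given them, $Y_i\sim\mathrm{Poi}(\theta_i)$ independently. $\mathsf{mmse}(G)=\mathbb{E}_G(\theta_G(Y)-\theta)^2$ is the Bayes risk, and for an estimator $\hat\theta$ of $\theta_n$ based on $Y^n=(Y_1,\ldots,Y_n)$, the individual regret is $\mathsf{Regret}_n(\hat\theta;\mathcal{G})=\sup_{G\in\mathcal{G}}\{\mathbb{E}_G(\hat\theta(Y^n)-\theta_n)^2-\mathsf{mmse}(G)\}$.
   Formalization: As no universal K works for ρ near 1 (where log(1/ρ)=0), the first bound is stated for |log ρ| ≥ δ with K depending only on δ>0 (any δ); in the regret bound C=C(c1,c2) for n ≥ 3, while for n<3 (log n<1) the constant may also depend on κ. *)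

theory Defs
  imports "HOL-Probability.Probability"
begin

definition Rplus_probs :: "real measure set" where
  "Rplus_probs = space (prob_algebra (restrict_space borel {0..}))"

(* The library's poisson_pmf is specified only for a positive rate; the rate 0 is needed here. *)
definition poi :: "nat \<Rightarrow> real \<Rightarrow> real" where
  "poi y \<theta> = exp (- \<theta>) * \<theta> ^ y / fact y"

definition mix :: "real measure \<Rightarrow> nat \<Rightarrow> real" where
  "mix G y = (\<integral>\<theta>. poi y \<theta> \<partial>G)"

definition mix_measure :: "real measure \<Rightarrow> nat measure" where
  "mix_measure G = density (count_space UNIV) (\<lambda>y. ennreal (mix G y))"

(* Joint law of (theta, Y) with theta distributed as G and Y given theta as Poi(theta):
   its density with respect to the product of G and counting measure is the Poisson pmf. *)
definition eb_joint :: "real measure \<Rightarrow> (real \<times> nat) measure" where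
  "eb_joint G =
     density (G \<Otimes>\<^sub>M count_space UNIV) (\<lambda>(\<theta>, y). ennreal (poi y \<theta>))"

definition moment_class :: "real \<Rightarrow> real \<Rightarrow> real measure set" where
  "moment_class p M =
     {G \<in> Rplus_probs. (\<integral>\<^sup>+ u. ennreal (u powr p) \<partial>G) \<le> ennreal M}"

definition fwd_diff :: "(nat \<Rightarrow> real) \<Rightarrow> nat \<Rightarrow> real" where
  "fwd_diff f y = f (y + 1) - f y"

(* mix G y = 0 only if G is the point mass at 0 and y > 0; such y have probability 0 under
   mix_measure G, so the value of the quotient there is irrelevant. *)
definition bayes_rule :: "real measure \<Rightarrow> nat \<Rightarrow> real" where
  "bayes_rule G y = real (y + 1) * mix G (y + 1) / mix G y"

definition reg_bayes_rule :: "real measure \<Rightarrow> real \<Rightarrow> nat \<Rightarrow> real" where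
  "reg_bayes_rule G \<rho> y =
     real (y + 1) * (fwd_diff (mix G) y / max (mix G y) \<rho> + 1)"

definition hellinger_sq :: "(nat \<Rightarrow> real) \<Rightarrow> (nat \<Rightarrow> real) \<Rightarrow> real" where
  "hellinger_sq f g = (\<Sum>y. (sqrt (f y) - sqrt (g y))\<^sup>2)"

(* A sample of size m is a function on {..<m}, extended by undefined outside; for a sample Y of
   size n, the n-th observation is Y (n - 1).  All sets of such samples are measurable. *)
definition samples :: "nat \<Rightarrow> (nat \<Rightarrow> nat) set" where
  "samples m = {..<m} \<rightarrow>\<^sub>E UNIV"

definition mix_sample :: "nat \<Rightarrow> real measure \<Rightarrow> (nat \<Rightarrow> nat) measure" where
  "mix_sample m G = (\<Pi>\<^sub>M i\<in>{..<m}. mix_measure G)"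

(* H maps the first n - 1 observations to a distribution. *)
definition g_estimator ::
  "nat \<Rightarrow> ((nat \<Rightarrow> nat) \<Rightarrow> real measure) \<Rightarrow> real \<Rightarrow> (nat \<Rightarrow> nat) \<Rightarrow> real" where
  "g_estimator n H \<rho> Y = reg_bayes_rule (H (restrict Y {..<n - 1})) \<rho> (Y (n - 1))"

definition eb_risk :: "nat \<Rightarrow> ((nat \<Rightarrow> nat) \<Rightarrow> real) \<Rightarrow> real measure \<Rightarrow> ennreal" where
  "eb_risk n est G =
     (\<integral>\<^sup>+ \<omega>. ennreal ((est (\<lambda>i\<in>{..<n}. snd (\<omega> i)) - fst (\<omega> (n - 1)))\<^sup>2)
        \<partial>(\<Pi>\<^sub>M i\<in>{..<n}. eb_joint G))"

definition mmse :: "real measure \<Rightarrow> ennreal" where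
  "mmse G = (\<integral>\<^sup>+ (\<theta>, y). ennreal ((bayes_rule G y - \<theta>)\<^sup>2) \<partial>eb_joint G)"

(* Over moment_class p M with p > 1 the Bayes risk is finite, so the difference is proper. *)
definition regret :: "nat \<Rightarrow> ((nat \<Rightarrow> nat) \<Rightarrow> real) \<Rightarrow> real measure set \<Rightarrow> ereal" where
  "regret n est \<G> = (SUP G\<in>\<G>. enn2ereal (eb_risk n est G) - enn2ereal (mmse G))"

definition remainder :: "real \<Rightarrow> real \<Rightarrow> real \<Rightarrow> nat \<Rightarrow> real \<Rightarrow> real" where
  "remainder c0 p M y0 \<rho> =
     M powr (1 / p) * exp (- c0 * real y0) + real y0 * \<rho> ^ 10
       + (real y0)\<^sup>2 * \<rho> * (ln (1 / \<rho>))\<^sup>2"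

end

theory Submission
  imports Defs
begin

text \<open>
  The regularized rules for \<open>G\<close> and \<open>H\<close> differ by a forward difference of \<open>h = f_H - f_G\<close>, so the main point
  is to bound the weighted energy \<open>S_1\<close> of the first differences of \<open>h\<close> by the energy \<open>S_0\<close> of \<open>h\<close>, which is at
  most twice the squared Hellinger distance.  With the weights \<open>(y + 1) \<cdots> (y + k)\<close>, orthogonality of
  the Charlier polynomials gives \<open>S_k \<le> 2 k! / \<rho>\<close>, and summation by parts gives
  \<open>S_k \<le> sqrt S_(k-1) (sqrt S_(k+1) + O(sqrt k + log (1 / \<rho>)) sqrt S_k)\<close>; iterating this about \<open>log (1 / \<rho>)\<close> times
  yields \<open>S_1 = O(log^4 (1 / \<rho>) S_0 + \<rho>^10)\<close>.

  Observations \<open>y < 64 y0\<close> are treated in this way.  Beyond that point, rates above \<open>y0\<close> are controlled by the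
  moment, and rates below \<open>y0\<close> give geometrically small probabilities.  Splitting at \<open>64 y0\<close>, while the moment
  is cut at \<open>y0\<close>, keeps the constants independent of \<open>p\<close>.

  For the regret, a fixed \<open>p\<close>-independent constant requires a cutoff \<open>y0\<close> of at least \<open>log n\<close>.  If the balancing cutoff is
  smaller than that, the trivial bound on first differences replaces the interpolation and saves
  the logarithm lost in \<open>y0\<close>.
\<close>

section \<open>Poisson weights\<close>

text \<open>The fourth power of the logarithm has a simple source. For the ratios r_k of
  \<open>sqrt S_(k+1)\<close> to \<open>sqrt S_k\<close> the interpolation inequality reads r_k
  \<le> r_(k+1) + B, with B of order log (1 / \<rho>) over the relevant k. About log (1 / \<rho>)
  steps bound r_0 by a multiple of log^2, and squaring gives log^4. In this argument boundedly many
  steps would not do: the a priori bound on S_k carries 1 / \<rho>, of which only a root of order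
  log (1 / \<rho>) is harmless. B has this size because the weight 1 / (max f_G \<rho> + max f_H
  \<rho>) changes by a relative amount O(log (1 / \<rho>) / sqrt y) per step; this is where the
  regularization enters. Three degenerate ranges shape the statement. At \<rho> = 1 the logarithm
  vanishes, hence the lower bound \<delta> on its modulus. At n = 1 the hypothesis demands Hellinger
  distance 0 to all G at once, which no H satisfies. At n = 2, log n < 1 and (log n)^\<kappa> may be
  arbitrarily small, hence the separate constant \<open>C'\<close>, chosen after \<kappa>.\<close>

lemma poi_nonneg: "0 \<le> \<theta> \<Longrightarrow> 0 \<le> poi y \<theta>"
  by (simp add: poi_def)

lemma poi_Suc: "real (Suc y) * poi (Suc y) \<theta> = \<theta> * poi y \<theta>"
proof -
  have "c * (a / (c * b)) = a / b" if "c \<noteq> 0" for a b c :: real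
    using that by simp
  from this[of "real (Suc y)"] show ?thesis
    by (simp add: poi_def mult_ac del: of_nat_Suc)
qed

lemma poi_sums: "(\<lambda>y. poi y \<theta>) sums 1"
proof -
  have "(\<lambda>y. exp (-\<theta>) * (\<theta> ^ y /\<^sub>R fact y)) sums (exp (-\<theta>) * exp \<theta>)"
    by (intro sums_mult exp_converges)
  then show ?thesis
    by (simp add: poi_def exp_minus field_simps)
qed

lemma sum_poi_le_1:
  assumes "0 \<le> \<theta>" "finite A"
  shows "(\<Sum>y\<in>A. poi y \<theta>) \<le> 1"
  using sum_le_suminf[OF sums_summable[OF poi_sums] assms(2), of \<theta>] poi_nonneg[OF assms(1)]
    sums_unique[OF poi_sums[of \<theta>]] by simp

lemma poi_le_1: "0 \<le> \<theta> \<Longrightarrow> poi y \<theta> \<le> 1"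
  using sum_poi_le_1[of \<theta> "{y}"] by simp

lemma continuous_on_poi: "continuous_on A (poi y)"
  unfolding poi_def by (intro continuous_intros) auto

lemma borel_measurable_poi [measurable]: "poi y \<in> borel_measurable borel"
  by (intro borel_measurable_continuous_onI continuous_on_poi)

lemma sums_poi_mean: "(\<lambda>y. real y * poi y \<theta>) sums \<theta>"
proof -
  have "(\<lambda>y. real (Suc y) * poi (Suc y) \<theta>) sums (\<theta> * 1)"
    unfolding poi_Suc by (intro sums_mult poi_sums)
  then show ?thesis
    by (subst (asm) sums_Suc_iff) simp
qed

lemma sums_poi_mean_Suc: "(\<lambda>y. (real y + 1) * poi y \<theta>) sums (\<theta> + 1)"
  using sums_add[OF sums_poi_mean poi_sums, of \<theta>] by (simp add: algebra_simps)

lemma sums_poi_second: "(\<lambda>y. (real y)\<^sup>2 * poi y \<theta>) sums (\<theta>\<^sup>2 + \<theta>)"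
proof -
  have eq: "(real (Suc y))\<^sup>2 * poi (Suc y) \<theta> = \<theta> * ((real y + 1) * poi y \<theta>)" for y
  proof -
    have "(real (Suc y))\<^sup>2 * poi (Suc y) \<theta> = real (Suc y) * (real (Suc y) * poi (Suc y) \<theta>)"
      by (simp only: power2_eq_square mult.assoc)
    then show ?thesis unfolding poi_Suc by (simp add: algebra_simps)
  qed
  have "(\<lambda>y. (real (Suc y))\<^sup>2 * poi (Suc y) \<theta>) sums (\<theta> * (\<theta> + 1))"
    unfolding eq by (intro sums_mult sums_poi_mean_Suc)
  then show ?thesis
    by (subst (asm) sums_Suc_iff) (simp add: algebra_simps power2_eq_square)
qed

lemma sums_poi_sq_dev: "(\<lambda>y. (\<theta> - real y - 1)\<^sup>2 * poi y \<theta>) sums (\<theta> + 1)"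
proof -
  have "(\<lambda>y. (real y)\<^sup>2 * poi y \<theta> + (2 - 2 * \<theta>) * (real y * poi y \<theta>) + (\<theta> - 1)\<^sup>2 * poi y \<theta>)
      sums (\<theta>\<^sup>2 + \<theta> + (2 - 2 * \<theta>) * \<theta> + (\<theta> - 1)\<^sup>2 * 1)"
    by (intro sums_add sums_mult sums_poi_second sums_poi_mean poi_sums)
  moreover have "(real y)\<^sup>2 * poi y \<theta> + (2 - 2 * \<theta>) * (real y * poi y \<theta>) + (\<theta> - 1)\<^sup>2 * poi y \<theta>
     = (\<theta> - real y - 1)\<^sup>2 * poi y \<theta>" for y
    by (simp add: power2_eq_square algebra_simps)
  moreover have "\<theta>\<^sup>2 + \<theta> + (2 - 2 * \<theta>) * \<theta> + (\<theta> - 1)\<^sup>2 * 1 = \<theta> + 1"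
    by (simp add: power2_eq_square algebra_simps)
  ultimately show ?thesis by (simp only:)
qed

lemma sum_le_sums:
  fixes f :: "nat \<Rightarrow> real"
  assumes "f sums s" "finite A" "\<And>y. 0 \<le> f y"
  shows "sum f A \<le> s"
  using sum_le_suminf[OF sums_summable[OF assms(1)] assms(2)] assms(3) sums_unique[OF assms(1)]
  by simp

section \<open>Sub-exponential concentration of the Poisson weights\<close>

text \<open>Multiplying the rate by c is an exponential tilt. Combined with \<open>poi_le_1\<close>
  at the rate c \<theta> it replaces the usual Chernoff computation, and it turns factors of the
  form c ^ y into a change of rate.\<close>

lemma poi_scale: "0 < c \<Longrightarrow> poi y (c * \<theta>) = c ^ y * (exp ((1 - c) * \<theta>) * poi y \<theta>)"
  by (simp add: poi_def power_mult_distrib algebra_simps exp_add exp_diff exp_minus field_simps)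

text \<open>Chernoff bound in \<theta> at fixed y: as a function of the rate, the weight is
  concentrated around y + 1 at scale sqrt (y + 1). The two tails come from
  \<open>poi y (c * \<theta>) \<le> 1\<close> at c slightly below and slightly above 1.\<close>

lemma poi_exp_dev_le:
  assumes "0 \<le> \<theta>"
  shows "poi y \<theta> * exp (\<bar>\<theta> - real y - 1\<bar> / (2 * sqrt (real y + 1))) \<le> 4"
proof -
  \<comment> \<open>This t makes y t^2 at most 1/4, so the quadratic error of the logarithm costs at
    most 1/2 in the exponent. The linear term c - 1 costs another 1/2.\<close>
  define t where "t = 1 / (2 * sqrt (real y + 1))"
  have t: "0 < t" "t \<le> 1/2" "real y * t\<^sup>2 \<le> 1/4"
    by (auto simp: t_def power_divide power_mult_distrib divide_simps)
  have tilt: "exp ((1 - c) * \<theta>) * poi y \<theta> * exp ((c - 1) * (real y + 1)) \<le> 4"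
    if c: "\<bar>c - 1\<bar> = t" for c
  proof -
    have cpos: "0 < c" using c t by auto
    have ln: "c - 1 - ln c \<le> 2 * t\<^sup>2"
    proof -
      have "\<bar>ln (1 + (c - 1)) - (c - 1)\<bar> \<le> 2 * (c - 1)\<^sup>2"
        using c t by (intro abs_ln_one_plus_x_minus_x_bound) auto
      moreover have "(c - 1)\<^sup>2 = t\<^sup>2" using c by (metis power2_abs)
      ultimately show ?thesis by simp
    qed
    have "poi y (c * \<theta>) \<le> 1"
      using assms cpos by (intro poi_le_1) auto
    then have 1: "exp ((1 - c) * \<theta>) * poi y \<theta> \<le> exp (- (real y * ln c))"
    proof -
      have e: "exp (real y * ln c) = c ^ y"
        using cpos by (simp add: exp_of_nat_mult)
      show ?thesis
        using \<open>poi y (c * \<theta>) \<le> 1\<close> cpos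
        unfolding exp_minus e poi_scale[OF cpos] by (simp add: divide_simps mult_ac)
    qed
    have "exp ((1 - c) * \<theta>) * poi y \<theta> * exp ((c - 1) * (real y + 1))
       \<le> exp (- (real y * ln c)) * exp ((c - 1) * (real y + 1))"
      by (intro mult_right_mono 1) auto
    also have "\<dots> = exp (real y * (c - 1 - ln c) + (c - 1))"
      by (simp add: exp_add[symmetric] algebra_simps)
    also have "\<dots> \<le> exp 1"
    proof -
      have "real y * (c - 1 - ln c) \<le> 1/2"
        using mult_left_mono[OF ln, of "real y"] t by simp
      then show ?thesis using c t by auto
    qed
    also have "\<dots> \<le> 4" using exp_le by simp
    finally show ?thesis .
  qed
  have e: "\<bar>\<theta> - real y - 1\<bar> / (2 * sqrt (real y + 1)) = t * \<bar>\<theta> - real y - 1\<bar>"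
    by (simp add: t_def)
  show ?thesis
  proof (cases "0 \<le> \<theta> - real y - 1")
    case True
    have "exp (t * \<bar>\<theta> - real y - 1\<bar>) = exp (t * \<theta>) * exp ((- t) * (real y + 1))"
      using True by (simp add: exp_add[symmetric] algebra_simps)
    with tilt[of "1 - t"] t show ?thesis unfolding e by (simp add: mult_ac)
  next
    case False
    have "exp (t * \<bar>\<theta> - real y - 1\<bar>) = exp (- t * \<theta>) * exp (t * (real y + 1))"
      using False by (simp add: exp_add[symmetric] algebra_simps)
    with tilt[of "1 + t"] t show ?thesis unfolding e by (simp add: mult_ac)
  qed
qed

text \<open>A version of log (1 / r) that is at least 4 for every r > 0, so that estimates survive
  for r near or above 1. The summand 4 is the constant of \<open>poi_exp_dev_le\<close>.\<close>

definition reg_log :: "real \<Rightarrow> real" where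
  "reg_log r = 4 + max 0 (ln (1 / r))"

lemma reg_log_ge: "4 \<le> reg_log r"
  by (simp add: reg_log_def)

lemma reg_log_antimono: "0 < r \<Longrightarrow> r \<le> s \<Longrightarrow> reg_log s \<le> reg_log r"
  by (auto simp: reg_log_def ln_div max_def)

text \<open>The scaled deviation X is split at s = log (1 / m), truncated at 0, by X \<le> s + exp
  (X - s). The part s costs a logarithm times the weight; the excess has weight at most 4 by
  \<open>poi_exp_dev_le\<close> and is damped by exp (- s) \<le> m. The level m is free, to be
  matched with the size of a mixture.\<close>

lemma poi_abs_dev_le:
  assumes "0 \<le> \<theta>" "0 < m"
  shows "poi y \<theta> * \<bar>\<theta> - real y - 1\<bar> 
    \<le> 2 * sqrt (real y + 1) * (max 0 (ln (1 / m)) * poi y \<theta> + 4 * m)"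
proof -
  define X where "X = \<bar>\<theta> - real y - 1\<bar> / (2 * sqrt (real y + 1))"
  define s where "s = max 0 (ln (1 / m))"
  have em: "exp (- s) \<le> m"
    using assms(2) by (auto simp: s_def ln_div max_def ln_ge_zero_iff exp_minus)
  have "X \<le> s + exp (X - s)"
    using exp_ge_add_one_self[of "X - s"] by linarith
  then have "poi y \<theta> * X \<le> poi y \<theta> * (s + exp (X - s))"
    by (intro mult_left_mono poi_nonneg assms)
  also have "\<dots> = s * poi y \<theta> + exp (- s) * (poi y \<theta> * exp X)"
    by (simp add: algebra_simps exp_diff exp_minus field_simps)
  also have "\<dots> \<le> s * poi y \<theta> + m * 4"
    using poi_exp_dev_le[OF assms(1), of y] em assms poi_nonneg[OF assms(1), of y]
    by (intro add_left_mono mult_mono) (auto simp: X_def)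
  finally have "poi y \<theta> * X \<le> s * poi y \<theta> + 4 * m" by simp
  then have "2 * sqrt (real y + 1) * (poi y \<theta> * X)
      \<le> 2 * sqrt (real y + 1) * (s * poi y \<theta> + 4 * m)"
    by (intro mult_left_mono) auto
  moreover have "2 * sqrt (real y + 1) * (poi y \<theta> * X) = poi y \<theta> * \<bar>\<theta> - real y - 1\<bar>"
    by (simp add: X_def)
  ultimately show ?thesis by (simp add: s_def)
qed

section \<open>Poisson mixtures\<close>

text \<open>The deviation of a rule from y + 1: r = f y gives the Bayes rule, r = max (f y) \<rho>
  the regularized one. The common y + 1 cancels from the loss.\<close>

abbreviation scaled_diff :: "(nat \<Rightarrow> real) \<Rightarrow> real \<Rightarrow> nat \<Rightarrow> real" where
  "scaled_diff f r y \<equiv> (real y + 1) * (fwd_diff f y / r)"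

locale rplus_prob = prob_space G for G :: "real measure" +
  assumes sets_G: "sets G = sets (restrict_space borel {0..})"
begin

lemma space_G: "space G = {0..}"
  using sets_eq_imp_space_eq[OF sets_G] by (simp add: space_restrict_space)

lemma borel_measurable_G [measurable (raw)]: "f \<in> borel_measurable borel \<Longrightarrow> f \<in> borel_measurable G"
  using measurable_restrict_space1 measurable_cong_sets[OF sets_G refl] by blast

lemma integrable_boundedI:
  fixes f :: "real \<Rightarrow> real"
  assumes "f \<in> borel_measurable borel" "\<And>\<theta>. 0 \<le> \<theta> \<Longrightarrow> \<bar>f \<theta>\<bar> \<le> B"
  shows "integrable G f"
  using assms by (intro integrable_const_bound[where B = B] AE_I2 borel_measurable_G) (auto simp: space_G)

lemma integral_mono_G:
  fixes f g :: "real \<Rightarrow> real"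
  assumes "integrable G f" "integrable G g" "\<And>\<theta>. 0 \<le> \<theta> \<Longrightarrow> f \<theta> \<le> g \<theta>"
  shows "integral\<^sup>L G f \<le> integral\<^sup>L G g"
  using assms by (intro integral_mono) (auto simp: space_G)

lemma integrable_poi: "integrable G (poi y)"
  by (rule integrable_boundedI[where B = 1]) (auto simp: poi_nonneg poi_le_1)

lemma mix_nonneg: "0 \<le> mix G y"
  unfolding mix_def by (intro integral_nonneg_AE AE_I2) (auto simp: space_G poi_nonneg)

lemma sum_mix_mult:
  "(\<Sum>y\<in>A. mix G y * c y) = (\<integral>\<theta>. (\<Sum>y\<in>A. poi y \<theta> * c y) \<partial>G)"
  unfolding mix_def by (subst Bochner_Integration.integral_sum) (auto intro: integrable_poi)

lemma sum_mix_le_1: "finite A \<Longrightarrow> sum (mix G) A \<le> 1"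
  using sum_mix_mult[of "\<lambda>_. 1" A]
    integral_mono_G[of "\<lambda>\<theta>. (\<Sum>y\<in>A. poi y \<theta>)" "\<lambda>_. 1"]
  by (simp add: integrable_poi sum_poi_le_1 prob_space)

lemma mix_le_1: "mix G y \<le> 1"
  using sum_mix_le_1[of "{y}"] by simp

lemma summable_mix: "summable (mix G)"
  by (rule bounded_imp_summable[where B = 1]) (auto simp: mix_nonneg sum_mix_le_1)

lemma integrable_poi_mult_dev: "integrable G (\<lambda>\<theta>. poi y \<theta> * (\<theta> - real y - 1))"
proof -
  have eq: "poi y \<theta> * (\<theta> - real y - 1) = real (Suc y) * poi (Suc y) \<theta> - (real y + 1) * poi y \<theta>" for \<theta>
    unfolding poi_Suc by (simp add: algebra_simps)
  show ?thesis unfolding eq by (intro Bochner_Integration.integrable_diff integrable_mult_right integrable_poi)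
qed

lemma integrable_poi_mult_sq_dev: "integrable G (\<lambda>\<theta>. poi y \<theta> * (\<theta> - real y - 1)\<^sup>2)"
proof -
  have eq: "poi y \<theta> * (\<theta> - real y - 1)\<^sup>2
     = real (Suc y) * (real (Suc (Suc y)) * poi (Suc (Suc y)) \<theta>)
        - 2 * (real y + 1) * (real (Suc y) * poi (Suc y) \<theta>) + (real y + 1)\<^sup>2 * poi y \<theta>" for \<theta>
    using poi_Suc[of y \<theta>] poi_Suc[of "Suc y" \<theta>]
    by (simp add: algebra_simps power2_eq_square)
  show ?thesis unfolding eq 
    by (intro Bochner_Integration.integrable_diff Bochner_Integration.integrable_add 
        integrable_mult_right integrable_poi)
qed

text \<open>By \<open>poi_Suc\<close> the forward difference is an average of \<theta> - y - 1, so
  concentration of the Poisson weights in \<theta> around y + 1 controls it.\<close>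

lemma fwd_diff_mix:
  "(real y + 1) * fwd_diff (mix G) y = (\<integral>\<theta>. poi y \<theta> * (\<theta> - real y - 1) \<partial>G)"
proof -
  have eq: "poi y \<theta> * (\<theta> - real y - 1) = real (Suc y) * poi (Suc y) \<theta> - (real y + 1) * poi y \<theta>" for \<theta>
    unfolding poi_Suc by (simp add: algebra_simps)
  show ?thesis unfolding eq
    by (subst Bochner_Integration.integral_diff) 
       (auto intro: integrable_poi simp: mix_def fwd_diff_def right_diff_distrib simp del: of_nat_Suc)
qed

text \<open>Here m is any upper bound on the mixture, so that the regularized denominator can take
  its place and the logarithm stays bounded where the mixture is tiny.\<close>

lemma fwd_diff_mix_le:
  assumes "mix G y \<le> m" "0 < m"
  shows "(real y + 1) * \<bar>fwd_diff (mix G) y\<bar> \<le> 2 * sqrt (real y + 1) * m * reg_log m"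
proof -
  let ?s = "max 0 (ln (1 / m))"
  have "(real y + 1) * \<bar>fwd_diff (mix G) y\<bar> = \<bar>\<integral>\<theta>. poi y \<theta> * (\<theta> - real y - 1) \<partial>G\<bar>"
    unfolding fwd_diff_mix[symmetric] by (simp add: abs_mult)
  also have "\<dots> \<le> (\<integral>\<theta>. \<bar>poi y \<theta> * (\<theta> - real y - 1)\<bar> \<partial>G)"
    by simp
  also have "\<dots> \<le> (\<integral>\<theta>. 2 * sqrt (real y + 1) * (?s * poi y \<theta> + 4 * m) \<partial>G)"
  proof (intro integral_mono_G)
    fix \<theta> :: real assume t: "0 \<le> \<theta>"
    show "\<bar>poi y \<theta> * (\<theta> - real y - 1)\<bar> \<le> 2 * sqrt (real y + 1) * (?s * poi y \<theta> + 4 * m)"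
      using poi_abs_dev_le[OF t assms(2), of y] poi_nonneg[OF t, of y] by (simp add: abs_mult)
  qed (auto intro!: integrable_poi integrable_poi_mult_dev)
  also have "\<dots> = 2 * sqrt (real y + 1) * (?s * mix G y + 4 * m)"
    by (simp add: integrable_poi mix_def prob_space)
  also have "\<dots> \<le> 2 * sqrt (real y + 1) * (?s * m + 4 * m)"
    using assms by (intro mult_left_mono add_right_mono) auto
  finally show ?thesis by (simp add: reg_log_def algebra_simps)
qed

text \<open>Jensen's inequality for the posterior of \<theta> given y: t is the posterior mean of
  \<theta> - y - 1, and the posterior variance is nonnegative.\<close>

lemma sq_fwd_diff_mix_le:
  assumes "0 < mix G y"
  shows "mix G y * (scaled_diff (mix G) (mix G y) y)\<^sup>2
     \<le> (\<integral>\<theta>. poi y \<theta> * (\<theta> - real y - 1)\<^sup>2 \<partial>G)"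
proof -
  define t where "t = scaled_diff (mix G) (mix G y) y"
  have tf: "t * mix G y = (\<integral>\<theta>. poi y \<theta> * (\<theta> - real y - 1) \<partial>G)"
    using assms by (simp add: t_def fwd_diff_mix[symmetric])
  have "0 \<le> (\<integral>\<theta>. poi y \<theta> * (\<theta> - real y - 1 - t)\<^sup>2 \<partial>G)"
    by (intro integral_nonneg_AE AE_I2) (auto simp: space_G poi_nonneg)
  also have "\<dots> = (\<integral>\<theta>. poi y \<theta> * (\<theta> - real y - 1)\<^sup>2 - 2 * t * (poi y \<theta> * (\<theta> - real y - 1))
      + t\<^sup>2 * poi y \<theta> \<partial>G)"
    by (intro Bochner_Integration.integral_cong) (auto simp: power2_eq_square algebra_simps)
  also have "\<dots> = (\<integral>\<theta>. poi y \<theta> * (\<theta> - real y - 1)\<^sup>2 \<partial>G) - 2 * t * (t * mix G y) + t\<^sup>2 * mix G y"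
    unfolding tf by (simp add: integrable_poi integrable_poi_mult_dev integrable_poi_mult_sq_dev mix_def)
  also have "\<dots> = (\<integral>\<theta>. poi y \<theta> * (\<theta> - real y - 1)\<^sup>2 \<partial>G) - mix G y * t\<^sup>2"
    by (simp add: power2_eq_square algebra_simps)
  finally show ?thesis by (simp add: t_def)
qed

end

lemma rplus_probI: "G \<in> Rplus_probs \<Longrightarrow> rplus_prob G"
  by (auto simp: Rplus_probs_def space_prob_algebra rplus_prob_def rplus_prob_axioms_def)

section \<open>Charlier polynomials\<close>

text \<open>Charlier polynomials, normalised to 1 at y = 0 and generated by their raising operator.
  At y = 0 the truncated y - 1 meets the factor 0.\<close>

fun charlier :: "real \<Rightarrow> nat \<Rightarrow> nat \<Rightarrow> real" where
  "charlier \<theta> 0 y = 1"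
| "charlier \<theta> (Suc k) y = charlier \<theta> k y - real y / \<theta> * charlier \<theta> k (y - 1)"

text \<open>The forward difference is the lowering operator of this family; the induction applies it
  to the raising recursion by the product rule.\<close>

lemma fwd_diff_charlier:
  assumes "0 < \<theta>"
  shows "charlier \<theta> (Suc k) (Suc y) - charlier \<theta> (Suc k) y = - (real (Suc k) / \<theta>) * charlier \<theta> k y"
proof (induction k arbitrary: y)
  case 0
  then show ?case using assms by (simp add: field_simps)
next
  case (Suc k)
  define c where "c = charlier \<theta>"
  have IH: "c (Suc k) (Suc z) = c (Suc k) z - (real (Suc k) / \<theta>) * c k z" for z
    using Suc.IH[of z] unfolding c_def by linarith
  have c2: "c (Suc (Suc k)) z = c (Suc k) z - real z / \<theta> * c (Suc k) (z - 1)" 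
    "c (Suc k) z = c k z - real z / \<theta> * c k (z - 1)" for z
    by (simp_all add: c_def)
  have "c (Suc (Suc k)) (Suc y) - c (Suc (Suc k)) y = - (real (Suc (Suc k)) / \<theta>) * c (Suc k) y"
  proof (cases y)
    case 0
    have a: "c (Suc k) 0 = c k 0" using c2(2)[of 0] by simp
    show ?thesis
      unfolding 0 c2(1) IH diff_Suc_1 a using assms by (simp add: a field_simps)
  next
    case (Suc x)
    have "c (Suc (Suc k)) (Suc y) - c (Suc (Suc k)) y
      = (c (Suc k) (Suc y) - c (Suc k) y) - real y / \<theta> * (c (Suc k) (Suc x) - c (Suc k) x) - c (Suc k) y / \<theta>"
      unfolding c2(1) using Suc by (simp add: algebra_simps add_divide_distrib)
    also have "\<dots> = - (real (Suc k) / \<theta>) * (c k y - real y / \<theta> * c k x) - c (Suc k) y / \<theta>"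
      unfolding IH using assms by (simp add: field_simps)
    also have "c k y - real y / \<theta> * c k x = c (Suc k) y"
      unfolding c2(2)[of y] using Suc by simp
    also have "- (real (Suc k) / \<theta>) * c (Suc k) y - c (Suc k) y / \<theta>
        = - (real (Suc (Suc k)) / \<theta>) * c (Suc k) y"
      by (simp add: algebra_simps add_divide_distrib)
    finally show ?thesis .
  qed
  then show ?case by (simp only: c_def)
qed

lemma charlier_growth:
  assumes "0 < \<theta>"
  shows "\<bar>charlier \<theta> k y\<bar> \<le> (1 + 1 / \<theta>) ^ k * (2 ^ k) ^ y"
proof (induction k arbitrary: y)
  case (Suc k)
  let ?B = "(1 + 1 / \<theta>) ^ k"
  have B: "0 \<le> ?B" using assms by simp
  have "\<bar>charlier \<theta> (Suc k) y\<bar> \<le> \<bar>charlier \<theta> k y\<bar> + real y / \<theta> * \<bar>charlier \<theta> k (y - 1)\<bar>"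
    using assms by (simp add: abs_mult order_trans[OF abs_triangle_ineq4])
  also have "\<dots> \<le> ?B * (2 ^ k) ^ y + real y / \<theta> * (?B * (2 ^ k) ^ (y - 1))"
    using assms by (intro add_mono Suc.IH mult_left_mono) auto
  also have "\<dots> \<le> ?B * (2 ^ k) ^ y * 2 ^ y + 2 ^ y / \<theta> * (?B * (2 ^ k) ^ y)"
  proof (rule add_mono)
    show "?B * (2 ^ k) ^ y \<le> ?B * (2 ^ k) ^ y * 2 ^ y"
      using mult_left_mono[of 1 "2 ^ y" "?B * (2 ^ k) ^ y"] B by simp
    show "real y / \<theta> * (?B * (2 ^ k) ^ (y - 1)) \<le> 2 ^ y / \<theta> * (?B * (2 ^ k) ^ y)"
      using assms B of_nat_less_two_power[of y, where 'a = real]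
      by (intro mult_mono divide_right_mono power_increasing) auto
  qed
  also have "\<dots> = (1 + 1 / \<theta>) ^ Suc k * (2 ^ Suc k) ^ y"
    by (simp add: power_mult_distrib algebra_simps)
  finally show ?case .
qed simp

text \<open>The polynomials grow at most exponentially in y, which \<open>poi_scale\<close> absorbs
  into the rate \<open>?q * \<theta>\<close>. The shift i serves the norm computation, which pairs a
  polynomial with its successor at y + 1.\<close>

lemma summable_poi_charlier:
  assumes "0 < \<theta>"
  shows "summable (\<lambda>y. poi y \<theta> * (charlier \<theta> j y * charlier \<theta> k (y + i)))"
proof (rule summable_comparison_test')
  let ?C = "(1 + 1 / \<theta>) ^ j * ((1 + 1 / \<theta>) ^ k * (2 ^ k) ^ i)"
  let ?q = "2 ^ j * 2 ^ k :: real"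
  show "summable (\<lambda>y. ?C * (exp ((?q - 1) * \<theta>) * poi y (?q * \<theta>)))"
    by (intro summable_mult sums_summable[OF poi_sums])
  fix y :: nat
  have "norm (poi y \<theta> * (charlier \<theta> j y * charlier \<theta> k (y + i)))
      = poi y \<theta> * (\<bar>charlier \<theta> j y\<bar> * \<bar>charlier \<theta> k (y + i)\<bar>)"
    using assms by (simp add: abs_mult poi_nonneg)
  also have "\<dots> \<le> poi y \<theta> * (((1 + 1 / \<theta>) ^ j * (2 ^ j) ^ y) * ((1 + 1 / \<theta>) ^ k * (2 ^ k) ^ (y + i)))"
    using assms by (intro mult_left_mono mult_mono charlier_growth poi_nonneg) auto
  also have "\<dots> = ?C * (?q ^ y * poi y \<theta>)"
    by (simp add: power_mult_distrib power_add mult_ac)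
  also have "?q ^ y * poi y \<theta> = exp ((?q - 1) * \<theta>) * poi y (?q * \<theta>)"
    by (subst poi_scale) (auto simp: exp_add[symmetric] mult_ac exp_minus[symmetric] algebra_simps)
  finally show "norm (poi y \<theta> * (charlier \<theta> j y * charlier \<theta> k (y + i)))
    \<le> ?C * (exp ((?q - 1) * \<theta>) * poi y (?q * \<theta>))" .
qed

text \<open>Under the Poisson weights the raising operator is the adjoint of minus the forward
  difference, by the index shift \<open>poi_Suc\<close>. Hence the squared norm of d is the pairing
  of c with minus the difference of d, and the lowering rule turns this into (k + 1) / \<theta>
  times the squared norm of c.\<close>

lemma charlier_norm:
  assumes "0 < \<theta>"
  shows "(\<lambda>y. poi y \<theta> * (charlier \<theta> k y)\<^sup>2) sums (fact k / \<theta> ^ k)"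
proof (induction k)
  case 0
  then show ?case using poi_sums by simp
next
  case (Suc k)
  define c where "c = charlier \<theta> k"
  define d where "d = charlier \<theta> (Suc k)"
  have dd: "d (Suc y) - d y = - (real (Suc k) / \<theta>) * c y" for y
    unfolding c_def d_def by (rule fwd_diff_charlier[OF assms])
  have s1: "(\<lambda>y. poi y \<theta> * (c y * d y)) sums (\<Sum>y. poi y \<theta> * (c y * d y))"
    using summable_poi_charlier[OF assms, of k "Suc k" 0]
    by (intro summable_sums) (simp add: c_def d_def)
  have s2: "(\<lambda>y. poi y \<theta> * (c y * d (Suc y))) sums (\<Sum>y. poi y \<theta> * (c y * d (Suc y)))"
    using summable_poi_charlier[OF assms, of k "Suc k" 1]
    by (intro summable_sums) (simp add: c_def d_def)
  have "poi (Suc y) \<theta> * (real (Suc y) / \<theta> * c y * d (Suc y)) = poi y \<theta> * (c y * d (Suc y))" for y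
    using poi_Suc[of y \<theta>] assms by (simp add: field_simps del: of_nat_Suc)
  then have "(\<lambda>y. poi (Suc y) \<theta> * (real (Suc y) / \<theta> * c (Suc y - 1) * d (Suc y))) sums
     (\<Sum>y. poi y \<theta> * (c y * d (Suc y)))"
    using s2 by simp
  then have "(\<lambda>y. poi y \<theta> * (real y / \<theta> * c (y - 1) * d y)) sums
     (\<Sum>y. poi y \<theta> * (c y * d (Suc y)))"
    by (subst (asm) sums_Suc_iff) simp
  from sums_diff[OF s1 this]
  have 1: "(\<lambda>y. poi y \<theta> * (d y)\<^sup>2) sums ((\<Sum>y. poi y \<theta> * (c y * d y)) - (\<Sum>y. poi y \<theta> * (c y * d (Suc y))))"
    by (simp add: d_def c_def algebra_simps power2_eq_square)
  have "(\<lambda>y. (real (Suc k) / \<theta>) * (poi y \<theta> * (c y)\<^sup>2)) sums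
      ((\<Sum>y. poi y \<theta> * (c y * d y)) - (\<Sum>y. poi y \<theta> * (c y * d (Suc y))))"
  proof -
    have "poi y \<theta> * (c y * d y) - poi y \<theta> * (c y * d (Suc y)) = (real (Suc k) / \<theta>) * (poi y \<theta> * (c y)\<^sup>2)" for y
    proof -
      have "poi y \<theta> * (c y * d y) - poi y \<theta> * (c y * d (Suc y)) = - (poi y \<theta> * c y * (d (Suc y) - d y))"
        by (simp add: algebra_simps)
      then show ?thesis unfolding dd by (simp add: power2_eq_square)
    qed
    with sums_diff[OF s1 s2] show ?thesis by simp
  qed
  from sums_unique2[OF this sums_mult[OF Suc.IH[folded c_def], of "real (Suc k) / \<theta>"]] 1
  show ?case by (simp add: d_def del: of_nat_Suc)
qed

text \<open>Rodrigues' formula. Forward differences move the argument to y + k, a shift that the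
  weights \<open>rising k\<close> compensate.\<close>

lemma fwd_diff_poi_charlier:
  assumes "0 < \<theta>"
  shows "(fwd_diff ^^ k) (\<lambda>y. poi y \<theta>) y = poi (y + k) \<theta> * charlier \<theta> k (y + k)"
proof (induction k arbitrary: y)
  case (Suc k)
  have p: "poi (y + k) \<theta> = real (Suc (y + k)) / \<theta> * poi (Suc (y + k)) \<theta>"
    using poi_Suc[of "y + k" \<theta>] assms by (simp add: field_simps)
  have "(fwd_diff ^^ Suc k) (\<lambda>y. poi y \<theta>) y
      = poi (Suc (y + k)) \<theta> * charlier \<theta> k (Suc (y + k)) - poi (y + k) \<theta> * charlier \<theta> k (y + k)"
    by (simp add: fwd_diff_def Suc.IH)
  also have "\<dots> = poi (Suc (y + k)) \<theta> * charlier \<theta> (Suc k) (Suc (y + k))"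
    unfolding p by (simp add: algebra_simps)
  finally show ?case by simp
qed simp

abbreviation rising :: "nat \<Rightarrow> nat \<Rightarrow> real" where
  "rising k y \<equiv> pochhammer (real y + 1) k"

abbreviation fdiff :: "nat \<Rightarrow> (nat \<Rightarrow> real) \<Rightarrow> nat \<Rightarrow> real" where
  "fdiff k \<equiv> fwd_diff ^^ k"

text \<open>The weights \<open>(y + 1) \<cdots> (y + k)\<close> turn one of the two Poisson factors at \<open>y + k\<close> into
  \<open>\<theta> ^ k\<close> times the one at \<open>y\<close>, which cancels the norm of the Charlier polynomial.\<close>

lemma sum_sq_fwd_diff_poi_le:
  assumes "0 \<le> \<theta>"
  shows "(\<Sum>y<Y. rising k y * (fdiff k (\<lambda>y. poi y \<theta>) y)\<^sup>2) \<le> fact k"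
proof (cases "\<theta> = 0")
  \<comment> \<open>Charlier polynomials divide by \<theta>, so the rate 0 is checked directly: only
    y = 0 contributes, with difference (-1)^k and weight k!.\<close>
  case True
  have z: "fdiff k (\<lambda>y. poi y 0) y = (if y = 0 then (-1) ^ k else 0)" for y
    by (induction k arbitrary: y) (auto simp: poi_def fwd_diff_def)
  have "(\<Sum>y<Y. rising k y * (fdiff k (\<lambda>y. poi y \<theta>) y)\<^sup>2)
      = (\<Sum>y<Y. if y = 0 then fact k else 0)"
    unfolding True z by (intro sum.cong) (auto simp: pochhammer_fact[symmetric] power_mult[symmetric] mult.commute[of k])
  also have "\<dots> \<le> fact k" by (simp add: sum.delta)
  finally show ?thesis .
next
  case False
  with assms have t: "0 < \<theta>" by simp
  have w: "rising k y * poi (y + k) \<theta> = \<theta> ^ k * poi y \<theta>" for y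
  proof -
    have "fact (y + k) = (fact y * rising k y :: real)"
      using pochhammer_product'[of "1::real" y k] by (simp add: pochhammer_fact add.commute)
    moreover have "rising k y > 0" by (intro pochhammer_pos) auto
    ultimately show ?thesis by (simp add: poi_def power_add)
  qed
  have "(\<Sum>y<Y. rising k y * (fdiff k (\<lambda>y. poi y \<theta>) y)\<^sup>2)
     = (\<Sum>y<Y. \<theta> ^ k * poi y \<theta> * (poi (y + k) \<theta> * (charlier \<theta> k (y + k))\<^sup>2))"
    unfolding fwd_diff_poi_charlier[OF t] w[symmetric] by (simp add: power2_eq_square mult_ac)
  also have "\<dots> \<le> (\<Sum>y<Y. \<theta> ^ k * (poi (y + k) \<theta> * (charlier \<theta> k (y + k))\<^sup>2))"
    using assms poi_le_1[OF assms] poi_nonneg[OF assms] by (intro sum_mono mult_right_mono mult_left_le) auto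
  also have "\<dots> = \<theta> ^ k * (\<Sum>y\<in>{0+k..<Y+k}. poi y \<theta> * (charlier \<theta> k y)\<^sup>2)"
    unfolding sum.shift_bounds_nat_ivl by (simp add: sum_distrib_left lessThan_atLeast0)
  also have "\<dots> \<le> \<theta> ^ k * (fact k / \<theta> ^ k)"
    using assms by (intro mult_left_mono sum_le_sums[OF charlier_norm[OF t]]) (auto simp: poi_nonneg)
  also have "\<dots> = fact k" using t by simp
  finally show ?thesis .
qed

section \<open>Finite differences of a Poisson mixture\<close>

context rplus_prob
begin

lemma fwd_diff_funpow_mix:
  "integrable G (\<lambda>\<theta>. fdiff k (\<lambda>y. poi y \<theta>) y) \<and>
   fdiff k (mix G) y = (\<integral>\<theta>. fdiff k (\<lambda>y. poi y \<theta>) y \<partial>G)"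
proof (induction k arbitrary: y)
  case (Suc k)
  then show ?case by (simp add: fwd_diff_def[of "fdiff k _"])
qed (simp add: integrable_poi mix_def)

text \<open>Jensen's inequality for a quadratic form. With a the average of u, integrating 2 a u
  \<le> u^2 + a^2 gives twice the sum for a on the left and one copy of it on the right, which
  cancels.\<close>

lemma sum_sq_fwd_diff_mix_le:
  "(\<Sum>y<Y. rising k y * (fdiff k (mix G) y)\<^sup>2) \<le> fact k"
proof -
  define u where "u y = (\<lambda>\<theta>. fdiff k (\<lambda>y. poi y \<theta>) y)" for y
  define w where "w y = rising k y" for y
  define a where "a y = fdiff k (mix G) y" for y
  have u: "integrable G (u y)" "a y = integral\<^sup>L G (u y)" for y
    using fwd_diff_funpow_mix[of k y] by (simp_all add: u_def a_def)
  have w: "0 < w y" for y unfolding w_def by (intro pochhammer_pos) auto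
  have le: "(\<Sum>y<Y. w y * (u y \<theta>)\<^sup>2) \<le> fact k" if "0 \<le> \<theta>" for \<theta>
    using sum_sq_fwd_diff_poi_le[OF that] by (simp add: u_def w_def)
  have "2 * (\<Sum>y<Y. w y * (a y)\<^sup>2) = (\<integral>\<theta>. (\<Sum>y<Y. 2 * w y * a y * u y \<theta>) \<partial>G)"
    using u by (simp add: power2_eq_square sum_distrib_left mult_ac)
  also have "\<dots> \<le> (\<integral>\<theta>. fact k + (\<Sum>y<Y. w y * (a y)\<^sup>2) \<partial>G)"
  proof (intro integral_mono_G)
    fix \<theta> :: real assume t: "0 \<le> \<theta>"
    have "(\<Sum>y<Y. 2 * w y * a y * u y \<theta>) \<le> (\<Sum>y<Y. w y * (u y \<theta>)\<^sup>2 + w y * (a y)\<^sup>2)"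
    proof (intro sum_mono)
      fix y
      have "w y * (2 * a y * u y \<theta>) \<le> w y * ((u y \<theta>)\<^sup>2 + (a y)\<^sup>2)"
        using w[of y] sum_squares_bound[of "a y" "u y \<theta>"] by (intro mult_left_mono) auto
      then show "2 * w y * a y * u y \<theta> \<le> w y * (u y \<theta>)\<^sup>2 + w y * (a y)\<^sup>2"
        by (simp add: algebra_simps)
    qed
    also have "\<dots> \<le> fact k + (\<Sum>y<Y. w y * (a y)\<^sup>2)"
      using le[OF t] by (simp add: sum.distrib)
    finally show "(\<Sum>y<Y. 2 * w y * a y * u y \<theta>) \<le> fact k + (\<Sum>y<Y. w y * (a y)\<^sup>2)" .
  qed (auto intro!: u)
  also have "\<dots> = fact k + (\<Sum>y<Y. w y * (a y)\<^sup>2)"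
    by (simp add: prob_space)
  finally show ?thesis by (simp add: w_def a_def)
qed

end

section \<open>Interpolation between differences\<close>

lemma sum_mult_le_sqrt:
  fixes f g :: "'a \<Rightarrow> real"
  assumes "\<And>x. x \<in> A \<Longrightarrow> 0 \<le> f x" "\<And>x. x \<in> A \<Longrightarrow> 0 \<le> g x"
    and "(\<Sum>x\<in>A. (f x)\<^sup>2) \<le> s" "(\<Sum>x\<in>A. (g x)\<^sup>2) \<le> t"
  shows "(\<Sum>x\<in>A. f x * g x) \<le> sqrt s * sqrt t"
proof -
  have "(\<Sum>x\<in>A. f x * g x) = (\<Sum>x\<in>A. \<bar>f x\<bar> * \<bar>g x\<bar>)"
    using assms(1,2) by (intro sum.cong) auto
  also have "\<dots> \<le> L2_set f A * L2_set g A"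
    by (rule L2_set_mult_ineq)
  also have "\<dots> \<le> sqrt s * sqrt t"
  proof -
    have "0 \<le> (\<Sum>x\<in>A. (f x)\<^sup>2)" "0 \<le> (\<Sum>x\<in>A. (g x)\<^sup>2)"
      by (simp_all add: sum_nonneg)
    then show ?thesis
      unfolding L2_set_def using assms(3,4) by (intro mult_mono) auto
  qed
  finally show ?thesis .
qed

text \<open>Otherwise z would dominate a multiple of the harmonic series. This disposes of the
  boundary term in the summation by parts, along suitably chosen cutoffs.\<close>

lemma summable_imp_small_term:
  fixes z :: "nat \<Rightarrow> real"
  assumes "summable z" "\<And>n. 0 \<le> z n" "0 < e"
  shows "\<exists>n\<ge>m. real (Suc n) * z n < e"
proof (rule ccontr)
  assume "\<not> ?thesis"
  then have ge: "e \<le> real (Suc n) * z n" if "n \<ge> m" for n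
    using that by auto
  have "summable (\<lambda>n. e * (1 / of_nat (Suc n)))"
  proof (rule summable_comparison_test')
    show "summable z" by fact
    fix n assume "n \<ge> m"
    from ge[OF this] show "norm (e * (1 / of_nat (Suc n))) \<le> z n"
      using assms(3) by (simp add: divide_simps mult.commute)
  qed
  then have "summable (\<lambda>n. 1 / (of_nat (Suc n) :: real))"
    using assms(3) by (subst (asm) summable_cmult_iff) auto
  then have "summable (\<lambda>n. 1 / (of_nat n :: real))"
    by (subst (asm) summable_Suc_iff)
  then show False
    using not_summable_harmonic[where 'a = real] by (simp add: inverse_eq_divide)
qed

text \<open>Summation by parts produces a weight at \<open>x\<close> where one at \<open>x + 1\<close> is wanted.  Attaching the
  difference to the smaller of the two weights \<open>v0\<close>, \<open>v1\<close> avoids a loss in the leading term.\<close>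

lemma summation_by_parts_term_le:
  fixes v0 v1 w X J b g1 d0 d1 :: real
  assumes "0 < v0" "0 < v1" "0 < w" "1 \<le> X" "0 \<le> J" "0 \<le> b"
    and dv: "\<bar>v1 - v0\<bar> \<le> v1 * (b / sqrt X)"
  shows "\<bar>g1 * ((X + J) * w * v1 * d1 - X * w * v0 * d0)\<bar>
    \<le> (sqrt (w * v1) * \<bar>g1\<bar>) * (sqrt (X * (X + J) * w * v0) * \<bar>d1 - d0\<bar>
        + sqrt J * (sqrt ((X + J) * w * v1) * \<bar>d1\<bar>)
        + b * (sqrt ((X + J) * w * v1) * \<bar>d1\<bar> + sqrt (X * w * v0) * \<bar>d0\<bar>))"
proof -
  define m where "m = min v0 v1"
  define d where "d = (if v0 \<le> v1 then d1 else d0)"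
  define P where "P = sqrt v1 * (sqrt (X * (X + J) * v0) * \<bar>d1 - d0\<bar>)"
  define Q where "Q = sqrt v1 * (sqrt ((X + J) * v1) * \<bar>d1\<bar>)"
  define R where "R = sqrt v1 * (sqrt (X * v0) * \<bar>d0\<bar>)"
  \<comment> \<open>With X = x + 1, J = j + 1 and w the rising factor of order j at x + 1, the
    weights of order j + 1 at x + 1 and x are (X + J) w v1 and X w v0. The three parts are the
    second difference, the increment of the rising factor and the variation of v.\<close>
  have split: "(X + J) * v1 * d1 - X * v0 * d0 = X * m * (d1 - d0) + J * v1 * d1 + X * (v1 - v0) * d"
    by (auto simp: m_def d_def min_def algebra_simps)
  have sq: "sqrt v1 * sqrt v1 = v1" "sqrt X * sqrt X = X" "sqrt J * sqrt J = J"
    using assms by auto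
  have "m * m \<le> v1 * v0" "0 < m"
    using assms by (auto simp: m_def min_def intro: mult_mono)
  then have m: "m \<le> sqrt v1 * sqrt v0"
    by (simp add: real_sqrt_mult[symmetric] real_le_rsqrt power2_eq_square)
  have 1: "\<bar>X * m * (d1 - d0)\<bar> \<le> P"
  proof -
    have "X \<le> sqrt (X * (X + J))"
      using assms by (intro real_le_rsqrt) (simp add: power2_eq_square)
    then have "X * m \<le> sqrt (X * (X + J)) * (sqrt v1 * sqrt v0)"
      using assms m \<open>0 < m\<close> by (intro mult_mono) auto
    then have "X * m * \<bar>d1 - d0\<bar> \<le> sqrt (X * (X + J)) * (sqrt v1 * sqrt v0) * \<bar>d1 - d0\<bar>"
      by (intro mult_right_mono) auto
    moreover have "\<bar>X * m * (d1 - d0)\<bar> = X * m * \<bar>d1 - d0\<bar>"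
      using assms \<open>0 < m\<close> by (simp add: abs_mult)
    ultimately show ?thesis
      by (simp add: P_def real_sqrt_mult mult_ac)
  qed
  have Q: "Q = v1 * (sqrt (X + J) * \<bar>d1\<bar>)"
    unfolding Q_def real_sqrt_mult using sq by (simp add: mult_ac)
  have 2: "\<bar>J * v1 * d1\<bar> \<le> sqrt J * Q"
  proof -
    have "J \<le> sqrt J * sqrt (X + J)"
      using assms sq(3) mult_left_mono[of "sqrt J" "sqrt (X + J)" "sqrt J"] by simp
    then have "J * (v1 * \<bar>d1\<bar>) \<le> sqrt J * sqrt (X + J) * (v1 * \<bar>d1\<bar>)"
      using assms by (intro mult_right_mono) auto
    then show ?thesis using assms by (simp add: Q abs_mult mult_ac)
  qed
  have 3: "\<bar>X * (v1 - v0) * d\<bar> \<le> b * (Q + R)"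
  proof -
    have "X * \<bar>v1 - v0\<bar> \<le> X * (v1 * (b / sqrt X))"
      using assms by (intro mult_left_mono) auto
    also have "\<dots> = sqrt X * v1 * b"
      using assms sq(2) by (simp add: field_simps)
    finally have "X * \<bar>v1 - v0\<bar> * \<bar>d\<bar> \<le> sqrt X * v1 * b * \<bar>d\<bar>"
      by (intro mult_right_mono) auto
    also have "sqrt X * v1 * b * \<bar>d\<bar> = b * (sqrt X * (v1 * \<bar>d\<bar>))" by simp
    also have "sqrt X * (v1 * \<bar>d\<bar>) \<le> Q + R"
    proof (cases "v0 \<le> v1")
      case True
      have "sqrt X * (v1 * \<bar>d1\<bar>) \<le> sqrt (X + J) * (v1 * \<bar>d1\<bar>)"
        using assms by (intro mult_right_mono) auto
      moreover have "0 \<le> R" using assms by (simp add: R_def)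
      ultimately show ?thesis using True by (simp add: Q d_def mult_ac)
    next
      case False
      have "sqrt X * (v1 * \<bar>d0\<bar>) \<le> sqrt X * ((sqrt v1 * sqrt v0) * \<bar>d0\<bar>)"
        using assms m False by (intro mult_left_mono mult_right_mono) (auto simp: m_def)
      moreover have "0 \<le> Q" using assms by (simp add: Q)
      ultimately show ?thesis using False by (simp add: R_def d_def real_sqrt_mult mult_ac)
    qed
    then have "b * (sqrt X * (v1 * \<bar>d\<bar>)) \<le> b * (Q + R)"
      using assms by (intro mult_left_mono)
    finally show ?thesis using assms by (simp add: abs_mult)
  qed
  have "\<bar>g1 * ((X + J) * w * v1 * d1 - X * w * v0 * d0)\<bar> = w * \<bar>g1\<bar> * \<bar>(X + J) * v1 * d1 - X * v0 * d0\<bar>"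
  proof -
    have "g1 * ((X + J) * w * v1 * d1 - X * w * v0 * d0) = w * g1 * ((X + J) * v1 * d1 - X * v0 * d0)"
      by (simp add: algebra_simps)
    then show ?thesis using \<open>0 < w\<close> by (simp only: abs_mult abs_of_pos)
  qed
  also have "\<dots> \<le> w * \<bar>g1\<bar> * (P + sqrt J * Q + b * (Q + R))"
    unfolding split using 1 2 3 assms by (intro mult_left_mono) auto
  also have "\<dots> = (sqrt w * sqrt w) * \<bar>g1\<bar> * (P + sqrt J * Q + b * (Q + R))"
    using assms by simp
  finally show ?thesis
    unfolding P_def Q_def R_def real_sqrt_mult by (simp only: algebra_simps)
qed

lemma sum_by_parts:
  fixes V g :: "nat \<Rightarrow> real"
  shows "(\<Sum>y<Suc Z. V y * (g (Suc y) - g y))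
    = V Z * g (Suc Z) - V 0 * g 0 - (\<Sum>x<Z. g (Suc x) * (V (Suc x) - V x))"
  by (induction Z) (auto simp: algebra_simps)

text \<open>The weight v may vary, but only by a relative amount b / sqrt (y + 1). At this scale,
  letting a difference fall on v costs b times a product of two root energies and no power of y.
  \<open>energy k\<close> is S_k, which \<open>smb\<close> and \<open>v_le\<close> make
  finite.\<close>

locale weighted_differences =
  fixes v h :: "nat \<Rightarrow> real" and b c :: real
  assumes v_pos: "0 < v y" and v_le: "v y \<le> c" and b_nonneg: "0 \<le> b"
    and dv: "\<bar>v (Suc y) - v y\<bar> \<le> v (Suc y) * (b / sqrt (real (Suc y)))"
    and smb: "summable (\<lambda>y. rising k y * (fdiff k h y)\<^sup>2)"
begin

definition energy :: "nat \<Rightarrow> real" where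
  "energy k = (\<Sum>y. rising k y * v y * (fdiff k h y)\<^sup>2)"

lemma poch_pos: "0 < rising k y"
  by (intro pochhammer_pos) auto

lemma summable_energy: "summable (\<lambda>y. rising k y * v y * (fdiff k h y)\<^sup>2)"
proof (rule summable_comparison_test')
  show "summable (\<lambda>y. c * (rising k y * (fdiff k h y)\<^sup>2))"
    by (intro summable_mult smb)
  fix y :: nat
  have "v y * (rising k y * (fdiff k h y)\<^sup>2)
     \<le> c * (rising k y * (fdiff k h y)\<^sup>2)"
    using poch_pos[of y k] by (intro mult_right_mono v_le) auto
  then show "norm (rising k y * v y * (fdiff k h y)\<^sup>2)
    \<le> c * (rising k y * (fdiff k h y)\<^sup>2)"
    using poch_pos[of y k] v_pos[of y] by (simp add: abs_mult mult_ac)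
qed

lemma energy_nonneg: "0 \<le> energy k"
  unfolding energy_def using poch_pos v_pos by (intro suminf_nonneg summable_energy) (auto simp: less_imp_le)

lemma sum_le_energy:
  "finite A \<Longrightarrow> (\<Sum>y\<in>A. rising k y * v y * (fdiff k h y)\<^sup>2) \<le> energy k"
  unfolding energy_def using poch_pos v_pos by (intro sum_le_suminf summable_energy) (auto simp: less_imp_le)

text \<open>One difference of order j + 1 is moved by parts from the order j onto the weighted
  factor, and Cauchy-Schwarz is applied to each resulting product. The sqrt (j + 1) stems from the
  growth of the rising factor, the 2 b from the variation of v.\<close>

lemma energy_step:
  "energy (Suc j) \<le> sqrt (energy j) *
     (sqrt (energy (Suc (Suc j))) + (sqrt (real (Suc j)) + 2 * b) * sqrt (energy (Suc j)))"
proof -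
  define W where "W k y = rising k y" for k y
  define D where "D k = fdiff k h" for k
  define p where "p k y = sqrt (W k y * v y) * \<bar>D k y\<bar>" for k y
  define V where "V y = W (Suc j) y * v y * D (Suc j) y" for y
  have Wpos: "0 < W k y" for k y
    unfolding W_def by (rule poch_pos)
  have D_Suc: "D (Suc k) y = D k (Suc y) - D k y" for k y
    by (simp add: D_def fwd_diff_def)
  have W_rec: "W (Suc k) y = (real y + 1) * W k (Suc y)" for k y
    by (simp add: W_def pochhammer_rec add_ac)
  have W_Suc: "W (Suc k) y = (real y + 1 + real k) * W k y" for k y
    by (simp add: W_def pochhammer_Suc mult.commute)
  have p_nonneg: "0 \<le> p k y" for k y
    by (simp add: p_def less_imp_le[OF Wpos] less_imp_le[OF v_pos])
  have p_sq: "(p k y)\<^sup>2 = W k y * v y * (D k y)\<^sup>2" for k y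
    by (simp add: p_def power_mult_distrib less_imp_le[OF Wpos] less_imp_le[OF v_pos])
  have p_sum: "(\<Sum>y\<in>A. (p k y)\<^sup>2) \<le> energy k" if "finite A" for A k
    using sum_le_energy[OF that, of k] by (simp add: p_sq W_def D_def)
  have p_sum_Suc: "(\<Sum>y<Z. (p k (Suc y))\<^sup>2) \<le> energy k" for Z k
    using p_sum[of "Suc ` {..<Z}" k] by (simp add: sum.reindex)
  let ?s = "\<lambda>k. sqrt (energy k)"
  let ?J = "sqrt (real (Suc j))"
  have by_parts: "\<bar>D j (Suc x) * (V (Suc x) - V x)\<bar> \<le> p j (Suc x) *
      (p (Suc (Suc j)) x + ?J * p (Suc j) (Suc x) + b * (p (Suc j) (Suc x) + p (Suc j) x))" for x
  proof -
    have "W (Suc j) (Suc x) = (real (Suc x) + real (Suc j)) * W j (Suc x)"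
      "W (Suc j) x = real (Suc x) * W j (Suc x)"
      "W (Suc (Suc j)) x = real (Suc x) * (real (Suc x) + real (Suc j)) * W j (Suc x)"
      unfolding W_rec[of _ x] W_Suc[of _ "Suc x"] by (simp_all add: algebra_simps)
    then show ?thesis
      using summation_by_parts_term_le[OF v_pos[of x] v_pos[of "Suc x"] Wpos[of j "Suc x"] _ _ b_nonneg dv[of x], 
          of "real (Suc j)" "D j (Suc x)" "D (Suc j) (Suc x)" "D (Suc j) x"]
      unfolding V_def p_def D_Suc[of "Suc j" x] by (simp del: of_nat_Suc)
  qed
  \<comment> \<open>At y = 0 the rising factor of order j + 1 is j + 1 times that of order j. The
    boundary term thus fits as the summand x = 0 missing from the sum with coefficient
    \<open>?J\<close>.\<close>
  have zero: "\<bar>V 0 * D j 0\<bar> \<le> ?J * (p j 0 * p (Suc j) 0)"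
  proof -
    have W0: "W (Suc j) 0 = ?J * ?J * W j 0"
      using W_Suc[of j 0] by simp
    have "\<bar>V 0 * D j 0\<bar> = W (Suc j) 0 * v 0 * \<bar>D (Suc j) 0\<bar> * \<bar>D j 0\<bar>"
      using Wpos[of "Suc j" 0] v_pos[of 0] by (simp add: V_def abs_mult)
    also have "\<dots> = ?J * ((sqrt (W j 0) * sqrt (v 0) * \<bar>D j 0\<bar>) * (?J * sqrt (W j 0) * sqrt (v 0) * \<bar>D (Suc j) 0\<bar>))"
      unfolding W0 using Wpos[of j 0] v_pos[of 0] by (simp add: mult_ac del: of_nat_Suc)
    also have "\<dots> = ?J * (p j 0 * p (Suc j) 0)"
      unfolding p_def W0 by (simp add: real_sqrt_mult mult_ac del: of_nat_Suc)
    finally show ?thesis by simp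
  qed
  let ?R = "?s j * (?s (Suc (Suc j)) + (?J + 2 * b) * ?s (Suc j))"
  have partial: "(\<Sum>y<Suc Z. (p (Suc j) y)\<^sup>2) \<le> \<bar>V Z * D j (Suc Z)\<bar> + ?R" for Z
  proof -
    have c1: "(\<Sum>x<Z. p j (Suc x) * p (Suc (Suc j)) x) \<le> ?s j * ?s (Suc (Suc j))"
      by (intro sum_mult_le_sqrt p_nonneg p_sum p_sum_Suc) auto
    have c2: "(\<Sum>x<Suc Z. p j x * p (Suc j) x) \<le> ?s j * ?s (Suc j)"
      by (intro sum_mult_le_sqrt p_nonneg p_sum p_sum_Suc) auto
    have c3: "(\<Sum>x<Z. p j (Suc x) * p (Suc j) (Suc x)) \<le> ?s j * ?s (Suc j)"
      by (intro sum_mult_le_sqrt p_nonneg p_sum p_sum_Suc)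
    have c4: "(\<Sum>x<Z. p j (Suc x) * p (Suc j) x) \<le> ?s j * ?s (Suc j)"
      by (intro sum_mult_le_sqrt p_nonneg p_sum p_sum_Suc) auto
    have "(\<Sum>y<Suc Z. (p (Suc j) y)\<^sup>2) = (\<Sum>y<Suc Z. V y * (D j (Suc y) - D j y))"
      unfolding p_sq V_def D_Suc[symmetric] by (simp add: power2_eq_square mult_ac)
    also have "\<dots> = V Z * D j (Suc Z) - V 0 * D j 0 - (\<Sum>x<Z. D j (Suc x) * (V (Suc x) - V x))"
      by (rule sum_by_parts)
    also have "\<dots> \<le> \<bar>V Z * D j (Suc Z)\<bar> + \<bar>V 0 * D j 0\<bar> + (\<Sum>x<Z. \<bar>D j (Suc x) * (V (Suc x) - V x)\<bar>)"
      using sum_abs[of "\<lambda>x. D j (Suc x) * (V (Suc x) - V x)" "{..<Z}"] by linarith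
    also have "\<dots> \<le> \<bar>V Z * D j (Suc Z)\<bar> + ?J * (p j 0 * p (Suc j) 0) + (\<Sum>x<Z. p j (Suc x) *
      (p (Suc (Suc j)) x + ?J * p (Suc j) (Suc x) + b * (p (Suc j) (Suc x) + p (Suc j) x)))"
      by (intro add_mono zero sum_mono by_parts order_refl)
    also have "\<dots> = \<bar>V Z * D j (Suc Z)\<bar> + ((\<Sum>x<Z. p j (Suc x) * p (Suc (Suc j)) x)
       + ?J * (\<Sum>x<Suc Z. p j x * p (Suc j) x)
       + b * ((\<Sum>x<Z. p j (Suc x) * p (Suc j) (Suc x)) + (\<Sum>x<Z. p j (Suc x) * p (Suc j) x)))"
      by (subst sum.lessThan_Suc_shift)
         (simp add: sum.distrib sum_distrib_left algebra_simps del: of_nat_Suc)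
    also have "\<dots> \<le> \<bar>V Z * D j (Suc Z)\<bar> + (?s j * ?s (Suc (Suc j)) + ?J * (?s j * ?s (Suc j))
       + b * (?s j * ?s (Suc j) + ?s j * ?s (Suc j)))"
      using b_nonneg by (intro add_mono mult_left_mono c1 c2 c3 c4 order_refl) auto
    also have "\<dots> = \<bar>V Z * D j (Suc Z)\<bar> + ?R"
      by (simp add: algebra_simps)
    finally show ?thesis .
  qed
  \<comment> \<open>The upper boundary term is at most c (x + 1) z x with z summable. A priori this
    need not tend to 0, but it is small at arbitrarily large x, which suffices since the partial
    sums on the left increase.\<close>
  define z where "z x = W (Suc j) x * (D (Suc j) x)\<^sup>2 + W j (Suc x) * (D j (Suc x))\<^sup>2" for x
  have z_nonneg: "0 \<le> z x" for x
    using Wpos by (simp add: z_def less_imp_le)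
  have "summable z"
    unfolding z_def using smb[of "Suc j"] smb[of j, THEN summable_ignore_initial_segment, of 1] 
    by (intro summable_add) (simp_all add: W_def D_def)
  have boundary: "\<bar>V x * D j (Suc x)\<bar> \<le> c * (real (Suc x) * z x)" for x
  proof -
    let ?w = "W j (Suc x)" and ?X = "real (Suc x)"
    have WX: "W (Suc j) x = ?X * ?w" by (simp add: W_rec)
    have "\<bar>V x * D j (Suc x)\<bar> = v x * (?X * (?w * (\<bar>D (Suc j) x\<bar> * \<bar>D j (Suc x)\<bar>)))"
      using Wpos[of j "Suc x"] v_pos[of x] by (simp add: V_def WX abs_mult mult_ac)
    also have "\<dots> \<le> c * (?X * (?w * (\<bar>D (Suc j) x\<bar> * \<bar>D j (Suc x)\<bar>)))"
      using Wpos[of j "Suc x"] by (intro mult_right_mono v_le) auto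
    also have "\<dots> \<le> c * (?X * (?w * ((D (Suc j) x)\<^sup>2 + (D j (Suc x))\<^sup>2)))"
    proof -
      have "\<bar>r\<bar> * \<bar>s\<bar> \<le> r\<^sup>2 + s\<^sup>2" for r s :: real
      proof -
        have "2 * \<bar>r\<bar> * \<bar>s\<bar> \<le> r\<^sup>2 + s\<^sup>2"
          using sum_squares_bound[of "\<bar>r\<bar>" "\<bar>s\<bar>"] by simp
        moreover have "0 \<le> \<bar>r\<bar> * \<bar>s\<bar>" by simp
        ultimately show ?thesis by linarith
      qed
      then show ?thesis
        using Wpos[of j "Suc x"] v_pos[of x] v_le[of x] by (intro mult_left_mono) auto
    qed
    also have "?w * ((D (Suc j) x)\<^sup>2 + (D j (Suc x))\<^sup>2) \<le> z x"
      using Wpos[of j "Suc x"] mult_right_mono[of 1 ?X "?w * (D (Suc j) x)\<^sup>2"] 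
      by (simp add: z_def WX algebra_simps)
    finally show ?thesis
      using v_pos[of x] v_le[of x] by (simp add: mult_left_mono)
  qed
  have c: "0 < c" using v_pos[of 0] v_le[of 0] by simp
  have "energy (Suc j) = (\<Sum>y. rising (Suc j) y * v y * (fdiff (Suc j) h y)\<^sup>2)"
    by (rule energy_def)
  also have "\<dots> \<le> ?R"
  proof (rule suminf_le_const[OF summable_energy])
    fix Y :: nat
    have "(\<Sum>y<Y. (p (Suc j) y)\<^sup>2) \<le> ?R"
    proof (rule field_le_epsilon)
      fix e :: real assume e: "0 < e"
      with c have "0 < e / c" by simp
      from summable_imp_small_term[OF \<open>summable z\<close> z_nonneg this, of Y]
      obtain Z where Z: "Z \<ge> Y" "real (Suc Z) * z Z < e / c" by blast
      have "(\<Sum>y<Y. (p (Suc j) y)\<^sup>2) \<le> (\<Sum>y<Suc Z. (p (Suc j) y)\<^sup>2)"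
        using Z by (intro sum_mono2) auto
      also have "\<dots> \<le> \<bar>V Z * D j (Suc Z)\<bar> + ?R" by (rule partial)
      also have "\<bar>V Z * D j (Suc Z)\<bar> \<le> e"
        using boundary[of Z] Z(2) c by (simp add: field_simps)
      finally show "(\<Sum>y<Y. (p (Suc j) y)\<^sup>2) \<le> ?R + e" by simp
    qed
    then show "(\<Sum>y<Y. rising (Suc j) y * v y * (fdiff (Suc j) h y)\<^sup>2) \<le> ?R"
      by (simp add: p_sq W_def D_def)
  qed
  finally show ?thesis .
qed

end

text \<open>In terms of the ratios x (j + 1) / x j, \<open>step\<close> says that a ratio exceeds
  the next one by at most B. If the first ratio were above k B + T, all k ratios would stay above T,
  and x k would exceed T ^ k s.\<close>

lemma interpolation_chain:
  fixes x :: "nat \<Rightarrow> real"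
  assumes k: "1 \<le> k" and s: "0 < s" "x 0 \<le> s" and x: "\<And>j. 0 \<le> x j" and B: "0 \<le> B" and T: "0 < T"
    and step: "\<And>j. Suc j < k \<Longrightarrow> (x (Suc j))\<^sup>2 \<le> x j * (x (Suc (Suc j)) + B * x (Suc j))"
    and last: "x k \<le> T ^ k * s"
  shows "x 1 \<le> (real k * B + T) * s"
proof (rule ccontr)
  assume neg: "\<not> ?thesis"
  \<comment> \<open>Replacing x 0 by the larger s > 0 keeps the first ratio meaningful even if x 0
    vanishes.\<close>
  define y where "y j = (if j = 0 then s else x j)" for j
  have main: "j < k \<Longrightarrow> 0 < y j \<and> ((real k - real j) * B + T) * y j < y (Suc j)" for j
  proof (induction j)
    case 0
    then show ?case using neg s by (simp add: y_def)
  next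
    case (Suc j)
    then have IH: "0 < y j" "((real k - real j) * B + T) * y j < y (Suc j)" and j: "Suc j < k" by auto
    have "0 < ((real k - real j) * B + T) * y j"
      using IH(1) j B T by (intro mult_pos_pos add_nonneg_pos mult_nonneg_nonneg) auto
    with IH(2) have pos: "0 < x (Suc j)" by (simp add: y_def)
    have "(x (Suc j))\<^sup>2 \<le> x j * (x (Suc (Suc j)) + B * x (Suc j))"
      by (rule step[OF j])
    also have "\<dots> \<le> y j * (x (Suc (Suc j)) + B * x (Suc j))"
      using s x B by (intro mult_right_mono) (auto simp: y_def)
    finally have 1: "x (Suc j) * x (Suc j) \<le> y j * (x (Suc (Suc j)) + B * x (Suc j))"
      by (simp add: power2_eq_square)
    have "((real k - real j) * B + T) * y j * x (Suc j) < x (Suc j) * x (Suc j)"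
      using IH(2) pos by (intro mult_strict_right_mono) (auto simp: y_def)
    also note 1
    finally have "y j * (((real k - real j) * B + T) * x (Suc j)) < y j * (x (Suc (Suc j)) + B * x (Suc j))"
      by (simp add: mult_ac)
    then have "((real k - real j) * B + T) * x (Suc j) < x (Suc (Suc j)) + B * x (Suc j)"
      using IH(1) by simp
    then show ?case using pos by (simp add: y_def algebra_simps)
  qed
  have grow: "j \<le> k \<Longrightarrow> T ^ j * s \<le> y j \<and> (0 < j \<longrightarrow> T ^ j * s < y j)" for j
  proof (induction j)
    case (Suc j)
    then have j: "j < k" and IH: "T ^ j * s \<le> y j" by auto
    have "T ^ Suc j * s = T * (T ^ j * s)" by simp
    also have "\<dots> \<le> T * y j" using IH T by (intro mult_left_mono) auto
    also have "\<dots> \<le> ((real k - real j) * B + T) * y j"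
      using main[OF j] j B by (intro mult_right_mono) auto
    also have "\<dots> < y (Suc j)" using main[OF j] by simp
    finally show ?case by auto
  qed (simp add: y_def)
  from grow[of k] k last show False by (simp add: y_def)
qed

section \<open>Two mixtures\<close>

context rplus_prob
begin

lemma fwd_diff_mix_regularized_le:
  assumes "0 < \<rho>"
  shows "\<bar>scaled_diff (mix G) (max (mix G y) \<rho>) y\<bar>
    \<le> 2 * sqrt (real y + 1) * reg_log (max (mix G y) \<rho>)"
proof -
  let ?m = "max (mix G y) \<rho>"
  have m: "0 < ?m" using assms by simp
  have "\<bar>(real y + 1) * (fwd_diff (mix G) y / ?m)\<bar> = (real y + 1) * \<bar>fwd_diff (mix G) y\<bar> / ?m"
    using m by (simp add: abs_mult)
  also have "\<dots> \<le> (2 * sqrt (real y + 1) * ?m * reg_log ?m) / ?m"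
    using m by (intro divide_right_mono fwd_diff_mix_le) auto
  also have "\<dots> = 2 * sqrt (real y + 1) * reg_log ?m"
    using m by simp
  finally show ?thesis .
qed

lemma sq_fwd_diff_mix_regularized_le:
  assumes "0 < \<rho>"
  shows "(scaled_diff (mix G) (max (mix G y) \<rho>) y)\<^sup>2
    \<le> 4 * (real y + 1) * (reg_log (max (mix G y) \<rho>))\<^sup>2"
proof -
  have "(scaled_diff (mix G) (max (mix G y) \<rho>) y)\<^sup>2 \<le>
      (2 * sqrt (real y + 1) * reg_log (max (mix G y) \<rho>))\<^sup>2"
    using fwd_diff_mix_regularized_le[OF assms, of y] by (rule power2_le_iff_abs_le[THEN iffD2, rotated])
      (use reg_log_ge[of "max (mix G y) \<rho>"] in auto)
  then show ?thesis by (simp add: power_mult_distrib)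
qed

text \<open>The source of the slow variation of the weight: relative to max f \<rho>, one step
  changes a mixture by O(log (1 / \<rho>) / sqrt (y + 1)).\<close>

lemma fwd_diff_mix_relative_le:
  assumes "0 < \<rho>"
  shows "\<bar>fwd_diff (mix G) y\<bar> / max (mix G y) \<rho> \<le> 2 * reg_log \<rho> / sqrt (real (Suc y))"
proof -
  let ?m = "max (mix G y) \<rho>"
  have "\<bar>(real y + 1) * (fwd_diff (mix G) y / ?m)\<bar> \<le> 2 * sqrt (real y + 1) * reg_log ?m"
    by (rule fwd_diff_mix_regularized_le[OF assms])
  also have "\<dots> \<le> 2 * sqrt (real y + 1) * reg_log \<rho>"
    using assms by (intro mult_left_mono reg_log_antimono) auto
  finally have "sqrt (real y + 1) * (sqrt (real y + 1) * (\<bar>fwd_diff (mix G) y\<bar> / ?m)) \<le> sqrt (real y + 1) * (2 * reg_log \<rho>)"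
    using assms by (simp add: abs_mult mult_ac)
  then have "sqrt (real y + 1) * (\<bar>fwd_diff (mix G) y\<bar> / ?m) \<le> 2 * reg_log \<rho>"
    by (subst (asm) mult_le_cancel_left_pos) auto
  then show ?thesis
    using assms by (simp add: field_simps)
qed

end

lemma summable_hellinger:
  fixes f g :: "nat \<Rightarrow> real"
  assumes "summable f" "summable g" "\<And>y. 0 \<le> f y" "\<And>y. 0 \<le> g y"
  shows "summable (\<lambda>y. (sqrt (f y) - sqrt (g y))\<^sup>2)"
proof (rule summable_comparison_test')
  show "summable (\<lambda>y. f y + g y)" by (intro summable_add assms)
  fix y
  have "(sqrt (f y) - sqrt (g y))\<^sup>2 = f y + g y - 2 * (sqrt (f y) * sqrt (g y))"
    using assms(3,4) by (simp add: power2_diff)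
  moreover have "0 \<le> sqrt (f y) * sqrt (g y)" using assms(3,4) by simp
  ultimately show "norm ((sqrt (f y) - sqrt (g y))\<^sup>2) \<le> f y + g y"
    using zero_le_power2[of "sqrt (f y) - sqrt (g y)"] unfolding real_norm_def by linarith
qed

text \<open>From ln x \<le> x - 1 at x = 1 / sqrt r. It lets \<rho>^12 pay for the fourth power of
  the logarithm and leave \<rho>^10.\<close>

lemma reg_log_sq_mult_le: "0 < r \<Longrightarrow> r \<le> 1 \<Longrightarrow> (reg_log r)\<^sup>2 * r \<le> 36"
proof -
  assume r: "0 < r" "r \<le> 1"
  have s: "0 < sqrt r" "sqrt r \<le> 1" using r by auto
  have "ln (1 / sqrt r) \<le> 1 / sqrt r - 1"
    using s by (intro ln_le_minus_one) auto
  moreover have "ln (1 / sqrt r) = ln (1 / r) / 2"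
    using r by (simp add: ln_div ln_sqrt)
  ultimately have "ln (1 / r) \<le> 2 / sqrt r" by (simp add: field_simps)
  moreover have "0 \<le> ln (1 / r)" using r by simp
  ultimately have "reg_log r \<le> 4 + 2 / sqrt r" by (simp add: reg_log_def)
  also have "\<dots> \<le> 6 / sqrt r" using s by (simp add: field_simps)
  finally have "reg_log r * sqrt r \<le> 6" using s by (simp add: field_simps)
  then have "(reg_log r * sqrt r)\<^sup>2 \<le> 6\<^sup>2"
    using reg_log_ge[of r] s by (intro power_mono mult_nonneg_nonneg) auto
  then show ?thesis using r by (simp add: power_mult_distrib)
qed

text \<open>Up to a constant, r log^2 (1 / r) is increasing: passing from \<rho> to x inflates the
  logarithm by at most 1 + ln (\<rho> / x) \<le> 2 sqrt (\<rho> / x), whose square the factor x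
  compensates.\<close>

lemma mult_reg_log_sq_le:
  assumes "0 \<le> x" "x \<le> \<rho>"
  shows "x * (reg_log x)\<^sup>2 \<le> 4 * \<rho> * (reg_log \<rho>)\<^sup>2"
proof (cases "x = 0")
  case False
  with assms have x: "0 < x" "0 < \<rho>" "0 < sqrt (\<rho> / x)" by auto
  have 1: "1 \<le> \<rho> / x" using assms x by simp
  have "ln (sqrt (\<rho> / x)) \<le> sqrt (\<rho> / x) - 1"
    using x by (intro ln_le_minus_one) auto
  then have l: "1 + ln (\<rho> / x) \<le> 2 * sqrt (\<rho> / x)" 
    using x 1 by (simp add: ln_sqrt field_simps)
  have 2: "0 \<le> ln (\<rho> / x)" using 1 by simp
  have "ln (1 / x) = ln (1 / \<rho>) + ln (\<rho> / x)" using x by (simp add: ln_div)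
  then have "reg_log x \<le> reg_log \<rho> + ln (\<rho> / x)" using 2 by (simp add: reg_log_def)
  also have "\<dots> \<le> reg_log \<rho> + reg_log \<rho> * ln (\<rho> / x)"
    using 2 reg_log_ge[of \<rho>] mult_right_mono[of 1 "reg_log \<rho>" "ln (\<rho> / x)"] by simp
  also have "\<dots> = reg_log \<rho> * (1 + ln (\<rho> / x))" by (simp add: algebra_simps)
  also have "\<dots> \<le> reg_log \<rho> * (2 * sqrt (\<rho> / x))"
    using l reg_log_ge[of \<rho>] by (intro mult_left_mono) auto
  finally have "(reg_log x)\<^sup>2 \<le> (reg_log \<rho> * (2 * sqrt (\<rho> / x)))\<^sup>2"
    using reg_log_ge[of x] by (intro power_mono) auto
  also have "\<dots> = (reg_log \<rho>)\<^sup>2 * 4 * (\<rho> / x)"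
    using x by (simp add: power_mult_distrib)
  finally have "x * (reg_log x)\<^sup>2 \<le> x * ((reg_log \<rho>)\<^sup>2 * 4 * (\<rho> / x))"
    using x by (intro mult_left_mono) auto
  then show ?thesis using x by (simp add: field_simps)
qed (use assms in simp)

section \<open>A pair of mixtures, its weight and its energies\<close>

locale two_mixtures = G: rplus_prob G + H: rplus_prob H for G H +
  fixes \<rho> :: real
  assumes rho: "0 < \<rho>"
begin

abbreviation l_rho :: real ("\<ell>") where "\<ell> \<equiv> reg_log \<rho>"

definition dif :: "nat \<Rightarrow> real" where "dif y = mix H y - mix G y"

text \<open>Near f_G = f_H the squared Hellinger distance behaves like the square of the difference
  over the sum, so this weight makes the energy of order 0 comparable to it. The regularization
  bounds the weight by 1 / (2 \<rho>) and makes it vary slowly.\<close>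

definition wt :: "nat \<Rightarrow> real" where "wt y = 1 / (max (mix G y) \<rho> + max (mix H y) \<rho>)"

abbreviation hell :: real where "hell \<equiv> hellinger_sq (mix G) (mix H)"

abbreviation hterm :: "nat \<Rightarrow> real" where "hterm y \<equiv> (sqrt (mix G y) - sqrt (mix H y))\<^sup>2"

lemma summable_hterm: "summable hterm"
  by (intro summable_hellinger G.summable_mix H.summable_mix G.mix_nonneg H.mix_nonneg)

lemma sum_hterm_le: "finite A \<Longrightarrow> sum hterm A \<le> hell"
  unfolding hellinger_sq_def by (intro sum_le_suminf summable_hterm) auto

lemma hell_nonneg: "0 \<le> hell"
  using sum_hterm_le[of "{}"] by simp

lemma wt_pos: "0 < wt y"
  using rho by (simp add: wt_def add_pos_pos less_max_iff_disj)

lemma wt_le: "wt y \<le> 1 / (2 * \<rho>)"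
  unfolding wt_def using rho by (intro divide_left_mono) (auto simp: max_def)

lemma mix_mult_wt_le: "mix G y * wt y \<le> 1"
  using rho H.mix_nonneg[of y] G.mix_nonneg[of y] by (simp add: wt_def divide_le_eq_1 max_def)

lemma dif_sq_wt_le: "(dif y)\<^sup>2 * wt y \<le> 2 * hterm y"
proof -
  have nn: "0 \<le> mix G y" "0 \<le> mix H y" by (rule G.mix_nonneg H.mix_nonneg)+
  have "- dif y = (sqrt (mix G y) - sqrt (mix H y)) * (sqrt (mix G y) + sqrt (mix H y))"
    using nn by (simp add: dif_def algebra_simps)
  then have "(- dif y)\<^sup>2 = hterm y * (sqrt (mix G y) + sqrt (mix H y))\<^sup>2"
    by (simp only: power_mult_distrib)
  then have "(dif y)\<^sup>2 = hterm y * (sqrt (mix G y) + sqrt (mix H y))\<^sup>2"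
    by simp
  also have "\<dots> \<le> hterm y * (2 * (mix G y + mix H y))"
  proof (intro mult_left_mono)
    show "(sqrt (mix G y) + sqrt (mix H y))\<^sup>2 \<le> 2 * (mix G y + mix H y)"
      using nn sum_squares_bound[of "sqrt (mix G y)" "sqrt (mix H y)"] by (simp add: power2_sum)
  qed auto
  finally have "(dif y)\<^sup>2 * wt y \<le> hterm y * (2 * (mix G y + mix H y)) * wt y"
    using wt_pos[of y] by (intro mult_right_mono) auto
  also have "\<dots> = 2 * hterm y * ((mix G y + mix H y) * wt y)" by simp
  also have "\<dots> \<le> 2 * hterm y * 1"
    using rho nn by (intro mult_left_mono) (auto simp: wt_def divide_le_eq_1 max_def)
  finally show ?thesis by simp
qed

lemma reg_diff_sq_wt_le: "(max (mix G y) \<rho> - max (mix H y) \<rho>)\<^sup>2 * wt y \<le> 2 * hterm y"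
proof -
  have "\<bar>max (mix G y) \<rho> - max (mix H y) \<rho>\<bar> \<le> \<bar>dif y\<bar>"
    by (auto simp: dif_def max_def)
  then have "(max (mix G y) \<rho> - max (mix H y) \<rho>)\<^sup>2 \<le> (dif y)\<^sup>2"
    by (simp add: abs_le_square_iff)
  then have "(max (mix G y) \<rho> - max (mix H y) \<rho>)\<^sup>2 * wt y \<le> (dif y)\<^sup>2 * wt y"
    using wt_pos[of y] by (intro mult_right_mono) auto
  with dif_sq_wt_le[of y] show ?thesis by simp
qed

text \<open>For the reciprocal of s, the change from y to y + 1 relative to the new value is (s y -
  s (y + 1)) / s y. The numerator is controlled because truncation at \<rho> is 1-Lipschitz and each
  mixture changes by O(\<ell> / sqrt (y + 1)) relative to its own summand of s y.\<close>

lemma wt_variation: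
  "\<bar>wt (Suc y) - wt y\<bar> \<le> wt (Suc y) * (4 * \<ell> / sqrt (real (Suc y)))"
proof -
  define s where "s y = max (mix G y) \<rho> + max (mix H y) \<rho>" for y
  have s: "0 < s y" for y using rho by (simp add: s_def add_pos_pos less_max_iff_disj)
  have wt: "wt y = 1 / s y" for y by (simp add: wt_def s_def)
  let ?q = "2 * \<ell> / sqrt (real (Suc y))"
  have le: "\<bar>max u \<rho> - max w \<rho>\<bar> \<le> \<bar>u - w\<bar>" for u w by (simp add: max_def)
  have q: "d \<le> ?q * s y" if "d / max m \<rho> \<le> ?q" "0 \<le> d" "max m \<rho> \<le> s y" for d m
  proof -
    have "d \<le> ?q * max m \<rho>" using that rho by (simp add: divide_le_eq less_max_iff_disj)
    also have "\<dots> \<le> ?q * s y"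
      using that reg_log_ge[of \<rho>] by (intro mult_left_mono) auto
    finally show ?thesis .
  qed
  have "\<bar>s y - s (Suc y)\<bar> \<le> \<bar>fwd_diff (mix G) y\<bar> + \<bar>fwd_diff (mix H) y\<bar>"
  proof -
    have "\<bar>s y - s (Suc y)\<bar> = \<bar>(max (mix G y) \<rho> - max (mix G (Suc y)) \<rho>) + (max (mix H y) \<rho> - max (mix H (Suc y)) \<rho>)\<bar>"
      by (simp add: s_def algebra_simps)
    also have "\<dots> \<le> \<bar>mix G y - mix G (Suc y)\<bar> + \<bar>mix H y - mix H (Suc y)\<bar>"
      by (intro order_trans[OF abs_triangle_ineq] add_mono le)
    finally show ?thesis by (simp add: fwd_diff_def abs_minus_commute)
  qed
  also have "\<dots> \<le> ?q * s y + ?q * s y"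
    using rho
    by (intro add_mono q[OF G.fwd_diff_mix_relative_le] q[OF H.fwd_diff_mix_relative_le])
       (simp_all add: s_def le_max_iff_disj)
  finally have *: "\<bar>s y - s (Suc y)\<bar> \<le> 2 * ?q * s y" by simp
  have "\<bar>wt (Suc y) - wt y\<bar> = \<bar>s y - s (Suc y)\<bar> / s y * wt (Suc y)"
    using s[of y] s[of "Suc y"] by (simp add: wt abs_div_pos[symmetric] diff_frac_eq abs_mult field_simps)
  also have "\<dots> \<le> 2 * ?q * wt (Suc y)"
    using * s[of y] wt_pos[of "Suc y"] by (intro mult_right_mono) (auto simp: divide_le_eq)
  finally show ?thesis by (simp add: mult_ac)
qed

lemma fwd_diff_funpow_dif: "fdiff k dif y = fdiff k (mix H) y - fdiff k (mix G) y"
  by (induction k arbitrary: y) (simp_all add: dif_def fwd_diff_def)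

lemma sum_sq_fwd_diff_dif_le:
  "(\<Sum>y<Y. rising k y * (fdiff k dif y)\<^sup>2) \<le> 4 * fact k"
proof -
  have "(\<Sum>y<Y. rising k y * (fdiff k dif y)\<^sup>2)
    \<le> (\<Sum>y<Y. 2 * (rising k y * (fdiff k (mix H) y)\<^sup>2)
           + 2 * (rising k y * (fdiff k (mix G) y)\<^sup>2))"
  proof (intro sum_mono)
    fix y
    have "rising k y * (fdiff k dif y)\<^sup>2 \<le> rising k y *
       (2 * (fdiff k (mix H) y)\<^sup>2 + 2 * (fdiff k (mix G) y)\<^sup>2)"
    proof (intro mult_left_mono)
      have "(r - s)\<^sup>2 \<le> 2 * r\<^sup>2 + 2 * s\<^sup>2" for r s :: real
        using zero_le_power2[of "r + s"] by (simp add: power2_eq_square algebra_simps)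
      then show "(fdiff k dif y)\<^sup>2 \<le> 2 * (fdiff k (mix H) y)\<^sup>2 + 2 * (fdiff k (mix G) y)\<^sup>2"
        unfolding fwd_diff_funpow_dif .
    qed (auto intro!: less_imp_le pochhammer_pos)
    then show "rising k y * (fdiff k dif y)\<^sup>2 \<le> 
        2 * (rising k y * (fdiff k (mix H) y)\<^sup>2)
           + 2 * (rising k y * (fdiff k (mix G) y)\<^sup>2)"
      by (simp add: algebra_simps)
  qed
  also have "\<dots> \<le> 2 * fact k + 2 * fact k"
    unfolding sum.distrib sum_distrib_left[symmetric]
    by (intro add_mono mult_left_mono G.sum_sq_fwd_diff_mix_le H.sum_sq_fwd_diff_mix_le) auto
  finally show ?thesis by simp
qed

sublocale weighted_differences wt dif "4 * \<ell>" "1 / (2 * \<rho>)"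
proof
  fix k
  have nn: "0 \<le> rising k y" for y by (intro less_imp_le pochhammer_pos) auto
  have sub: "(\<Sum>y\<in>A. rising k y * (fdiff k dif y)\<^sup>2) \<le> 4 * fact k" if "finite A" for A
  proof -
    from that obtain Y where "A \<subseteq> {..<Y}" using finite_nat_bounded by blast
    then have "(\<Sum>y\<in>A. rising k y * (fdiff k dif y)\<^sup>2)
       \<le> (\<Sum>y<Y. rising k y * (fdiff k dif y)\<^sup>2)"
      using nn by (intro sum_mono2) auto
    with sum_sq_fwd_diff_dif_le show ?thesis by (rule order_trans[rotated])
  qed
  show "summable (\<lambda>y. rising k y * (fdiff k dif y)\<^sup>2)"
    using nn by (intro bounded_imp_summable[where B = "4 * fact k"] sub) auto
qed (use wt_pos wt_le wt_variation reg_log_ge[of \<rho>] in auto)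

lemma energy_le: "energy k \<le> 2 * fact k / \<rho>"
  unfolding energy_def
proof (rule suminf_le_const[OF summable_energy])
  fix Y
  have "(\<Sum>y<Y. rising k y * wt y * (fdiff k dif y)\<^sup>2)
     \<le> (\<Sum>y<Y. 1 / (2 * \<rho>) * (rising k y * (fdiff k dif y)\<^sup>2))"
  proof (intro sum_mono)
    fix y
    have "wt y * (rising k y * (fdiff k dif y)\<^sup>2)
      \<le> 1 / (2 * \<rho>) * (rising k y * (fdiff k dif y)\<^sup>2)"
      by (intro mult_right_mono wt_le mult_nonneg_nonneg less_imp_le[OF poch_pos]) auto
    then show "rising k y * wt y * (fdiff k dif y)\<^sup>2
      \<le> 1 / (2 * \<rho>) * (rising k y * (fdiff k dif y)\<^sup>2)"
      by (simp add: mult_ac)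
  qed
  also have "\<dots> \<le> 1 / (2 * \<rho>) * (4 * fact k)"
    unfolding sum_distrib_left[symmetric] using rho
    by (intro mult_left_mono sum_sq_fwd_diff_dif_le) auto
  finally show "(\<Sum>y<Y. rising k y * wt y * (fdiff k dif y)\<^sup>2) \<le> 2 * fact k / \<rho>"
    by simp
qed

lemma energy_0_le: "energy 0 \<le> 2 * hell"
proof -
  have "energy 0 = (\<Sum>y. (dif y)\<^sup>2 * wt y)"
    by (simp add: energy_def mult.commute)
  also have "\<dots> \<le> (\<Sum>y. 2 * hterm y)"
    using summable_energy[of 0] summable_hterm
    by (intro suminf_le dif_sq_wt_le summable_mult) (auto simp: mult.commute)
  also have "\<dots> = 2 * hell"
    unfolding hellinger_sq_def by (intro suminf_mult summable_hterm)
  finally show ?thesis .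
qed

text \<open>The number of interpolation steps is \<open>log (1 / \<rho>)\<close>, so that the factor \<open>1 / \<rho>\<close> in the bound
  on the last energy costs only a constant.\<close>

lemma energy_1_le: "energy 1 \<le> 10 ^ 10 * (\<ell> ^ 4 * hell + \<rho> ^ 10)"
proof (cases "1 \<le> \<rho>")
  \<comment> \<open>For \<rho> \<ge> 1 the term \<rho>^10 alone dominates the a priori bound 2 /
    \<rho>.\<close>
  case True
  have "energy 1 \<le> 2 / \<rho>" using energy_le[of 1] by simp
  also have "\<dots> \<le> 2 * \<rho> ^ 10"
    using True rho power_increasing[of 0 11 \<rho>] by (simp add: divide_le_eq power_Suc2[symmetric])
  also have "\<dots> \<le> 10 ^ 10 * (\<ell> ^ 4 * hell + \<rho> ^ 10)"
    using True hell_nonneg by (intro mult_mono) auto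
  finally show ?thesis .
next
  case False
  define l where "l = \<ell>"
  have l: "4 \<le> l" "ln (1 / \<rho>) \<le> l" by (auto simp: l_def reg_log_def)
  define k where "k = nat \<lceil>l\<rceil>"
  have k: "l \<le> real k" "real k \<le> 2 * l" "1 \<le> k"
    using l unfolding k_def by linarith+
  have sk: "sqrt (real k) \<le> l"
  proof (rule real_le_lsqrt)
    have "2 * l \<le> l * l" using l by (intro mult_right_mono) auto
    then show "real k \<le> l\<^sup>2" using k(2) unfolding power2_eq_square by (rule order_trans[rotated])
  qed (use l in auto)
  \<comment> \<open>T is chosen so that the a priori bound on the last energy is at most (T^k)^2
    \<rho>^12: k! \<le> k^k gives sqrt k, while the remaining 2 / \<rho>^13 is at most exp (14 k)
    because log (1 / \<rho>) \<le> k.\<close>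
  define T where "T = sqrt (real k) * exp 7"
  define B where "B = sqrt (real k) + 2 * (4 * l)"
  \<comment> \<open>The floor \<rho>^12 keeps s positive when the mixtures coincide. Its two powers
    beyond \<rho>^10 pay for the factor l^4 at the end.\<close>
  define s where "s = sqrt (max (energy 0) (\<rho> ^ 12))"
  have "0 < \<rho> ^ 12" using rho by simp
  then have s: "0 < s" unfolding s_def by (simp add: less_max_iff_disj)
  have T: "0 < T" using k by (simp add: T_def)
  have s_sq: "s\<^sup>2 = max (energy 0) (\<rho> ^ 12)"
    unfolding s_def using energy_nonneg[of 0] by (simp add: le_max_iff_disj)
  have "sqrt (energy 1) \<le> (real k * B + T) * s"
  proof (rule interpolation_chain[where x = "\<lambda>j. sqrt (energy j)"])
    fix j assume "Suc j < k"
    have "(sqrt (energy (Suc j)))\<^sup>2 \<le> sqrt (energy j) *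
       (sqrt (energy (Suc (Suc j))) + (sqrt (real (Suc j)) + 2 * (4 * l)) * sqrt (energy (Suc j)))"
      using energy_step[of j] energy_nonneg by (simp add: l_def)
    also have "\<dots> \<le> sqrt (energy j) *
       (sqrt (energy (Suc (Suc j))) + B * sqrt (energy (Suc j)))"
      unfolding B_def using \<open>Suc j < k\<close> energy_nonneg
      by (intro mult_left_mono add_left_mono mult_right_mono add_right_mono real_sqrt_le_mono) auto
    finally show "(sqrt (energy (Suc j)))\<^sup>2 \<le> sqrt (energy j) *
       (sqrt (energy (Suc (Suc j))) + B * sqrt (energy (Suc j)))" .
  next
    have "2 / \<rho> = 2 / \<rho> ^ 13 * \<rho> ^ 12"
      using rho by (simp add: field_simps power_Suc[symmetric] del: power_Suc)
    also have "2 / \<rho> ^ 13 = exp (ln 2 + 13 * ln (1 / \<rho>))"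
      using rho exp_of_nat_mult[of 13 "ln (1 / \<rho>)"] by (simp add: exp_add power_divide)
    also have "\<dots> \<le> exp (14 * real k)"
      using l k ln_2_less_1 by (subst exp_le_cancel_iff) linarith
    finally have 2: "2 / \<rho> \<le> exp (14 * real k) * \<rho> ^ 12"
      using rho by (simp add: mult_right_mono)
    have "energy k \<le> fact k * (2 / \<rho>)" using energy_le[of k] by (simp add: mult.commute)
    also have "\<dots> \<le> real k ^ k * (exp (14 * real k) * \<rho> ^ 12)"
      using 2 rho fact_le_power[of k, where 'a = real] by (intro mult_mono) auto
    also have "\<dots> = (T\<^sup>2) ^ k * \<rho> ^ 12"
      by (simp add: T_def power_mult_distrib exp_of_nat_mult[symmetric] exp_double[symmetric] mult_ac)
    also have "\<dots> \<le> (T\<^sup>2) ^ k * s\<^sup>2"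
      unfolding s_sq by (intro mult_left_mono) auto
    also have "\<dots> = (T ^ k * s)\<^sup>2"
      by (simp add: power_mult_distrib power_mult[symmetric] mult.commute)
    finally show "sqrt (energy k) \<le> T ^ k * s"
      using T s by (intro real_le_lsqrt) auto
  qed (use k s T energy_nonneg l in \<open>auto simp: s_def B_def\<close>)
  also have "\<dots> \<le> (2205 * l\<^sup>2) * s"
  proof (intro mult_right_mono)
    have "real k * B \<le> (2 * l) * (9 * l)"
      using k sk l by (intro mult_mono) (auto simp: B_def)
    moreover have "T \<le> 2187 * l\<^sup>2"
    proof -
      have "exp 7 = exp (1::real) ^ 7" using exp_of_nat_mult[of 7 "1::real"] by simp
      also have "\<dots> \<le> 3 ^ 7" using exp_le by (intro power_mono) auto
      finally have "T \<le> l * 2187" unfolding T_def using sk l by (intro mult_mono) auto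
      also have "\<dots> \<le> l * (2187 * l)" using l by (intro mult_left_mono) auto
      finally show ?thesis by (simp add: power2_eq_square)
    qed
    ultimately show "real k * B + T \<le> 2205 * l\<^sup>2" by (simp add: power2_eq_square)
  qed (use s in auto)
  finally have "(sqrt (energy 1))\<^sup>2 \<le> ((2205 * l\<^sup>2) * s)\<^sup>2"
    using energy_nonneg by (intro power_mono) auto
  then have "energy 1 \<le> 2205\<^sup>2 * (l ^ 4 * s\<^sup>2)"
    using energy_nonneg by (simp add: power_mult_distrib power_mult[symmetric])
  also have "l ^ 4 * s\<^sup>2 \<le> l ^ 4 * (2 * hell + \<rho> ^ 12)"
  proof (intro mult_left_mono)
    have "energy 0 \<le> 2 * hell + \<rho> ^ 12"
      using energy_0_le \<open>0 < \<rho> ^ 12\<close> by linarith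
    then show "s\<^sup>2 \<le> 2 * hell + \<rho> ^ 12"
      using hell_nonneg by (simp add: s_sq)
  qed auto
  also have "\<dots> = 2 * (l ^ 4 * hell) + (l\<^sup>2 * \<rho>)\<^sup>2 * \<rho> ^ 10"
    by (simp add: power_mult_distrib power_mult[symmetric] algebra_simps flip: power_add)
  also have "\<dots> \<le> 2 * (l ^ 4 * hell) + 36\<^sup>2 * \<rho> ^ 10"
    using rho False reg_log_sq_mult_le[of \<rho>] 
    by (intro add_left_mono mult_right_mono power_mono) (auto simp: l_def)
  also have "\<dots> \<le> 1296 * (l ^ 4 * hell + \<rho> ^ 10)"
    using hell_nonneg l by simp
  finally have "energy 1 \<le> 2205\<^sup>2 * (1296 * (l ^ 4 * hell + \<rho> ^ 10))" by simp
  also have "\<dots> = (2205\<^sup>2 * 1296) * (l ^ 4 * hell + \<rho> ^ 10)" by simp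
  also have "\<dots> \<le> 10 ^ 10 * (l ^ 4 * hell + \<rho> ^ 10)"
    using hell_nonneg l rho by (intro mult_right_mono) auto
  finally show ?thesis by (simp add: l_def)
qed

end

section \<open>Small observations\<close>

context two_mixtures
begin

definition loss :: "nat \<Rightarrow> real" where
  "loss y = mix G y * (reg_bayes_rule H \<rho> y - bayes_rule G y)\<^sup>2"

lemma sq_add_le: "(r + s)\<^sup>2 \<le> 2 * r\<^sup>2 + 2 * s\<^sup>2" for r s :: real
  using zero_le_power2[of "r - s"] by (simp add: power2_eq_square algebra_simps)

lemma sq_add3_le: "(r + s + t)\<^sup>2 \<le> 3 * (r\<^sup>2 + s\<^sup>2 + t\<^sup>2)" for r s t :: real
  using zero_le_power2[of "r - s"] zero_le_power2[of "r - t"] zero_le_power2[of "s - t"]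
  by (simp add: power2_eq_square algebra_simps)

lemma loss_eq:
  assumes "0 < mix G y"
  shows "loss y = mix G y * (scaled_diff (mix H) (max (mix H y) \<rho>) y
      - scaled_diff (mix G) (mix G y) y)\<^sup>2"
proof -
  have "bayes_rule G y = (real y + 1) * (fwd_diff (mix G) y / mix G y + 1)"
    using assms by (simp add: bayes_rule_def fwd_diff_def field_simps)
  then show ?thesis by (simp add: loss_def reg_bayes_rule_def algebra_simps)
qed

text \<open>Comparing both quotients with the one over the sum of the denominators separates the error in
  the differences from the error in the denominators.\<close>

lemma regularized_diff_le:
  "mix G y * (scaled_diff (mix H) (max (mix H y) \<rho>) y
      - scaled_diff (mix G) (max (mix G y) \<rho>) y)\<^sup>2
    \<le> 12 * (((real y + 1) * fwd_diff dif y)\<^sup>2 * wt y) + 48 * ((real y + 1) * \<ell>\<^sup>2 * hterm y)"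
proof -
  define a b where "a = max (mix G y) \<rho>" and "b = max (mix H y) \<rho>"
  define P Q where "P = (real y + 1) * (fwd_diff (mix G) y / a)"
    and "Q = (real y + 1) * (fwd_diff (mix H) y / b)"
  define R where "R = (real y + 1) * fwd_diff dif y"
  have ab: "0 < a" "0 < b" using rho by (auto simp: a_def b_def less_max_iff_disj)
  have w: "wt y = 1 / (a + b)" by (simp add: wt_def a_def b_def)
  have R: "R = Q * b - P * a"
    using ab by (simp add: R_def P_def Q_def dif_def fwd_diff_def field_simps)
  have eq: "Q - P = 2 * R * wt y + Q * (a - b) * wt y + P * (a - b) * wt y"
  proof -
    have "2 * R * wt y + Q * (a - b) * wt y + P * (a - b) * wt y = (Q - P) * ((a + b) * wt y)"
      unfolding R by (simp add: algebra_simps)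
    moreover have "(a + b) * wt y = 1" using ab by (simp add: w)
    ultimately show ?thesis by simp
  qed
  have lle: "reg_log a \<le> \<ell>" "reg_log b \<le> \<ell>"
    using rho by (auto simp: a_def b_def intro!: reg_log_antimono)
  have "P\<^sup>2 \<le> 4 * (real y + 1) * (reg_log a)\<^sup>2" "Q\<^sup>2 \<le> 4 * (real y + 1) * (reg_log b)\<^sup>2"
    unfolding P_def Q_def a_def b_def
    by (intro G.sq_fwd_diff_mix_regularized_le H.sq_fwd_diff_mix_regularized_le rho)+
  moreover have "4 * (real y + 1) * (reg_log c)\<^sup>2 \<le> 4 * (real y + 1) * \<ell>\<^sup>2" if "reg_log c \<le> \<ell>" for c
    using that reg_log_ge[of c] by (intro mult_left_mono power_mono) auto
  ultimately have PQ: "P\<^sup>2 \<le> 4 * (real y + 1) * \<ell>\<^sup>2" "Q\<^sup>2 \<le> 4 * (real y + 1) * \<ell>\<^sup>2"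
    using lle by (meson order_trans)+
  have d: "(a - b)\<^sup>2 * wt y \<le> 2 * hterm y"
    using reg_diff_sq_wt_le[of y] by (simp add: a_def b_def)
  have fw: "mix G y * wt y \<le> 1" "0 \<le> mix G y" by (rule mix_mult_wt_le G.mix_nonneg)+
  have term_le: "mix G y * (X * wt y)\<^sup>2 \<le> X\<^sup>2 * wt y" for X
  proof -
    have "(mix G y * wt y) * (X\<^sup>2 * wt y) \<le> 1 * (X\<^sup>2 * wt y)"
      using fw wt_pos[of y] by (intro mult_right_mono) auto
    then show ?thesis by (simp add: power_mult_distrib power2_eq_square mult_ac)
  qed
  have term2: "mix G y * (X * (a - b) * wt y)\<^sup>2 \<le> 8 * ((real y + 1) * \<ell>\<^sup>2 * hterm y)"
    if "X\<^sup>2 \<le> 4 * (real y + 1) * \<ell>\<^sup>2" for X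
  proof -
    have "mix G y * (X * (a - b) * wt y)\<^sup>2 \<le> X\<^sup>2 * ((a - b)\<^sup>2 * wt y)"
      using term_le[of "X * (a - b)"] by (simp add: power_mult_distrib)
    also have "\<dots> \<le> (4 * (real y + 1) * \<ell>\<^sup>2) * (2 * hterm y)"
      by (rule mult_mono[OF that d]) (use wt_pos[of y] in auto)
    also have "\<dots> = 8 * ((real y + 1) * \<ell>\<^sup>2 * hterm y)" by simp
    finally show ?thesis .
  qed
  have "mix G y * (Q - P)\<^sup>2 \<le> mix G y * (3 * ((2 * R * wt y)\<^sup>2 + (Q * (a - b) * wt y)\<^sup>2 + (P * (a - b) * wt y)\<^sup>2))"
    unfolding eq using fw by (intro mult_left_mono sq_add3_le)
  also have "\<dots> = 3 * (mix G y * (2 * R * wt y)\<^sup>2 + mix G y * (Q * (a - b) * wt y)\<^sup>2 + mix G y * (P * (a - b) * wt y)\<^sup>2)"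
    by (simp add: algebra_simps)
  also have "\<dots> \<le> 3 * ((2 * R)\<^sup>2 * wt y + 8 * ((real y + 1) * \<ell>\<^sup>2 * hterm y) + 8 * ((real y + 1) * \<ell>\<^sup>2 * hterm y))"
    by (intro mult_left_mono add_mono term_le term2 PQ) auto
  also have "\<dots> = 12 * (R\<^sup>2 * wt y) + 48 * ((real y + 1) * \<ell>\<^sup>2 * hterm y)"
    by (simp add: power_mult_distrib)
  finally show ?thesis by (simp add: P_def Q_def R_def a_def b_def)
qed

text \<open>Only a mixture value f below \<rho> contributes. There regularization shrinks the
  quotient X by f / \<rho>, so the error is at most X^2, which is O(y log^2 (1 / f)); the factor f
  brings the logarithm back to the level \<rho>.\<close>

lemma truncation_le:
  assumes "0 < mix G y"
  shows "mix G y * (scaled_diff (mix G) (max (mix G y) \<rho>) y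
      - scaled_diff (mix G) (mix G y) y)\<^sup>2 \<le> 16 * ((real y + 1) * \<rho> * \<ell>\<^sup>2)"
proof (cases "\<rho> \<le> mix G y")
  case True
  then show ?thesis using rho by (simp add: max_absorb1)
next
  case False
  define f where "f = mix G y"
  define X where "X = (real y + 1) * (fwd_diff (mix G) y / f)"
  have f: "0 < f" "f < \<rho>" using assms False by (auto simp: f_def)
  \<comment> \<open>The bound is used with f itself as regularization level, where the regularized
    and the plain quotient agree.\<close>
  have "X\<^sup>2 \<le> 4 * (real y + 1) * (reg_log f)\<^sup>2"
    using G.sq_fwd_diff_mix_regularized_le[OF f(1), of y] by (simp add: X_def f_def)
  have "((real y + 1) * (fwd_diff (mix G) y / max f \<rho>) - X)\<^sup>2 = X\<^sup>2 * (1 - f / \<rho>)\<^sup>2"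
    unfolding power_mult_distrib[symmetric] power2_eq_iff using f by (simp add: X_def max_absorb2 field_simps)
  also have "\<dots> \<le> X\<^sup>2 * 1"
    using f by (intro mult_left_mono power_le_one) auto
  also have "\<dots> \<le> 4 * (real y + 1) * (reg_log f)\<^sup>2" using \<open>X\<^sup>2 \<le> _\<close> by simp
  finally have "f * ((real y + 1) * (fwd_diff (mix G) y / max f \<rho>) - X)\<^sup>2 \<le> f * (4 * (real y + 1) * (reg_log f)\<^sup>2)"
    using f by (intro mult_left_mono) auto
  also have "\<dots> = 4 * (real y + 1) * (f * (reg_log f)\<^sup>2)" by simp
  also have "\<dots> \<le> 4 * (real y + 1) * (4 * \<rho> * \<ell>\<^sup>2)"
    using f by (intro mult_left_mono mult_reg_log_sq_le) auto
  also have "\<dots> = 16 * ((real y + 1) * \<rho> * \<ell>\<^sup>2)" by simp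
  finally show ?thesis by (simp only: X_def f_def)
qed

lemma loss_le:
  "loss y \<le> 24 * (((real y + 1) * fwd_diff dif y)\<^sup>2 * wt y)
     + 96 * ((real y + 1) * \<ell>\<^sup>2 * hterm y) + 32 * ((real y + 1) * \<rho> * \<ell>\<^sup>2)"
proof (cases "mix G y = 0")
  case True
  then show ?thesis using rho wt_pos[of y] by (simp add: loss_def)
next
  case False
  then have f: "0 < mix G y" using G.mix_nonneg[of y] by simp
  let ?P = "scaled_diff (mix H) (max (mix H y) \<rho>) y"
  let ?Q = "scaled_diff (mix G) (max (mix G y) \<rho>) y"
  let ?R = "scaled_diff (mix G) (mix G y) y"
  have "loss y = mix G y * ((?P - ?Q) + (?Q - ?R))\<^sup>2" by (simp add: loss_eq[OF f])
  also have "\<dots> \<le> mix G y * (2 * (?P - ?Q)\<^sup>2 + 2 * (?Q - ?R)\<^sup>2)"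
    using f by (intro mult_left_mono sq_add_le) auto
  also have "\<dots> = 2 * (mix G y * (?P - ?Q)\<^sup>2) + 2 * (mix G y * (?Q - ?R)\<^sup>2)"
    by (simp only: distrib_left mult.left_commute)
  also have "\<dots> \<le> 2 * (12 * (((real y + 1) * fwd_diff dif y)\<^sup>2 * wt y) + 48 * ((real y + 1) * \<ell>\<^sup>2 * hterm y))
      + 2 * (16 * ((real y + 1) * \<rho> * \<ell>\<^sup>2))"
    by (intro add_mono mult_left_mono regularized_diff_le truncation_le f) auto
  finally show ?thesis by simp
qed

lemma sum_loss_le:
  "(\<Sum>y<N. loss y) \<le> 24 * (\<Sum>y<N. ((real y + 1) * fwd_diff dif y)\<^sup>2 * wt y)
     + 96 * (real N * \<ell>\<^sup>2 * hell) + 32 * ((real N)\<^sup>2 * \<rho> * \<ell>\<^sup>2)"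
proof -
  have "(\<Sum>y<N. loss y) \<le> (\<Sum>y<N. 24 * (((real y + 1) * fwd_diff dif y)\<^sup>2 * wt y)
     + 96 * (real N * \<ell>\<^sup>2 * hterm y) + 32 * (real N * \<rho> * \<ell>\<^sup>2))"
    using rho by (intro sum_mono order_trans[OF loss_le] add_mono mult_left_mono mult_right_mono) auto
  also have "\<dots> = 24 * (\<Sum>y<N. ((real y + 1) * fwd_diff dif y)\<^sup>2 * wt y)
     + 96 * (real N * \<ell>\<^sup>2 * (\<Sum>y<N. hterm y)) + 32 * ((real N)\<^sup>2 * \<rho> * \<ell>\<^sup>2)"
    by (simp add: sum.distrib sum_distrib_left power2_eq_square mult_ac)
  also have "\<dots> \<le> 24 * (\<Sum>y<N. ((real y + 1) * fwd_diff dif y)\<^sup>2 * wt y)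
     + 96 * (real N * \<ell>\<^sup>2 * hell) + 32 * ((real N)\<^sup>2 * \<rho> * \<ell>\<^sup>2)"
    by (intro add_mono mult_left_mono sum_hterm_le order_refl) auto
  finally show ?thesis .
qed

text \<open>The energy of order 1 carries one factor y + 1; the other one is bounded by N.\<close>

lemma sum_sq_fwd_diff_wt_le_energy:
  "(\<Sum>y<N. ((real y + 1) * fwd_diff dif y)\<^sup>2 * wt y) \<le> real N * energy 1"
proof -
  have "(\<Sum>y<N. ((real y + 1) * fwd_diff dif y)\<^sup>2 * wt y)
     \<le> (\<Sum>y<N. real N * (rising 1 y * wt y * (fdiff 1 dif y)\<^sup>2))"
  proof (intro sum_mono)
    fix y assume "y \<in> {..<N}"
    then have "(real y + 1) * ((real y + 1) * wt y * (fwd_diff dif y)\<^sup>2)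
        \<le> real N * ((real y + 1) * wt y * (fwd_diff dif y)\<^sup>2)"
      using wt_pos[of y] by (intro mult_right_mono) auto
    then show "((real y + 1) * fwd_diff dif y)\<^sup>2 * wt y \<le> real N * (rising 1 y * wt y * (fdiff 1 dif y)\<^sup>2)"
      by (simp add: power_mult_distrib power2_eq_square mult_ac)
  qed
  also have "\<dots> \<le> real N * energy 1"
    unfolding sum_distrib_left[symmetric] by (intro mult_left_mono sum_le_energy) auto
  finally show ?thesis .
qed

text \<open>The difference is bounded by its two terms. This costs (y + 1)^2 \<le> N^2 in place of
  N, but only one factor \<ell>, from comparing the weights at y and y + 1; for N of logarithmic
  size this is the better bargain.\<close>

lemma sum_sq_fwd_diff_wt_le_hell:
  "(\<Sum>y<N. ((real y + 1) * fwd_diff dif y)\<^sup>2 * wt y) \<le> 20 * ((real N)\<^sup>2 * \<ell> * hell)"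
proof -
  let ?l = "\<ell>"
  have l: "4 \<le> ?l" by (rule reg_log_ge)
  have w: "wt y \<le> (1 + 4 * ?l) * wt (Suc y)" for y
  proof -
    have "1 \<le> sqrt (real (Suc y))" by simp
    then have "4 * ?l / sqrt (real (Suc y)) \<le> 4 * ?l / 1"
      using l by (intro divide_left_mono) auto
    then have "wt (Suc y) * (4 * ?l / sqrt (real (Suc y))) \<le> wt (Suc y) * (4 * ?l)"
      using wt_pos[of "Suc y"] by (intro mult_left_mono) auto
    with wt_variation[of y] have "\<bar>wt (Suc y) - wt y\<bar> \<le> wt (Suc y) * (4 * ?l)" by linarith
    then show ?thesis by (simp add: algebra_simps)
  qed
  have "(\<Sum>y<N. ((real y + 1) * fwd_diff dif y)\<^sup>2 * wt y)
     \<le> (\<Sum>y<N. (real N)\<^sup>2 * (2 * ((1 + 4 * ?l) * ((dif (Suc y))\<^sup>2 * wt (Suc y))) + 2 * ((dif y)\<^sup>2 * wt y)))"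
  proof (intro sum_mono)
    fix y assume y: "y \<in> {..<N}"
    have "((real y + 1) * fwd_diff dif y)\<^sup>2 * wt y = (real y + 1)\<^sup>2 * ((dif (Suc y) + - dif y)\<^sup>2 * wt y)"
      by (simp add: power_mult_distrib fwd_diff_def)
    also have "\<dots> \<le> (real N)\<^sup>2 * ((2 * (dif (Suc y))\<^sup>2 + 2 * (- dif y)\<^sup>2) * wt y)"
      using y wt_pos[of y] by (intro mult_mono mult_right_mono power_mono sq_add_le) auto
    also have "(2 * (dif (Suc y))\<^sup>2 + 2 * (- dif y)\<^sup>2) * wt y = 2 * ((dif (Suc y))\<^sup>2 * wt y) + 2 * ((dif y)\<^sup>2 * wt y)"
      by (simp add: algebra_simps)
    also have "(real N)\<^sup>2 * \<dots> \<le> (real N)\<^sup>2 * (2 * ((dif (Suc y))\<^sup>2 * ((1 + 4 * ?l) * wt (Suc y))) + 2 * ((dif y)\<^sup>2 * wt y))"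
      by (intro mult_left_mono add_right_mono w) auto
    finally show "((real y + 1) * fwd_diff dif y)\<^sup>2 * wt y \<le> 
      (real N)\<^sup>2 * (2 * ((1 + 4 * ?l) * ((dif (Suc y))\<^sup>2 * wt (Suc y))) + 2 * ((dif y)\<^sup>2 * wt y))"
      by (simp add: mult_ac)
  qed
  also have "\<dots> = (real N)\<^sup>2 * (2 * ((1 + 4 * ?l) * (\<Sum>y<N. (dif (Suc y))\<^sup>2 * wt (Suc y))) + 2 * (\<Sum>y<N. (dif y)\<^sup>2 * wt y))"
    by (simp add: sum.distrib flip: sum_distrib_left)
  also have "\<dots> \<le> (real N)\<^sup>2 * (2 * ((1 + 4 * ?l) * energy 0) + 2 * energy 0)"
  proof -
    have "(\<Sum>y\<in>A. (dif y)\<^sup>2 * wt y) \<le> energy 0" if "finite A" for A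
      using sum_le_energy[OF that, of 0] by (simp add: mult.commute)
    from this[of "{..<N}"] this[of "Suc ` {..<N}"] show ?thesis
      using l by (intro mult_left_mono add_mono) (auto simp: sum.reindex)
  qed
  also have "\<dots> = (real N)\<^sup>2 * ((4 + 8 * ?l) * energy 0)" by (simp add: algebra_simps)
  also have "\<dots> \<le> (real N)\<^sup>2 * ((10 * ?l) * (2 * hell))"
    using l energy_nonneg[of 0] energy_0_le by (intro mult_left_mono mult_mono) auto
  finally show ?thesis by (simp add: mult_ac)
qed

lemma bulk_le:
  "(\<Sum>y<N. loss y) \<le> 10 ^ 12 * (real N * \<ell> ^ 4 * hell) + 10 ^ 12 * (real N * \<rho> ^ 10)
     + 32 * ((real N)\<^sup>2 * \<rho> * \<ell>\<^sup>2)"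
proof -
  let ?l = "\<ell>"
  have l2: "?l\<^sup>2 \<le> ?l ^ 4" using reg_log_ge[of \<rho>] by (intro power_increasing) auto
  have "(\<Sum>y<N. loss y) \<le> 24 * (real N * (10 ^ 10 * (?l ^ 4 * hell + \<rho> ^ 10)))
     + 96 * (real N * ?l\<^sup>2 * hell) + 32 * ((real N)\<^sup>2 * \<rho> * ?l\<^sup>2)"
    by (rule order_trans[OF sum_loss_le] add_right_mono mult_left_mono
        order_trans[OF sum_sq_fwd_diff_wt_le_energy] energy_1_le)+ auto
  also have "\<dots> \<le> 24 * (real N * (10 ^ 10 * (?l ^ 4 * hell + \<rho> ^ 10)))
     + 96 * (real N * ?l ^ 4 * hell) + 32 * ((real N)\<^sup>2 * \<rho> * ?l\<^sup>2)"
    using l2 hell_nonneg by (intro add_right_mono add_left_mono mult_left_mono mult_right_mono) auto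
  also have "\<dots> \<le> 10 ^ 12 * (real N * ?l ^ 4 * hell) + 10 ^ 12 * (real N * \<rho> ^ 10)
     + 32 * ((real N)\<^sup>2 * \<rho> * ?l\<^sup>2)"
  proof -
    have "0 \<le> real N * ?l ^ 4 * hell" "0 \<le> real N * \<rho> ^ 10"
      using hell_nonneg rho by auto
    then show ?thesis by (simp add: algebra_simps)
  qed
  finally show ?thesis .
qed

lemma bulk_le_small:
  "(\<Sum>y<N. loss y) \<le> 480 * ((real N)\<^sup>2 * \<ell> * hell) + 96 * (real N * \<ell>\<^sup>2 * hell)
     + 32 * ((real N)\<^sup>2 * \<rho> * \<ell>\<^sup>2)"
  using sum_loss_le[of N] sum_sq_fwd_diff_wt_le_hell[of N] by simp

end

section \<open>Moments and large observations\<close>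

lemma powr_le_affine:
  fixes x :: real
  assumes "0 \<le> x" "0 < r" "r \<le> p"
  shows "x powr r \<le> r / p * x powr p + (1 - r / p)"
proof (cases "x = 0")
  case False
  have "(x powr p) powr (r / p) * 1 powr (1 - r / p) \<le> r / p * x powr p + (1 - r / p) * 1"
    using assms False by (intro Youngs_inequality_0) auto
  then show ?thesis using assms by (simp add: powr_powr)
qed (use assms in simp)

text \<open>Since y^y / y! \<le> e^y \<le> 4^y, the ratio 1/64 leaves 16^(-y). This is what later
  steps consume: either (y + 1)^2 \<le> 4^y is paid at once, or a square root is taken first and y +
  1 \<le> 2^y is paid afterwards, with 2^(-y) to spare in both cases.\<close>

lemma power_div_fact_le:
  assumes "64 * y0 \<le> y"
  shows "real y0 ^ y / fact y \<le> (1 / 16) ^ y"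
proof -
  have "exp (real y) = exp (1 :: real) ^ y" using exp_of_nat_mult[of y "1 :: real"] by simp
  also have "\<dots> \<le> 4 ^ y" using exp_le by (intro power_mono) auto
  finally have "exp (real y) \<le> 4 ^ y" .
  moreover have "real y ^ y / fact y \<le> exp (real y)"
    using poi_le_1[of "real y" y] by (simp add: poi_def exp_minus field_simps)
  ultimately have "real y ^ y / fact y \<le> 4 ^ y" by linarith
  moreover have "real y0 ^ y \<le> (real y / 64) ^ y"
    using assms by (intro power_mono) auto
  then have "real y0 ^ y / fact y \<le> (1 / 64) ^ y * (real y ^ y / fact y)"
    using divide_right_mono[of "real y0 ^ y" "(real y / 64) ^ y" "fact y"] by (simp add: power_divide)
  ultimately have "real y0 ^ y / fact y \<le> (1 / 64) ^ y * 4 ^ y"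
    by (meson mult_left_mono order_trans zero_le_divide_1_iff zero_le_numeral zero_le_power)
  then show ?thesis by (simp add: power_mult_distrib[symmetric])
qed

lemma Suc_le_2_power: "real y + 1 \<le> 2 ^ y"
  using of_nat_less_two_power[of y, where 'a = real] less_exp[of y]
  by (metis Suc_leI of_nat_Suc of_nat_le_iff of_nat_numeral of_nat_power add.commute)

lemma sum_half_power_le:
  assumes "finite A" "A \<subseteq> {64 * y0..}"
  shows "(\<Sum>y\<in>A. (1 / 2 :: real) ^ y) \<le> 2 * exp (- real y0)"
proof -
  let ?N = "64 * y0"
  obtain Z where Z: "A \<subseteq> {..<Z}" using assms(1) finite_nat_bounded by blast
  have "(\<Sum>y\<in>A. (1 / 2 :: real) ^ y) \<le> (\<Sum>y\<in>{0 + ?N..<Z + ?N}. (1 / 2) ^ y)"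
    using assms Z by (intro sum_mono2) (auto dest!: subsetD)
  also have "\<dots> = (1 / 2) ^ ?N * (\<Sum>y<Z. (1 / 2) ^ y)"
    unfolding sum.shift_bounds_nat_ivl power_add sum_distrib_right[symmetric] by (simp add: lessThan_atLeast0)
  also have "\<dots> \<le> (1 / 2) ^ ?N * 2"
  proof (intro mult_left_mono)
    have "(\<lambda>n. (1 / 2 :: real) ^ n) sums 2" using geometric_sums[of "1 / 2 :: real"] by simp
    then show "(\<Sum>y<Z. (1 / 2 :: real) ^ y) \<le> 2" by (rule sum_le_sums) auto
  qed auto
  also have "(1 / 2 :: real) ^ ?N \<le> exp (- real y0)"
  proof -
    have "exp (1 :: real) \<le> 2 ^ 64" using exp_le by simp
    then have "(1 / 2) ^ 64 \<le> exp (- 1 :: real)" by (simp add: exp_minus field_simps)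
    then have "((1 / 2) ^ 64) ^ y0 \<le> exp (- 1 :: real) ^ y0" by (intro power_mono) auto
    then show ?thesis by (simp add: power_mult exp_of_nat_mult[symmetric])
  qed
  finally show ?thesis by simp
qed

text \<open>For the rate \<open>\<theta> \<le> y0\<close>, the Poisson weights beyond \<open>64 y0\<close> decay geometrically, with a factor
  \<open>\<theta>\<close> to spare.\<close>

lemma poi_small_rate_le:
  assumes "0 \<le> \<theta>" "\<theta> \<le> real y0" "1 \<le> y0" "64 * y0 \<le> y"
  shows "poi y \<theta> * (real y + 1)\<^sup>2 \<le> \<theta> * (1 / 2) ^ y"
proof -
  have y: "y = Suc (y - 1)" using assms by auto
  have "poi y \<theta> \<le> \<theta> ^ y / fact y"
    using assms by (simp add: poi_def divide_right_mono mult_left_le_one_le)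
  also have "\<theta> ^ y \<le> \<theta> * real y0 ^ y"
  proof -
    have "\<theta> ^ y = \<theta> * \<theta> ^ (y - 1)" by (subst y) simp
    also have "\<dots> \<le> \<theta> * real y0 ^ (y - 1)" using assms by (intro mult_left_mono power_mono) auto
    also have "\<dots> \<le> \<theta> * real y0 ^ y" using assms by (intro mult_left_mono power_increasing) auto
    finally show ?thesis .
  qed
  also have "\<theta> * real y0 ^ y / fact y = \<theta> * (real y0 ^ y / fact y)" by simp
  also have "\<dots> \<le> \<theta> * (1 / 16) ^ y"
    using assms by (intro mult_left_mono power_div_fact_le) auto
  finally have 1: "poi y \<theta> \<le> \<theta> * (1 / 16) ^ y" by (simp add: divide_right_mono)
  have "(real y + 1)\<^sup>2 \<le> (2 ^ y)\<^sup>2" by (intro power_mono Suc_le_2_power) auto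
  also have "\<dots> = (2\<^sup>2) ^ y" by (simp only: power_mult[symmetric] mult.commute)
  also have "\<dots> = 4 ^ y" by simp
  finally have 2: "(real y + 1)\<^sup>2 \<le> 4 ^ y" .
  have "poi y \<theta> * (real y + 1)\<^sup>2 \<le> \<theta> * (1 / 16) ^ y * 4 ^ y"
    using 1 2 assms by (intro mult_mono) auto
  also have "\<dots> = \<theta> * (1 / 4) ^ y" by (simp add: power_mult_distrib[symmetric] mult.assoc)
  also have "\<dots> \<le> \<theta> * (1 / 2) ^ y" using assms by (intro mult_left_mono power_mono) auto
  finally show ?thesis .
qed

text \<open>Rates above y0 are traded for the p-th moment by \<theta> \<le> \<theta>^p y0^(1-p). The
  summand 1 is at most \<theta> because y0 \<ge> 1.\<close>

lemma large_rate_le: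
  assumes "real y0 < \<theta>" "1 \<le> y0" "1 < p"
  shows "\<theta> + 1 \<le> 2 * (\<theta> powr p * real y0 powr (1 - p))"
proof -
  have "real y0 powr (p - 1) \<le> \<theta> powr (p - 1)" using assms by (intro powr_mono2) auto
  then have "\<theta> * real y0 powr (p - 1) \<le> \<theta> * \<theta> powr (p - 1)" using assms by (intro mult_left_mono) auto
  also have "\<dots> = \<theta> powr p" using assms by (simp add: powr_mult_base)
  finally have "\<theta> * real y0 powr (p - 1) * real y0 powr (1 - p) \<le> \<theta> powr p * real y0 powr (1 - p)"
    by (intro mult_right_mono) auto
  moreover have "real y0 powr (p - 1) * real y0 powr (1 - p) = 1"
    using assms by (simp add: powr_add[symmetric])
  ultimately show ?thesis using assms by (simp add: mult.assoc)
qed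

lemma sum_poi_sq_dev_tail_le:
  assumes "0 \<le> \<theta>" "1 \<le> y0" "1 < p" "finite A" "A \<subseteq> {64 * y0..}"
  shows "(\<Sum>y\<in>A. poi y \<theta> * (\<theta> - real y - 1)\<^sup>2)
    \<le> 2 * (\<theta> powr p * real y0 powr (1 - p)) + 2 * (\<theta> * exp (- real y0))"
proof (cases "\<theta> \<le> real y0")
  case True
  have "(\<Sum>y\<in>A. poi y \<theta> * (\<theta> - real y - 1)\<^sup>2) \<le> (\<Sum>y\<in>A. \<theta> * (1 / 2) ^ y)"
  proof (intro sum_mono)
    fix y assume "y \<in> A"
    then have y: "64 * y0 \<le> y" using assms by auto
    then have "\<bar>\<theta> - real y - 1\<bar> \<le> \<bar>real y + 1\<bar>" using True assms by auto
    then have "poi y \<theta> * (\<theta> - real y - 1)\<^sup>2 \<le> poi y \<theta> * (real y + 1)\<^sup>2"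
      using assms by (intro mult_left_mono poi_nonneg) (auto simp only: abs_le_square_iff)
    also have "\<dots> \<le> \<theta> * (1 / 2) ^ y" using True assms y by (intro poi_small_rate_le) auto
    finally show "poi y \<theta> * (\<theta> - real y - 1)\<^sup>2 \<le> \<theta> * (1 / 2) ^ y" .
  qed
  also have "\<dots> \<le> \<theta> * (2 * exp (- real y0))"
    unfolding sum_distrib_left[symmetric] using assms by (intro mult_left_mono sum_half_power_le) auto
  finally show ?thesis by (simp add: add_increasing)
next
  case False
  have "(\<Sum>y\<in>A. poi y \<theta> * (\<theta> - real y - 1)\<^sup>2) \<le> \<theta> + 1"
    using sum_le_sums[OF sums_poi_sq_dev assms(4)] assms by (simp add: poi_nonneg mult.commute)
  also have "\<dots> \<le> 2 * (\<theta> powr p * real y0 powr (1 - p))"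
    using False assms by (intro large_rate_le) auto
  finally show ?thesis using assms by (simp add: add_increasing2)
qed

section \<open>Consequences of the moment bound\<close>

lemma moment_classD:
  assumes "G \<in> moment_class p M" "0 < M"
  shows "rplus_prob G" "integrable G (\<lambda>u. u powr p)" "(\<integral>u. u powr p \<partial>G) \<le> M"
proof -
  show G: "rplus_prob G" using assms by (auto simp: moment_class_def intro: rplus_probI)
  interpret rplus_prob G by (rule G)
  have le: "(\<integral>\<^sup>+ u. ennreal (u powr p) \<partial>G) \<le> ennreal M" using assms by (auto simp: moment_class_def)
  have m: "(\<lambda>u. u powr p) \<in> borel_measurable G" by (intro borel_measurable_G) auto
  show int: "integrable G (\<lambda>u. u powr p)"
    using m le by (intro integrableI_nonneg) (auto simp: less_top[symmetric] top_unique)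
  have "ennreal (\<integral>u. u powr p \<partial>G) \<le> ennreal M"
    using le nn_integral_eq_integral[OF int] by simp
  then show "(\<integral>u. u powr p \<partial>G) \<le> M" using assms by simp
qed

locale moment_mixture = rplus_prob G for G +
  fixes p M :: real
  assumes p: "1 < p" and M: "0 < M"
    and integrable_moment: "integrable G (\<lambda>u. u powr p)" and moment_le: "(\<integral>u. u powr p \<partial>G) \<le> M"
begin

definition m :: real where "m = M powr (1 / p)"

lemma m_pos: "0 < m" using M by (simp add: m_def)

lemma m_powr: "m powr p = M" using M p by (simp add: m_def powr_powr)

text \<open>Lyapunov's inequality relative to the scale m rather than the actual norm: u / m has
  p-th moment at most 1, and the pointwise Young bound \<open>powr_le_affine\<close> is
  integrated.\<close>

lemma lyapunov:
  assumes "0 < r" "r \<le> p"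
  shows "integrable G (\<lambda>u. u powr r)" "(\<integral>u. u powr r \<partial>G) \<le> m powr r"
proof -
  have le: "u powr r \<le> m powr r * (r / p * (u powr p / M) + (1 - r / p))" if "0 \<le> u" for u
  proof -
    have "(u / m) powr r \<le> r / p * (u / m) powr p + (1 - r / p)"
      using that assms m_pos by (intro powr_le_affine) auto
    then have "u powr r / m powr r \<le> r / p * (u powr p / M) + (1 - r / p)"
      using that m_pos by (simp add: powr_divide m_powr)
    then show ?thesis using m_pos by (simp add: field_simps)
  qed
  have i: "integrable G (\<lambda>u. m powr r * (r / p * (u powr p / M) + (1 - r / p)))"
    using integrable_moment by auto
  show I: "integrable G (\<lambda>u. u powr r)"
  proof (rule Bochner_Integration.integrable_bound[OF i])
    show "AE u in G. norm (u powr r) \<le> norm (m powr r * (r / p * (u powr p / M) + (1 - r / p)))"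
    proof (rule AE_I2)
      fix u assume "u \<in> space G"
      then have "0 \<le> u" by (simp add: space_G)
      from order_trans[OF le[OF this] abs_ge_self]
      show "norm (u powr r) \<le> norm (m powr r * (r / p * (u powr p / M) + (1 - r / p)))"
        by (simp only: real_norm_def abs_of_nonneg[OF powr_ge_zero])
    qed
  qed (auto intro!: borel_measurable_G)
  have "(\<integral>u. u powr r \<partial>G) \<le> (\<integral>u. m powr r * (r / p * (u powr p / M) + (1 - r / p)) \<partial>G)"
    by (intro integral_mono_G I i le)
  also have "\<dots> = m powr r * (r / p * ((\<integral>u. u powr p \<partial>G) / M) + (1 - r / p))"
    using integrable_moment by (simp add: prob_space)
  also have "\<dots> \<le> m powr r * (r / p * 1 + (1 - r / p))"
    using moment_le M assms by (intro mult_left_mono add_right_mono) auto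
  finally show "(\<integral>u. u powr r \<partial>G) \<le> m powr r" by simp
qed

lemma mean: "integrable G (\<lambda>u. u)" "(\<integral>u. u \<partial>G) \<le> m"
proof -
  have "integrable G (\<lambda>u. u powr 1) = integrable G (\<lambda>u. u)" "(\<integral>u. u powr 1 \<partial>G) = (\<integral>u. u \<partial>G)"
    by (auto intro!: Bochner_Integration.integrable_cong Bochner_Integration.integral_cong simp: space_G)
  then show "integrable G (\<lambda>u. u)" "(\<integral>u. u \<partial>G) \<le> m"
    using lyapunov[of 1] p m_pos by auto
qed

text \<open>The common form of the tail estimates: a pointwise bound by the p-th power for large
  rates and by \<theta> itself for small ones. Zero coefficients select one of the two.\<close>

lemma integral_tail_bound:
  assumes "integrable G h" "\<And>\<theta>. 0 \<le> \<theta> \<Longrightarrow> h \<theta> \<le> c * (\<theta> powr p * b) + d * (\<theta> * e)"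
    and "0 \<le> b" "0 \<le> c" "0 \<le> d" "0 \<le> e"
  shows "(\<integral>\<theta>. h \<theta> \<partial>G) \<le> c * (M * b) + d * (m * e)"
proof -
  have "(\<integral>\<theta>. h \<theta> \<partial>G) \<le> (\<integral>\<theta>. c * (\<theta> powr p * b) + d * (\<theta> * e) \<partial>G)"
    using integrable_moment mean by (intro integral_mono_G assms) auto
  also have "\<dots> = c * ((\<integral>\<theta>. \<theta> powr p \<partial>G) * b) + d * ((\<integral>\<theta>. \<theta> \<partial>G) * e)"
    using integrable_moment mean by simp
  also have "\<dots> \<le> c * (M * b) + d * (m * e)"
    using assms moment_le mean by (intro add_mono mult_left_mono mult_right_mono) auto
  finally show ?thesis .
qed

lemma sum_posterior_sq_dev_le:
  assumes "finite A" "\<And>\<theta>. 0 \<le> \<theta> \<Longrightarrow> (\<Sum>y\<in>A. poi y \<theta> * (\<theta> - real y - 1)\<^sup>2) \<le> h \<theta>" "integrable G h"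
  shows "(\<Sum>y\<in>A. mix G y * (scaled_diff (mix G) (mix G y) y)\<^sup>2) \<le> (\<integral>\<theta>. h \<theta> \<partial>G)"
proof -
  have "(\<Sum>y\<in>A. mix G y * (scaled_diff (mix G) (mix G y) y)\<^sup>2)
     \<le> (\<Sum>y\<in>A. \<integral>\<theta>. poi y \<theta> * (\<theta> - real y - 1)\<^sup>2 \<partial>G)"
  proof (intro sum_mono)
    fix y
    show "mix G y * (scaled_diff (mix G) (mix G y) y)\<^sup>2 \<le> (\<integral>\<theta>. poi y \<theta> * (\<theta> - real y - 1)\<^sup>2 \<partial>G)"
    proof (cases "mix G y = 0")
      case True
      then show ?thesis
        by (auto intro!: integral_nonneg_AE AE_I2 simp: space_G poi_nonneg)
    next
      case False
      then show ?thesis using mix_nonneg[of y] by (intro sq_fwd_diff_mix_le) auto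
    qed
  qed
  also have "\<dots> = (\<integral>\<theta>. (\<Sum>y\<in>A. poi y \<theta> * (\<theta> - real y - 1)\<^sup>2) \<partial>G)"
    by (subst Bochner_Integration.integral_sum) (auto intro: integrable_poi_mult_sq_dev)
  also have "\<dots> \<le> (\<integral>\<theta>. h \<theta> \<partial>G)"
    using assms by (intro integral_mono_G) (auto intro: integrable_poi_mult_sq_dev)
  finally show ?thesis .
qed

lemma bayes_tail_le:
  assumes "1 \<le> y0" "finite A" "A \<subseteq> {64 * y0..}"
  shows "(\<Sum>y\<in>A. mix G y * (scaled_diff (mix G) (mix G y) y)\<^sup>2)
    \<le> 2 * (M * real y0 powr (1 - p)) + 2 * (m * exp (- real y0))"
proof -
  have "(\<Sum>y\<in>A. mix G y * (scaled_diff (mix G) (mix G y) y)\<^sup>2)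
    \<le> (\<integral>\<theta>. 2 * (\<theta> powr p * real y0 powr (1 - p)) + 2 * (\<theta> * exp (- real y0)) \<partial>G)"
    using assms p integrable_moment mean
    by (intro sum_posterior_sq_dev_le sum_poi_sq_dev_tail_le Bochner_Integration.integrable_add) auto
  also have "\<dots> \<le> 2 * (M * real y0 powr (1 - p)) + 2 * (m * exp (- real y0))"
    using integrable_moment mean
    by (intro integral_tail_bound Bochner_Integration.integrable_add) auto
  finally show ?thesis .
qed

definition low :: "nat \<Rightarrow> nat \<Rightarrow> real" where
  "low y0 y = (\<integral>\<theta>. poi y \<theta> * indicator {..real y0} \<theta> \<partial>G)"

definition high :: "nat \<Rightarrow> nat \<Rightarrow> real" where
  "high y0 y = (\<integral>\<theta>. poi y \<theta> * indicator {real y0<..} \<theta> \<partial>G)"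

lemma integrable_poi_indicator:
  assumes "B \<in> sets borel"
  shows "integrable G (\<lambda>\<theta>. poi y \<theta> * indicator B \<theta>)"
  using assms by (intro integrable_boundedI[where B = 1])
    (auto simp: indicator_def poi_nonneg poi_le_1)

lemma mix_eq_low_high: "mix G y = low y0 y + high y0 y"
proof -
  have "mix G y = (\<integral>\<theta>. poi y \<theta> * indicator {..real y0} \<theta> + poi y \<theta> * indicator {real y0<..} \<theta> \<partial>G)"
    unfolding mix_def by (intro Bochner_Integration.integral_cong) (auto simp: indicator_def)
  also have "\<dots> = low y0 y + high y0 y"
    unfolding low_def high_def by (intro Bochner_Integration.integral_add integrable_poi_indicator) auto
  finally show ?thesis .
qed

lemma low_nonneg: "0 \<le> low y0 y"
  unfolding low_def by (intro integral_nonneg_AE AE_I2) (auto simp: space_G poi_nonneg)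

lemma high_nonneg: "0 \<le> high y0 y"
  unfolding high_def by (intro integral_nonneg_AE AE_I2) (auto simp: space_G poi_nonneg)

lemma sum_high_le:
  assumes "1 \<le> y0" "finite A"
  shows "(\<Sum>y\<in>A. (real y + 1) * high y0 y) \<le> 2 * (M * real y0 powr (1 - p))"
proof -
  have "(\<Sum>y\<in>A. (real y + 1) * high y0 y) = (\<integral>\<theta>. (\<Sum>y\<in>A. (real y + 1) * (poi y \<theta> * indicator {real y0<..} \<theta>)) \<partial>G)"
    unfolding high_def by (subst Bochner_Integration.integral_sum) (auto intro!: integrable_poi_indicator)
  also have "\<dots> \<le> 2 * (M * real y0 powr (1 - p)) + 0 * (m * 0)"
  proof (rule integral_tail_bound)
    fix \<theta> :: real assume t: "0 \<le> \<theta>"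
    show "(\<Sum>y\<in>A. (real y + 1) * (poi y \<theta> * indicator {real y0<..} \<theta>)) \<le> 2 * (\<theta> powr p * real y0 powr (1 - p)) + 0 * (\<theta> * 0)"
    proof (cases "real y0 < \<theta>")
      case True
      have "(\<Sum>y\<in>A. (real y + 1) * poi y \<theta>) \<le> \<theta> + 1"
        using t assms by (intro sum_le_sums[OF sums_poi_mean_Suc]) (auto simp: poi_nonneg)
      with large_rate_le[OF True assms(1) p] True show ?thesis by simp
    qed simp
  qed (auto intro!: Bochner_Integration.integrable_sum integrable_mult_right integrable_poi_indicator)
  finally show ?thesis by simp
qed

text \<open>The square of y + 1 anticipates the case of \<open>low_term_le\<close> in which the
  squared logarithm is at most y + 1.\<close>

lemma sum_low_le:
  assumes "1 \<le> y0" "finite A" "A \<subseteq> {64 * y0..}"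
  shows "(\<Sum>y\<in>A. (real y + 1)\<^sup>2 * low y0 y) \<le> 2 * (m * exp (- real y0))"
proof -
  have "(\<Sum>y\<in>A. (real y + 1)\<^sup>2 * low y0 y) = (\<integral>\<theta>. (\<Sum>y\<in>A. (real y + 1)\<^sup>2 * (poi y \<theta> * indicator {..real y0} \<theta>)) \<partial>G)"
    unfolding low_def by (subst Bochner_Integration.integral_sum) (auto intro!: integrable_poi_indicator)
  also have "\<dots> \<le> 0 * (M * 0) + 2 * (m * exp (- real y0))"
  proof (rule integral_tail_bound)
    fix \<theta> :: real assume t: "0 \<le> \<theta>"
    have "(\<Sum>y\<in>A. (real y + 1)\<^sup>2 * (poi y \<theta> * indicator {..real y0} \<theta>)) \<le> (\<Sum>y\<in>A. \<theta> * (1 / 2) ^ y)"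
    proof (intro sum_mono)
      fix y assume "y \<in> A"
      then show "(real y + 1)\<^sup>2 * (poi y \<theta> * indicator {..real y0} \<theta>) \<le> \<theta> * (1 / 2) ^ y"
        using poi_small_rate_le[OF t _ assms(1), of y] assms(3) t
        by (cases "\<theta> \<le> real y0") (auto simp: mult.commute)
    qed
    also have "\<dots> \<le> \<theta> * (2 * exp (- real y0))"
      unfolding sum_distrib_left[symmetric] using assms t by (intro mult_left_mono sum_half_power_le) auto
    finally show "(\<Sum>y\<in>A. (real y + 1)\<^sup>2 * (poi y \<theta> * indicator {..real y0} \<theta>)) \<le> 0 * (\<theta> powr p * 0) + 2 * (\<theta> * exp (- real y0))"
      by simp
  qed (auto intro!: Bochner_Integration.integrable_sum integrable_mult_right integrable_poi_indicator)
  finally show ?thesis by simp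
qed

text \<open>For y \<ge> p the power \<theta>^y contains \<theta>^p, which produces the moment; the
  rest is at most y0^(y-p) since \<theta> \<le> y0, and y0^(1-p) is split off from it.\<close>

lemma low_le_moment:
  assumes "1 \<le> y0" "64 * y0 \<le> y" "p \<le> real y"
  shows "low y0 y \<le> M * real y0 powr (1 - p) * (1 / 16) ^ y"
proof -
  have "low y0 y \<le> 1 * (M * (real y0 powr (1 - p) * (1 / 16) ^ y)) + 0 * (m * 0)"
    unfolding low_def
  proof (rule integral_tail_bound)
    fix \<theta> :: real assume t: "0 \<le> \<theta>"
    have "poi y \<theta> \<le> \<theta> powr p * (real y0 powr (1 - p) * (1 / 16) ^ y)" if "\<theta> \<le> real y0" "\<theta> \<noteq> 0"
    proof -
      have t0: "0 < \<theta>" using that t by simp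
      have "poi y \<theta> \<le> \<theta> ^ y / fact y"
        using t by (simp add: poi_def divide_right_mono mult_left_le_one_le)
      also have "\<theta> ^ y = \<theta> powr p * \<theta> powr (real y - p)"
        using t0 by (simp add: powr_add[symmetric] powr_realpow)
      also have "\<dots> \<le> \<theta> powr p * real y0 powr (real y - p)"
        using t0 that assms by (intro mult_left_mono powr_mono2) auto
      also have "real y0 powr (real y - p) \<le> real y0 powr (1 - p + real y)"
        using assms by (intro powr_mono) auto
      also have "\<dots> = real y0 powr (1 - p) * real y0 ^ y"
        using assms by (simp add: powr_add powr_realpow)
      finally have "poi y \<theta> \<le> \<theta> powr p * real y0 powr (1 - p) * (real y0 ^ y / fact y)"
        by (simp add: divide_right_mono mult_left_mono)
      also have "\<dots> \<le> \<theta> powr p * real y0 powr (1 - p) * (1 / 16) ^ y"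
        using assms by (intro mult_left_mono power_div_fact_le) auto
      finally show ?thesis by simp
    qed
    moreover have "poi y 0 = 0" using assms by (simp add: poi_def)
    ultimately show "poi y \<theta> * indicator {..real y0} \<theta>
      \<le> 1 * (\<theta> powr p * (real y0 powr (1 - p) * (1 / 16) ^ y)) + 0 * (\<theta> * 0)"
      by (cases "\<theta> = 0") (auto simp: indicator_def)
  qed (auto intro!: integrable_poi_indicator)
  then show ?thesis by simp
qed

text \<open>For y \<le> p the power \<theta>^y is a moment of admissible order y. If m \<le> y0,
  Lyapunov gives m^y \<le> m^2 y0^(y-2); if m > y0, then m \<ge> 1 and the plain weight suffices.
  The square of m is what leaves a single m after the square root in
  \<open>low_term_le\<close>.\<close>

lemma low_le_sq:
  assumes "1 \<le> y0" "64 * y0 \<le> y" "real y \<le> p"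
  shows "low y0 y \<le> m\<^sup>2 * (1 / 16) ^ y"
proof (cases "real y0 < m")
  case True
  have "low y0 y \<le> (\<integral>\<theta>. (1 / 16) ^ y \<partial>G)"
    unfolding low_def
  proof (intro integral_mono_G integrable_poi_indicator)
    fix \<theta> :: real assume t: "0 \<le> \<theta>"
    have "poi y \<theta> \<le> (1 / 16) ^ y" if "\<theta> \<le> real y0"
    proof -
      have "poi y \<theta> \<le> \<theta> ^ y / fact y"
        using t by (simp add: poi_def divide_right_mono mult_left_le_one_le)
      also have "\<dots> \<le> real y0 ^ y / fact y"
        using that t by (intro divide_right_mono power_mono) auto
      also have "\<dots> \<le> (1 / 16) ^ y" using assms by (intro power_div_fact_le) auto
      finally show ?thesis .
    qed
    then show "poi y \<theta> * indicator {..real y0} \<theta> \<le> (1 / 16) ^ y" by (auto simp: indicator_def)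
  qed auto
  also have "\<dots> = 1 * (1 / 16) ^ y" by (simp add: prob_space)
  also have "\<dots> \<le> m\<^sup>2 * (1 / 16) ^ y"
    using True assms by (intro mult_right_mono one_le_power) auto
  finally show ?thesis .
next
  case False
  have y: "0 < y" "y = 2 + (y - 2)" using assms by auto
  have "low y0 y \<le> (\<integral>\<theta>. \<theta> powr real y / fact y \<partial>G)"
    unfolding low_def
  proof (intro integral_mono_G integrable_poi_indicator)
    fix \<theta> :: real assume t: "0 \<le> \<theta>"
    have "poi y \<theta> \<le> \<theta> ^ y / fact y"
      using t by (simp add: poi_def divide_right_mono mult_left_le_one_le)
    then show "poi y \<theta> * indicator {..real y0} \<theta> \<le> \<theta> powr real y / fact y"
      using t y by (auto simp: indicator_def powr_realpow')
  qed (use lyapunov[of "real y"] assms y in auto)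
  also have "\<dots> \<le> m powr real y / fact y"
    using lyapunov[of "real y"] assms y by (simp add: divide_right_mono)
  also have "m powr real y = m ^ y" using m_pos by (simp add: powr_realpow)
  also have "m ^ y = m\<^sup>2 * m ^ (y - 2)" by (subst y(2)) (simp only: power_add)
  also have "\<dots> \<le> m\<^sup>2 * real y0 ^ (y - 2)"
    using False m_pos by (intro mult_left_mono power_mono) auto
  also have "\<dots> \<le> m\<^sup>2 * real y0 ^ y"
    using assms by (intro mult_left_mono power_increasing) auto
  finally have "low y0 y \<le> m\<^sup>2 * (real y0 ^ y / fact y)"
    by (simp add: divide_right_mono)
  also have "\<dots> \<le> m\<^sup>2 * (1 / 16) ^ y"
    using assms by (intro mult_left_mono power_div_fact_le) auto
  finally show ?thesis .
qed

end

text \<open>The squared logarithm costs half a power of s. Applied to a small mixture value, this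
  replaces log (1 / \<rho>) by a geometric bound free of \<rho>.\<close>

lemma reg_log_sq_le_inverse_sqrt:
  assumes "0 < s" "s \<le> 1"
  shows "s * (reg_log s)\<^sup>2 \<le> 144 * sqrt s"
proof -
  have "reg_log s \<le> 2 * reg_log (sqrt s)"
    using assms by (simp add: reg_log_def ln_div ln_sqrt)
  then have "(reg_log s)\<^sup>2 \<le> (2 * reg_log (sqrt s))\<^sup>2"
    using reg_log_ge[of s] by (intro power_mono) auto
  then have "s * (reg_log s)\<^sup>2 \<le> s * (2 * reg_log (sqrt s))\<^sup>2"
    using assms by (intro mult_left_mono) auto
  also have "\<dots> = 4 * sqrt s * ((reg_log (sqrt s))\<^sup>2 * sqrt s)"
    using assms by (simp add: power_mult_distrib)
  also have "\<dots> \<le> 4 * sqrt s * 36"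
    using assms by (intro mult_left_mono reg_log_sq_mult_le) auto
  finally show ?thesis by simp
qed

section \<open>Large observations for two mixtures under the moment bound\<close>

locale moment_two_mixtures = two_mixtures G H \<rho> + G: moment_mixture G p M
  for G H \<rho> p M
begin

text \<open>For a small mixing rate at a large observation, one of the following holds: the logarithm is dominated by
  the observation; or \<open>H\<close> gives the observation a much smaller probability than \<open>G\<close>, which is charged to the
  Hellinger distance; or the logarithm is at most that of the probability under \<open>G\<close> itself.\<close>

lemma low_term_le:
  assumes "1 \<le> y0" "64 * y0 \<le> y"
  shows "(real y + 1) * G.low y0 y * (reg_log (max (mix H y) \<rho>))\<^sup>2
     \<le> (real y + 1)\<^sup>2 * G.low y0 y + 4 * (\<ell> ^ 4 * hterm y)
       + \<ell>\<^sup>2 * (M * real y0 powr (1 - p)) * (1 / 2) ^ y + 288 * G.m * (1 / 2) ^ y"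
proof -
  define l' where "l' = reg_log (max (mix H y) \<rho>)"
  define l where "l = \<ell>"
  define f0 where "f0 = G.low y0 y"
  define b where "b = M * real y0 powr (1 - p)"
  have l: "4 \<le> l'" "l' \<le> l"
    using rho by (auto simp: l_def l'_def reg_log_ge intro!: reg_log_antimono)
  have l2: "l'\<^sup>2 \<le> l\<^sup>2" using l by (intro power_mono) auto
  have f0: "0 \<le> f0" "f0 \<le> mix G y" "mix G y \<le> 1"
    using G.low_nonneg[of y0 y] G.mix_eq_low_high[of y y0] G.high_nonneg[of y0 y] G.mix_le_1[of y]
    unfolding f0_def by linarith+
  have b: "0 \<le> b" using G.M by (simp add: b_def)
  have m: "0 < G.m" by (rule G.m_pos)
  have nn: "0 \<le> (real y + 1)\<^sup>2 * f0" "0 \<le> 4 * (l ^ 4 * hterm y)" "0 \<le> l\<^sup>2 * b * (1 / 2) ^ y" "0 \<le> 288 * G.m * (1 / 2) ^ y"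
    using f0 b m by auto
  have geo: "(real y + 1) * (1 / 4) ^ y \<le> (1 / 2) ^ y"
  proof -
    have "(real y + 1) * (1 / 4) ^ y \<le> 2 ^ y * (1 / 4) ^ y" by (intro mult_right_mono Suc_le_2_power) auto
    then show ?thesis by (simp add: power_mult_distrib[symmetric])
  qed
  have "(real y + 1) * f0 * l'\<^sup>2 \<le> (real y + 1)\<^sup>2 * f0 + 4 * (l ^ 4 * hterm y) + l\<^sup>2 * b * (1 / 2) ^ y + 288 * G.m * (1 / 2) ^ y"
  proof -
    \<comment> \<open>For p \<le> y the bound \<open>low_le_moment\<close> already has the factor M
      y0^(1-p), which tolerates \<ell>^2. The comparison with the probability under G is therefore
      made only for y \<le> p.\<close>
    consider "l\<^sup>2 \<le> real y + 1" | "real y + 1 \<le> l\<^sup>2" "mix H y < mix G y / 4" | "p \<le> real y"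
      | "real y \<le> p" "mix G y / 4 \<le> mix H y" "0 < f0" | "f0 = 0"
      using f0 by linarith
    then show ?thesis
    proof cases
      case 1
      have "(real y + 1) * f0 * l'\<^sup>2 \<le> (real y + 1) * f0 * (real y + 1)"
        using 1 l2 f0 by (intro mult_left_mono) auto
      also have "\<dots> = (real y + 1)\<^sup>2 * f0" by (simp add: power2_eq_square)
      finally show ?thesis using nn by linarith
    next
      case 2
      have "sqrt (mix H y) \<le> sqrt (mix G y) / 2"
        using 2 by (intro real_le_lsqrt) (auto simp: power_divide f0 G.mix_nonneg)
      then have "(sqrt (mix G y) / 2)\<^sup>2 \<le> hterm y"
        using G.mix_nonneg[of y] by (intro power_mono) auto
      then have h: "f0 \<le> 4 * hterm y" using f0 by (simp add: power_divide G.mix_nonneg)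
      have "(real y + 1) * f0 * l'\<^sup>2 \<le> l\<^sup>2 * (4 * hterm y) * l\<^sup>2"
        using 2 l2 f0 h by (intro mult_mono) auto
      also have "\<dots> = 4 * (l ^ 4 * hterm y)" by (simp add: power2_eq_square power4_eq_xxxx)
      finally show ?thesis using nn by linarith
    next
      case 3
      have "f0 \<le> b * (1 / 16) ^ y"
        using G.low_le_moment[OF assms 3] by (simp add: f0_def b_def)
      also have "\<dots> \<le> b * (1 / 4) ^ y"
        using b by (intro mult_left_mono power_mono) auto
      finally have "(real y + 1) * f0 * l'\<^sup>2 \<le> (real y + 1) * (b * (1 / 4) ^ y) * l\<^sup>2"
        using l2 f0 by (intro mult_mono) auto
      also have "\<dots> = l\<^sup>2 * b * ((real y + 1) * (1 / 4) ^ y)" by simp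
      also have "\<dots> \<le> l\<^sup>2 * b * (1 / 2) ^ y" using geo b by (intro mult_left_mono) auto
      finally show ?thesis using nn by linarith
    next
      case 4
      \<comment> \<open>Here \<open>mix H y\<close> is at least a quarter of f0, so the logarithm is
        at most that of 4 / f0.\<close>
      have s: "0 < f0 / 4" "f0 / 4 \<le> 1" "f0 / 4 \<le> max (mix H y) \<rho>" using 4 f0 by auto
      then have "l' \<le> reg_log (f0 / 4)" unfolding l'_def by (intro reg_log_antimono) auto
      then have "f0 / 4 * l'\<^sup>2 \<le> f0 / 4 * (reg_log (f0 / 4))\<^sup>2"
        using s l by (intro mult_left_mono power_mono) auto
      also have "\<dots> \<le> 144 * sqrt (f0 / 4)" using s by (intro reg_log_sq_le_inverse_sqrt)
      also have "sqrt (f0 / 4) = sqrt f0 / 2" by (simp add: real_sqrt_divide)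
      finally have "f0 * l'\<^sup>2 \<le> 288 * sqrt f0" by simp
      also have "sqrt f0 \<le> G.m * (1 / 4) ^ y"
      proof (rule real_le_lsqrt)
        have "f0 \<le> G.m\<^sup>2 * (1 / 16) ^ y"
          using G.low_le_sq[OF assms 4(1)] by (simp add: f0_def)
        also have "(1 / 16 :: real) ^ y = ((1 / 4) ^ y)\<^sup>2"
        proof -
          have "((1 / 4 :: real) ^ y)\<^sup>2 = ((1 / 4)\<^sup>2) ^ y" by (simp only: power_mult[symmetric] mult.commute)
          then show ?thesis by (simp add: power_divide)
        qed
        finally show "f0 \<le> (G.m * (1 / 4) ^ y)\<^sup>2" by (simp add: power_mult_distrib)
      qed (use m f0 in auto)
      finally have "f0 * l'\<^sup>2 \<le> 288 * (G.m * (1 / 4) ^ y)" by simp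
      then have "(real y + 1) * (f0 * l'\<^sup>2) \<le> (real y + 1) * (288 * (G.m * (1 / 4) ^ y))"
        by (intro mult_left_mono) auto
      also have "\<dots> = 288 * G.m * ((real y + 1) * (1 / 4) ^ y)" by simp
      also have "\<dots> \<le> 288 * G.m * (1 / 2) ^ y" using geo m by (intro mult_left_mono) auto
      finally show ?thesis using nn unfolding mult.assoc by linarith
    next
      case 5
      then show ?thesis using nn by simp
    qed
  qed
  then show ?thesis by (simp only: f0_def l_def l'_def b_def)
qed

lemma estimator_sq_dev_le:
  "mix G y * (scaled_diff (mix H) (max (mix H y) \<rho>) y)\<^sup>2
     \<le> 4 * ((real y + 1) * mix G y * (reg_log (max (mix H y) \<rho>))\<^sup>2)"
proof -
  have "mix G y * (scaled_diff (mix H) (max (mix H y) \<rho>) y)\<^sup>2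
     \<le> mix G y * (4 * (real y + 1) * (reg_log (max (mix H y) \<rho>))\<^sup>2)"
    using rho by (intro mult_left_mono H.sq_fwd_diff_mix_regularized_le G.mix_nonneg)
  then show ?thesis by (simp only: mult_ac)
qed

lemma reg_log_max_sq_le: "(reg_log (max (mix H y) \<rho>))\<^sup>2 \<le> \<ell>\<^sup>2"
  using rho reg_log_ge[of "max (mix H y) \<rho>"] by (intro power_mono reg_log_antimono) auto

lemma estimator_tail_le:
  assumes "1 \<le> y0" "finite A" "A \<subseteq> {64 * y0..}"
  shows "(\<Sum>y\<in>A. mix G y * (scaled_diff (mix H) (max (mix H y) \<rho>) y)\<^sup>2)
     \<le> 16 * (\<ell>\<^sup>2 * (M * real y0 powr (1 - p))) + 2312 * (G.m * exp (- real y0))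
        + 16 * (\<ell> ^ 4 * hell)"
proof -
  define l where "l = \<ell>"
  define b where "b = M * real y0 powr (1 - p)"
  define e where "e = exp (- real y0)"
  have b: "0 \<le> b" using G.M by (simp add: b_def)
  have m: "0 < G.m" by (rule G.m_pos)
  have geo: "(\<Sum>y\<in>A. (1 / 2 :: real) ^ y) \<le> 2 * e" unfolding e_def using assms(2,3) by (rule sum_half_power_le)
  have "e \<le> 1" by (simp add: e_def)
  with geo have geo2: "(\<Sum>y\<in>A. (1 / 2 :: real) ^ y) \<le> 2" by linarith
  have "(\<Sum>y\<in>A. mix G y * (scaled_diff (mix H) (max (mix H y) \<rho>) y)\<^sup>2)
    \<le> (\<Sum>y\<in>A. 4 * (l\<^sup>2 * ((real y + 1) * G.high y0 y) + (real y + 1)\<^sup>2 * G.low y0 y + 4 * (l ^ 4 * hterm y)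
        + l\<^sup>2 * b * (1 / 2) ^ y + 288 * G.m * (1 / 2) ^ y))"
  proof (intro sum_mono order_trans[OF estimator_sq_dev_le] mult_left_mono)
    fix y assume "y \<in> A"
    then have y: "64 * y0 \<le> y" using assms by auto
    let ?l' = "reg_log (max (mix H y) \<rho>)"
    \<comment> \<open>The high part sums to O(M y0^(1-p)), so the crude factor \<ell>^2 is
      affordable; only the low part requires the case analysis.\<close>
    have "(real y + 1) * G.high y0 y * ?l'\<^sup>2 \<le> (real y + 1) * G.high y0 y * l\<^sup>2"
      unfolding l_def by (intro mult_left_mono reg_log_max_sq_le mult_nonneg_nonneg G.high_nonneg) auto
    moreover have "(real y + 1) * mix G y * ?l'\<^sup>2
        = (real y + 1) * G.low y0 y * ?l'\<^sup>2 + (real y + 1) * G.high y0 y * ?l'\<^sup>2"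
      unfolding G.mix_eq_low_high[of y y0] by (simp add: algebra_simps)
    ultimately show "(real y + 1) * mix G y * ?l'\<^sup>2 \<le> l\<^sup>2 * ((real y + 1) * G.high y0 y)
        + (real y + 1)\<^sup>2 * G.low y0 y + 4 * (l ^ 4 * hterm y)
        + l\<^sup>2 * b * (1 / 2) ^ y + 288 * G.m * (1 / 2) ^ y"
      using low_term_le[OF assms(1) y, folded l_def b_def] mult.commute[of "(real y + 1) * G.high y0 y" "l\<^sup>2"]
      by linarith
  qed simp
  also have "\<dots> = 4 * (l\<^sup>2 * (\<Sum>y\<in>A. (real y + 1) * G.high y0 y) + (\<Sum>y\<in>A. (real y + 1)\<^sup>2 * G.low y0 y)
        + 4 * (l ^ 4 * (\<Sum>y\<in>A. hterm y)) + l\<^sup>2 * b * (\<Sum>y\<in>A. (1 / 2) ^ y) + 288 * G.m * (\<Sum>y\<in>A. (1 / 2) ^ y))"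
    by (simp only: sum.distrib sum_distrib_left[symmetric])
  also have "\<dots> \<le> 4 * (l\<^sup>2 * (2 * b) + 2 * (G.m * e) + 4 * (l ^ 4 * hell) + l\<^sup>2 * b * 2 + 288 * G.m * (2 * e))"
    unfolding b_def e_def using m b assms
    by (intro mult_left_mono add_mono G.sum_high_le G.sum_low_le sum_hterm_le geo2 geo[unfolded e_def])
       (auto simp: b_def)
  also have "\<dots> = 16 * (l\<^sup>2 * b) + 2312 * (G.m * e) + 16 * (l ^ 4 * hell)"
    by (simp add: algebra_simps)
  finally show ?thesis by (simp only: l_def b_def e_def)
qed

lemma loss_le_dev:
  "loss y \<le> 2 * (mix G y * (scaled_diff (mix H) (max (mix H y) \<rho>) y)\<^sup>2)
     + 2 * (mix G y * (scaled_diff (mix G) (mix G y) y)\<^sup>2)"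
proof (cases "mix G y = 0")
  case True
  then show ?thesis by (simp add: loss_def)
next
  case False
  then have f: "0 < mix G y" using G.mix_nonneg[of y] by simp
  let ?P = "scaled_diff (mix H) (max (mix H y) \<rho>) y"
  let ?Q = "scaled_diff (mix G) (mix G y) y"
  have "loss y = mix G y * (?P + - ?Q)\<^sup>2" by (simp add: loss_eq[OF f])
  also have "\<dots> \<le> mix G y * (2 * ?P\<^sup>2 + 2 * (- ?Q)\<^sup>2)"
    using f by (intro mult_left_mono sq_add_le) auto
  also have "\<dots> = 2 * (mix G y * ?P\<^sup>2) + 2 * (mix G y * ?Q\<^sup>2)"
    by (simp only: distrib_left mult.left_commute power2_minus)
  finally show ?thesis .
qed

lemma tail_le:
  assumes "1 \<le> y0" "finite A" "A \<subseteq> {64 * y0..}"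
  shows "(\<Sum>y\<in>A. loss y) \<le> 40 * (\<ell>\<^sup>2 * (M * real y0 powr (1 - p)))
     + 5000 * (G.m * exp (- real y0)) + 32 * (\<ell> ^ 4 * hell)"
proof -
  define b where "b = M * real y0 powr (1 - p)"
  define e where "e = G.m * exp (- real y0)"
  define l2 where "l2 = \<ell>\<^sup>2"
  define h where "h = \<ell> ^ 4 * hell"
  have b: "0 \<le> b" using G.M by (simp add: b_def)
  have e: "0 \<le> e" using G.m_pos by (simp add: e_def)
  have "(\<Sum>y\<in>A. loss y) \<le> (\<Sum>y\<in>A. 2 * (mix G y * (scaled_diff (mix H) (max (mix H y) \<rho>) y)\<^sup>2)
     + 2 * (mix G y * (scaled_diff (mix G) (mix G y) y)\<^sup>2))"
    by (intro sum_mono loss_le_dev)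
  also have "\<dots> = 2 * (\<Sum>y\<in>A. mix G y * (scaled_diff (mix H) (max (mix H y) \<rho>) y)\<^sup>2)
     + 2 * (\<Sum>y\<in>A. mix G y * (scaled_diff (mix G) (mix G y) y)\<^sup>2)"
    by (simp only: sum.distrib sum_distrib_left)
  also have "\<dots> \<le> 2 * (16 * (l2 * b) + 2312 * e + 16 * h) + 2 * (2 * b + 2 * e)"
    unfolding b_def e_def l2_def h_def
    by (intro add_mono mult_left_mono estimator_tail_le G.bayes_tail_le assms) auto
  also have "\<dots> \<le> 40 * (l2 * b) + 5000 * e + 32 * h"
  proof -
    have "1 \<le> l2" unfolding l2_def using reg_log_ge[of \<rho>] by (intro one_le_power) auto
    then have "b \<le> l2 * b" using b mult_right_mono[of 1 l2 b] by simp
    then show ?thesis using e b by (simp add: algebra_simps)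
  qed
  finally show ?thesis by (simp only: b_def e_def l2_def h_def)
qed

text \<open>No cutoff: both rules stay within an expected squared distance O(\<ell>^2 (m + 1)) of y
  + 1. This is enough when the moment is so large that the target rate exceeds m.\<close>

lemma sum_loss_trivial:
  assumes "finite A"
  shows "(\<Sum>y\<in>A. loss y) \<le> 10 * (\<ell>\<^sup>2 * (G.m + 1))"
proof -
  define l2 where "l2 = \<ell>\<^sup>2"
  have l2: "1 \<le> l2" unfolding l2_def using reg_log_ge[of \<rho>] by (intro one_le_power) auto
  have int: "integrable G (\<lambda>\<theta>. \<theta> + 1)" "(\<integral>\<theta>. \<theta> + 1 \<partial>G) \<le> G.m + 1"
    using G.mean by (auto simp: G.prob_space)
  have 1: "(\<Sum>y\<in>A. mix G y * (scaled_diff (mix G) (mix G y) y)\<^sup>2) \<le> G.m + 1"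
  proof (rule order_trans[OF G.sum_posterior_sq_dev_le[OF assms _ int(1)] int(2)])
    fix \<theta> :: real assume "0 \<le> \<theta>"
    then show "(\<Sum>y\<in>A. poi y \<theta> * (\<theta> - real y - 1)\<^sup>2) \<le> \<theta> + 1"
      using sum_le_sums[OF sums_poi_sq_dev assms] by (simp add: poi_nonneg mult.commute)
  qed
  have "(\<Sum>y\<in>A. mix G y * (real y + 1)) = (\<integral>\<theta>. (\<Sum>y\<in>A. poi y \<theta> * (real y + 1)) \<partial>G)"
    by (rule G.sum_mix_mult)
  also have "\<dots> \<le> (\<integral>\<theta>. \<theta> + 1 \<partial>G)"
  proof (intro G.integral_mono_G int)
    fix \<theta> :: real assume "0 \<le> \<theta>"
    then show "(\<Sum>y\<in>A. poi y \<theta> * (real y + 1)) \<le> \<theta> + 1"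
      using sum_le_sums[OF sums_poi_mean_Suc assms] by (simp add: poi_nonneg mult.commute)
  qed (intro Bochner_Integration.integrable_sum integrable_mult_left G.integrable_poi)
  also note int(2)
  finally have 2: "(\<Sum>y\<in>A. mix G y * (real y + 1)) \<le> G.m + 1" .
  have "(\<Sum>y\<in>A. loss y) \<le> (\<Sum>y\<in>A. 2 * (4 * l2 * (mix G y * (real y + 1)))
     + 2 * (mix G y * (scaled_diff (mix G) (mix G y) y)\<^sup>2))"
  proof (intro sum_mono order_trans[OF loss_le_dev] add_mono mult_left_mono order_refl)
    fix y
    have "(real y + 1) * mix G y * (reg_log (max (mix H y) \<rho>))\<^sup>2 \<le> (real y + 1) * mix G y * l2"
      unfolding l2_def using G.mix_nonneg[of y] by (intro mult_left_mono reg_log_max_sq_le) auto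
    with estimator_sq_dev_le[of y]
    have "mix G y * (scaled_diff (mix H) (max (mix H y) \<rho>) y)\<^sup>2 \<le> 4 * ((real y + 1) * mix G y * l2)"
      by linarith
    then show "mix G y * (scaled_diff (mix H) (max (mix H y) \<rho>) y)\<^sup>2 \<le> 4 * l2 * (mix G y * (real y + 1))"
      by (simp only: mult_ac)
  qed (auto simp: G.mix_nonneg)
  also have "\<dots> = 8 * l2 * (\<Sum>y\<in>A. mix G y * (real y + 1))
     + 2 * (\<Sum>y\<in>A. mix G y * (scaled_diff (mix G) (mix G y) y)\<^sup>2)"
    by (simp add: sum.distrib sum_distrib_left mult_ac)
  also have "\<dots> \<le> 8 * l2 * (G.m + 1) + 2 * (G.m + 1)"
    using 1 2 l2 by (intro add_mono mult_left_mono) auto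
  also have "\<dots> \<le> 10 * (l2 * (G.m + 1))"
  proof -
    have "1 * (G.m + 1) \<le> l2 * (G.m + 1)" using l2 G.m_pos by (intro mult_right_mono) auto
    then show ?thesis by linarith
  qed
  finally show ?thesis by (simp only: l2_def)
qed

section \<open>Risk bounds for a fixed H\<close>

definition risk :: ennreal where
  "risk = (\<integral>\<^sup>+ y. ennreal ((reg_bayes_rule H \<rho> y - bayes_rule G y)\<^sup>2) \<partial>mix_measure G)"

lemma risk_leI:
  assumes "\<And>Y. (\<Sum>y<Y. loss y) \<le> B"
  shows "risk \<le> ennreal B"
proof -
  have nn: "0 \<le> loss y" for y by (simp add: loss_def G.mix_nonneg)
  have smb: "summable loss"
  proof (rule bounded_imp_summable[where B = B])
    show "sum loss {..n} \<le> B" for n using assms[of "Suc n"] by (simp add: lessThan_Suc_atMost)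
  qed (rule nn)
  have "risk = (\<integral>\<^sup>+ y. ennreal (loss y) \<partial>count_space UNIV)"
    unfolding risk_def mix_measure_def loss_def
    by (subst nn_integral_density) (auto simp: ennreal_mult G.mix_nonneg)
  also have "\<dots> = (\<Sum>y. ennreal (loss y))" by (rule nn_integral_count_space_nat)
  also have "\<dots> = ennreal (\<Sum>y. loss y)" using smb nn by (rule suminf_ennreal2[rotated])
  also have "\<dots> \<le> ennreal B" using smb assms by (intro ennreal_leI suminf_le_const)
  finally show ?thesis .
qed

lemma sum_loss_split:
  assumes "1 \<le> y0" "(\<Sum>y<64 * y0. loss y) \<le> B"
  shows "(\<Sum>y<Y. loss y) \<le> B + 40 * (\<ell>\<^sup>2 * (M * real y0 powr (1 - p)))
     + 5000 * (G.m * exp (- real y0)) + 32 * (\<ell> ^ 4 * hell)"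
proof -
  have nn: "0 \<le> loss y" for y by (simp add: loss_def G.mix_nonneg)
  have "(\<Sum>y<Y. loss y) \<le> (\<Sum>y\<in>{..<64 * y0} \<union> {64 * y0..<Y}. loss y)"
    using nn by (intro sum_mono2) auto
  also have "\<dots> = (\<Sum>y<64 * y0. loss y) + (\<Sum>y\<in>{64 * y0..<Y}. loss y)"
    by (intro sum.union_disjoint) auto
  finally show ?thesis
    using assms(2) tail_le[OF assms(1) finite_atLeastLessThan, of "64 * y0" Y] by fastforce
qed

lemma risk_le_trivial: "risk \<le> ennreal (10 * (\<ell>\<^sup>2 * (G.m + 1)))"
  by (intro risk_leI sum_loss_trivial) auto

lemma risk_le:
  assumes "1 \<le> y0"
  shows "risk \<le> ennreal (10 ^ 14 * (\<ell> ^ 4 * (M * real y0 powr (1 - p) + real y0 * hell)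
      + G.m * exp (- real y0) + real y0 * \<rho> ^ 10 + (real y0)\<^sup>2 * \<rho> * \<ell>\<^sup>2))"
proof (rule risk_leI)
  fix Y
  define b where "b = M * real y0 powr (1 - p)"
  define e where "e = G.m * exp (- real y0)"
  define l2 where "l2 = \<ell>\<^sup>2"
  define l4 where "l4 = \<ell> ^ 4"
  define h where "h = l4 * (real y0 * hell)"
  define t where "t = (real y0)\<^sup>2 * \<rho> * l2"
  define s where "s = real y0 * \<rho> ^ 10"
  have l24: "l2 \<le> l4" "0 \<le> l4" using reg_log_ge[of \<rho>] by (auto simp: l2_def l4_def intro: power_increasing)
  have b: "0 \<le> b" and e: "0 \<le> e" using G.M G.m_pos by (auto simp: b_def e_def)
  have t: "0 \<le> t" and s: "0 \<le> s" using rho by (auto simp: t_def s_def l2_def)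
  have h: "l4 * hell \<le> h"
    unfolding h_def using assms l24 hell_nonneg mult_right_mono[of 1 "real y0" hell] by (intro mult_left_mono) auto
  have h0: "0 \<le> h" using l24 hell_nonneg by (simp add: h_def)
  have lb: "l2 * b \<le> l4 * b" "0 \<le> l4 * b" using l24 b by (auto intro: mult_right_mono)
  have "(\<Sum>y<Y. loss y) \<le> (10 ^ 12 * (real (64 * y0) * l4 * hell) + 10 ^ 12 * (real (64 * y0) * \<rho> ^ 10)
     + 32 * ((real (64 * y0))\<^sup>2 * \<rho> * l2)) + 40 * (l2 * b) + 5000 * e + 32 * (l4 * hell)"
    unfolding b_def e_def l2_def l4_def by (intro sum_loss_split assms bulk_le)
  also have "\<dots> = (64 * 10 ^ 12 * h + 64 * 10 ^ 12 * s + 131072 * t) + 40 * (l2 * b) + 5000 * e + 32 * (l4 * hell)"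
    by (simp add: h_def s_def t_def power_mult_distrib)
  also have "\<dots> \<le> 10 ^ 14 * (l4 * b + h + e + s + t)"
    using h h0 lb e s t by simp
  also have "l4 * b + h = l4 * (b + real y0 * hell)" by (simp add: h_def distrib_left)
  finally show "(\<Sum>y<Y. loss y) \<le> 10 ^ 14 * (\<ell> ^ 4 * (M * real y0 powr (1 - p) + real y0 * hell)
      + G.m * exp (- real y0) + real y0 * \<rho> ^ 10 + (real y0)\<^sup>2 * \<rho> * \<ell>\<^sup>2)"
    by (simp only: b_def e_def l4_def l2_def s_def t_def)
qed

text \<open>For y0 and \<ell> both of order log n the coefficient of the Hellinger distance is of
  order log^4 n, whereas y0 \<ell>^4 would be of order log^5 n.\<close>

lemma risk_le_small:
  assumes "1 \<le> y0"
  shows "risk \<le> ennreal (10 ^ 14 * (\<ell> ^ 4 * (M * real y0 powr (1 - p))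
      + ((real y0)\<^sup>2 * \<ell> + real y0 * \<ell>\<^sup>2 + \<ell> ^ 4) * hell
      + G.m * exp (- real y0) + (real y0)\<^sup>2 * \<rho> * \<ell>\<^sup>2))"
proof (rule risk_leI)
  fix Y
  define b where "b = M * real y0 powr (1 - p)"
  define e where "e = G.m * exp (- real y0)"
  define l2 where "l2 = \<ell>\<^sup>2"
  define l4 where "l4 = \<ell> ^ 4"
  define h1 where "h1 = (real y0)\<^sup>2 * \<ell> * hell"
  define h2 where "h2 = real y0 * l2 * hell"
  define h3 where "h3 = l4 * hell"
  define t where "t = (real y0)\<^sup>2 * \<rho> * l2"
  have l24: "l2 \<le> l4" "0 \<le> l4" "0 \<le> l2" "0 \<le> \<ell>"
    using reg_log_ge[of \<rho>] by (auto simp: l2_def l4_def intro: power_increasing)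
  have b: "0 \<le> b" and e: "0 \<le> e" using G.M G.m_pos by (auto simp: b_def e_def)
  have t: "0 \<le> t" using rho by (auto simp: t_def l2_def)
  have h: "0 \<le> h1" "0 \<le> h2" "0 \<le> h3" using l24 hell_nonneg by (auto simp: h1_def h2_def h3_def)
  have lb: "l2 * b \<le> l4 * b" "0 \<le> l4 * b" using l24 b by (auto intro: mult_right_mono)
  have "(\<Sum>y<Y. loss y) \<le> (480 * ((real (64 * y0))\<^sup>2 * \<ell> * hell) + 96 * (real (64 * y0) * l2 * hell)
     + 32 * ((real (64 * y0))\<^sup>2 * \<rho> * l2)) + 40 * (l2 * b) + 5000 * e + 32 * (l4 * hell)"
    unfolding b_def e_def l2_def l4_def by (intro sum_loss_split assms bulk_le_small)
  also have "\<dots> = (1966080 * h1 + 6144 * h2 + 131072 * t) + 40 * (l2 * b) + 5000 * e + 32 * h3"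
    by (simp add: h1_def h2_def h3_def t_def power_mult_distrib)
  also have "\<dots> \<le> 10 ^ 14 * (l4 * b + (h1 + h2 + h3) + e + t)"
    using h lb e t by simp
  also have "h1 + h2 + h3 = ((real y0)\<^sup>2 * \<ell> + real y0 * l2 + l4) * hell"
    by (simp add: h1_def h2_def h3_def distrib_right)
  finally show "(\<Sum>y<Y. loss y) \<le> 10 ^ 14 * (\<ell> ^ 4 * (M * real y0 powr (1 - p))
      + ((real y0)\<^sup>2 * \<ell> + real y0 * \<ell>\<^sup>2 + \<ell> ^ 4) * hell
      + G.m * exp (- real y0) + (real y0)\<^sup>2 * \<rho> * \<ell>\<^sup>2)"
    by (simp only: b_def e_def l4_def l2_def t_def)
qed

end

lemma moment_two_mixturesI:
  assumes "G \<in> moment_class p M" "H \<in> Rplus_probs" "0 < \<rho>" "1 < p" "0 < M"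
  shows "moment_two_mixtures G H \<rho> p M"
  using moment_classD[OF assms(1,5)] rplus_probI[OF assms(2)] assms(3-5)
  by (simp add: moment_two_mixtures_def moment_mixture_def moment_mixture_axioms_def
      two_mixtures_def two_mixtures_axioms_def)

section \<open>Decomposition of the risk\<close>

context rplus_prob
begin

lemma borel_measurable_joint:
  fixes h :: "nat \<Rightarrow> real \<Rightarrow> ennreal"
  assumes "\<And>y. h y \<in> borel_measurable borel"
  shows "(\<lambda>(\<theta>, y). h y \<theta>) \<in> borel_measurable (G \<Otimes>\<^sub>M count_space UNIV)"
proof -
  have "(\<lambda>x. h (snd x) (fst x)) \<in> borel_measurable (G \<Otimes>\<^sub>M count_space UNIV)"
  proof (rule measurable_compose_countable[where g = snd and f = "\<lambda>y x. h y (fst x)"])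
    fix y
    have "h y \<in> borel_measurable G"
      using assms[of y] measurable_restrict_space1 measurable_cong_sets[OF sets_G refl] by blast
    then show "(\<lambda>x. h y (fst x)) \<in> borel_measurable (G \<Otimes>\<^sub>M count_space UNIV)"
      by (rule measurable_compose[OF measurable_fst])
  qed simp
  then show ?thesis by (simp add: case_prod_beta')
qed

lemma nn_integral_eb_joint:
  assumes "\<And>y. h y \<in> borel_measurable borel"
  shows "(\<integral>\<^sup>+ (\<theta>, y). h y \<theta> \<partial>eb_joint G) = (\<Sum>y. \<integral>\<^sup>+ \<theta>. ennreal (poi y \<theta>) * h y \<theta> \<partial>G)"
proof -
  interpret C: sigma_finite_measure "count_space (UNIV :: nat set)"
    by (rule sigma_finite_measure_count_space)
  have m: "(\<lambda>(\<theta>, y). ennreal (poi y \<theta>)) \<in> borel_measurable (G \<Otimes>\<^sub>M count_space UNIV)"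
    by (rule borel_measurable_joint) measurable
  have mh: "(\<lambda>(\<theta>, y). h y \<theta>) \<in> borel_measurable (G \<Otimes>\<^sub>M count_space UNIV)"
    by (rule borel_measurable_joint) fact
  have mp: "(\<lambda>(\<theta>, y). ennreal (poi y \<theta>) * h y \<theta>) \<in> borel_measurable (G \<Otimes>\<^sub>M count_space UNIV)"
    using assms by (intro borel_measurable_joint) measurable
  have "(\<integral>\<^sup>+ (\<theta>, y). h y \<theta> \<partial>eb_joint G) = (\<integral>\<^sup>+ x. (case x of (\<theta>, y) \<Rightarrow> ennreal (poi y \<theta>) * h y \<theta>) \<partial>(G \<Otimes>\<^sub>M count_space UNIV))"
    unfolding eb_joint_def nn_integral_density[OF m mh]
    by (intro nn_integral_cong) auto
  also have "\<dots> = (\<integral>\<^sup>+ \<theta>. \<integral>\<^sup>+ y. ennreal (poi y \<theta>) * h y \<theta> \<partial>count_space UNIV \<partial>G)"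
    by (subst C.nn_integral_fst[OF mp, symmetric]) simp
  also have "\<dots> = (\<integral>\<^sup>+ \<theta>. (\<Sum>y. ennreal (poi y \<theta>) * h y \<theta>) \<partial>G)"
    by (intro nn_integral_cong nn_integral_count_space_nat)
  also have "\<dots> = (\<Sum>y. \<integral>\<^sup>+ \<theta>. ennreal (poi y \<theta>) * h y \<theta> \<partial>G)"
  proof (rule nn_integral_suminf)
    fix y
    have "(\<lambda>\<theta>. ennreal (poi y \<theta>) * h y \<theta>) \<in> borel_measurable borel" using assms by measurable
    then show "(\<lambda>\<theta>. ennreal (poi y \<theta>) * h y \<theta>) \<in> borel_measurable G"
      using measurable_restrict_space1 measurable_cong_sets[OF sets_G refl] by blast
  qed
  finally show ?thesis .
qed

lemma nn_integral_mix_measure: "(\<integral>\<^sup>+ y. h y \<partial>mix_measure G) = (\<Sum>y. ennreal (mix G y) * h y)"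
  unfolding mix_measure_def by (subst nn_integral_density) (auto simp: nn_integral_count_space_nat)

lemma ennreal_mix: "ennreal (mix G y) = (\<integral>\<^sup>+ \<theta>. ennreal (poi y \<theta>) \<partial>G)"
  unfolding mix_def
  by (subst nn_integral_eq_integral) (auto intro!: integrable_poi AE_I2 simp: space_G poi_nonneg)

lemma sets_eb_joint: "sets (eb_joint G) = sets (G \<Otimes>\<^sub>M count_space UNIV)"
  by (simp add: eb_joint_def)

lemma snd_eb_joint_measurable: "snd \<in> measurable (eb_joint G) (count_space UNIV)"
  unfolding measurable_cong_sets[OF sets_eb_joint refl] by (rule measurable_snd)

lemma distr_eb_joint: "distr (eb_joint G) (count_space UNIV) snd = mix_measure G"
proof (rule measure_eqI)
  fix A assume "A \<in> sets (distr (eb_joint G) (count_space UNIV) snd)"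
  have "emeasure (distr (eb_joint G) (count_space UNIV) snd) A = (\<integral>\<^sup>+ y. indicator A y \<partial>distr (eb_joint G) (count_space UNIV) snd)"
    by simp
  also have "\<dots> = (\<integral>\<^sup>+ x. indicator A (snd x) \<partial>eb_joint G)"
    by (intro nn_integral_distr snd_eb_joint_measurable) auto
  also have "\<dots> = (\<integral>\<^sup>+ (\<theta>, y). indicator A y \<partial>eb_joint G)"
    by (intro nn_integral_cong) auto
  also have "\<dots> = (\<Sum>y. \<integral>\<^sup>+ \<theta>. ennreal (poi y \<theta>) * indicator A y \<partial>G)"
    by (intro nn_integral_eb_joint) auto
  also have "\<dots> = (\<Sum>y. ennreal (mix G y) * indicator A y)"
    unfolding ennreal_mix by (intro suminf_cong nn_integral_multc) (auto intro!: measurable_compose[OF _ measurable_ennreal] borel_measurable_G)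
  also have "\<dots> = (\<integral>\<^sup>+ y. indicator A y \<partial>mix_measure G)"
    by (rule nn_integral_mix_measure[symmetric])
  also have "\<dots> = emeasure (mix_measure G) A"
    by (subst nn_integral_indicator) (auto simp: mix_measure_def)
  finally show "emeasure (distr (eb_joint G) (count_space UNIV) snd) A = emeasure (mix_measure G) A" .
qed (auto simp: mix_measure_def)

lemma prob_space_eb_joint: "prob_space (eb_joint G)"
proof (rule prob_spaceI)
  have "emeasure (eb_joint G) (space (eb_joint G)) = (\<integral>\<^sup>+ x. 1 \<partial>eb_joint G)"
    by simp
  also have "\<dots> = (\<integral>\<^sup>+ (\<theta>, y). 1 \<partial>eb_joint G)"
    by (intro nn_integral_cong) auto
  also have "\<dots> = (\<Sum>y. \<integral>\<^sup>+ \<theta>. ennreal (poi y \<theta>) * 1 \<partial>G)"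
    by (intro nn_integral_eb_joint) auto
  also have "\<dots> = (\<integral>\<^sup>+ \<theta>. (\<Sum>y. ennreal (poi y \<theta>)) \<partial>G)"
    by (subst nn_integral_suminf) (auto intro!: measurable_compose[OF _ measurable_ennreal] borel_measurable_G)
  also have "\<dots> = (\<integral>\<^sup>+ \<theta>. 1 \<partial>G)"
  proof (intro nn_integral_cong)
    fix \<theta> assume "\<theta> \<in> space G"
    then have "(\<Sum>y. ennreal (poi y \<theta>)) = ennreal (\<Sum>y. poi y \<theta>)"
      by (intro suminf_ennreal2 sums_summable[OF poi_sums]) (auto simp: space_G poi_nonneg)
    then show "(\<Sum>y. ennreal (poi y \<theta>)) = 1" by (simp add: sums_unique[OF poi_sums, symmetric])
  qed
  also have "\<dots> = 1" by (simp add: emeasure_space_1)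
  finally show "emeasure (eb_joint G) (space (eb_joint G)) = 1" .
qed

lemma prob_space_mix_measure: "prob_space (mix_measure G)"
  unfolding distr_eb_joint[symmetric]
  by (rule prob_space.prob_space_distr[OF prob_space_eb_joint snd_eb_joint_measurable])

text \<open>Pythagoras for the posterior at fixed y, whose mean is the Bayes rule. All integrals
  here are finite for each y, because the Poisson weight bounds powers of \<theta>.\<close>

lemma poi_sq_error_decomposition:
  "(\<integral>\<^sup>+ \<theta>. ennreal (poi y \<theta>) * ennreal ((t - \<theta>)\<^sup>2) \<partial>G)
    = (\<integral>\<^sup>+ \<theta>. ennreal (poi y \<theta>) * ennreal ((bayes_rule G y - \<theta>)\<^sup>2) \<partial>G)
      + ennreal (mix G y) * ennreal ((t - bayes_rule G y)\<^sup>2)"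
proof (cases "mix G y = 0")
  \<comment> \<open>The quotient in \<open>bayes_rule\<close> is then 0 by convention, but the
    Poisson weight vanishes almost everywhere under G.\<close>
  case True
  have "AE \<theta> in G. 0 \<le> poi y \<theta>"
    by (intro AE_I2) (auto simp: space_G poi_nonneg)
  then have "AE \<theta> in G. poi y \<theta> = 0"
    using True integral_nonneg_eq_0_iff_AE[OF integrable_poi[of y]] by (simp add: mix_def)
  then have "(\<integral>\<^sup>+ \<theta>. ennreal (poi y \<theta>) * ennreal ((s - \<theta>)\<^sup>2) \<partial>G) = (\<integral>\<^sup>+ \<theta>. 0 \<partial>G)" for s
    by (intro nn_integral_cong_AE) auto
  then show ?thesis using True by simp
next
  case False
  define b where "b = bayes_rule G y"
  have eq: "poi y \<theta> * (s - \<theta>)\<^sup>2 = poi y \<theta> * (\<theta> - real y - 1)\<^sup>2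
      - 2 * (s - real y - 1) * (poi y \<theta> * (\<theta> - real y - 1)) + (s - real y - 1)\<^sup>2 * poi y \<theta>" for \<theta> s
    by (simp add: power2_eq_square algebra_simps)
  have int: "integrable G (\<lambda>\<theta>. poi y \<theta> * (s - \<theta>)\<^sup>2)" for s
    unfolding eq by (intro Bochner_Integration.integrable_add Bochner_Integration.integrable_diff
        integrable_mult_right integrable_poi integrable_poi_mult_dev integrable_poi_mult_sq_dev)
  have val: "(\<integral>\<theta>. poi y \<theta> * (s - \<theta>)\<^sup>2 \<partial>G) = (\<integral>\<theta>. poi y \<theta> * (\<theta> - real y - 1)\<^sup>2 \<partial>G)
     - 2 * (s - real y - 1) * ((real y + 1) * fwd_diff (mix G) y) + (s - real y - 1)\<^sup>2 * mix G y" for s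
    unfolding eq fwd_diff_mix mix_def
    by (simp add: integrable_poi integrable_poi_mult_dev integrable_poi_mult_sq_dev)
  have bf: "(real y + 1) * fwd_diff (mix G) y = (b - real y - 1) * mix G y"
    using False by (simp add: b_def bayes_rule_def fwd_diff_def field_simps)
  have ident: "(\<integral>\<theta>. poi y \<theta> * (t - \<theta>)\<^sup>2 \<partial>G) = (\<integral>\<theta>. poi y \<theta> * (b - \<theta>)\<^sup>2 \<partial>G) + mix G y * (t - b)\<^sup>2"
    unfolding val bf by (simp add: power2_eq_square algebra_simps)
  have nn: "(\<integral>\<^sup>+ \<theta>. ennreal (poi y \<theta>) * ennreal ((s - \<theta>)\<^sup>2) \<partial>G) = ennreal (\<integral>\<theta>. poi y \<theta> * (s - \<theta>)\<^sup>2 \<partial>G)" for s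
  proof -
    have "(\<integral>\<^sup>+ \<theta>. ennreal (poi y \<theta>) * ennreal ((s - \<theta>)\<^sup>2) \<partial>G) = (\<integral>\<^sup>+ \<theta>. ennreal (poi y \<theta> * (s - \<theta>)\<^sup>2) \<partial>G)"
      by (intro nn_integral_cong) (auto simp: ennreal_mult space_G poi_nonneg)
    also have "\<dots> = ennreal (\<integral>\<theta>. poi y \<theta> * (s - \<theta>)\<^sup>2 \<partial>G)"
      by (intro nn_integral_eq_integral int AE_I2) (auto simp: space_G poi_nonneg)
    finally show ?thesis .
  qed
  have "0 \<le> (\<integral>\<theta>. poi y \<theta> * (b - \<theta>)\<^sup>2 \<partial>G)"
    by (intro integral_nonneg_AE AE_I2) (auto simp: space_G poi_nonneg)
  then show ?thesis
    unfolding nn ident b_def[symmetric] by (simp add: mix_nonneg ennreal_plus ennreal_mult)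
qed

lemma risk_decomposition:
  "(\<integral>\<^sup>+ (\<theta>, y). ennreal ((t y - \<theta>)\<^sup>2) \<partial>eb_joint G)
    = mmse G + (\<integral>\<^sup>+ y. ennreal ((t y - bayes_rule G y)\<^sup>2) \<partial>mix_measure G)"
proof -
  have "(\<integral>\<^sup>+ (\<theta>, y). ennreal ((s y - \<theta>)\<^sup>2) \<partial>eb_joint G) = (\<Sum>y. \<integral>\<^sup>+ \<theta>. ennreal (poi y \<theta>) * ennreal ((s y - \<theta>)\<^sup>2) \<partial>G)" for s
    by (intro nn_integral_eb_joint) measurable
  note J = this
  have "(\<integral>\<^sup>+ (\<theta>, y). ennreal ((t y - \<theta>)\<^sup>2) \<partial>eb_joint G)
     = (\<Sum>y. (\<integral>\<^sup>+ \<theta>. ennreal (poi y \<theta>) * ennreal ((bayes_rule G y - \<theta>)\<^sup>2) \<partial>G)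
         + ennreal (mix G y) * ennreal ((t y - bayes_rule G y)\<^sup>2))"
    unfolding J by (intro suminf_cong poi_sq_error_decomposition)
  also have "\<dots> = (\<Sum>y. (\<integral>\<^sup>+ \<theta>. ennreal (poi y \<theta>) * ennreal ((bayes_rule G y - \<theta>)\<^sup>2) \<partial>G))
         + (\<Sum>y. ennreal (mix G y) * ennreal ((t y - bayes_rule G y)\<^sup>2))"
    by (intro suminf_add[symmetric] summableI)
  finally show ?thesis
    unfolding mmse_def nn_integral_mix_measure J .
qed

text \<open>A finite product of countable discrete spaces is discrete. Hence every map on samples is
  measurable, and H may be arbitrary.\<close>

lemma sets_PiM_mix_measure:
  "finite A \<Longrightarrow> sets (\<Pi>\<^sub>M i\<in>A. mix_measure G) = Pow (A \<rightarrow>\<^sub>E UNIV)"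
proof -
  assume A: "finite A"
  have "sets (\<Pi>\<^sub>M i\<in>A. mix_measure G) = sets (\<Pi>\<^sub>M i\<in>A. count_space (UNIV :: nat set))"
    by (intro sets_PiM_cong) (auto simp: mix_measure_def)
  also have "\<dots> = Pow (A \<rightarrow>\<^sub>E UNIV)"
    using count_space_PiM_finite[OF A, of "\<lambda>_. UNIV :: nat set"] by simp
  finally show ?thesis .
qed

lemma space_PiM_mix_measure: "space (\<Pi>\<^sub>M i\<in>A. mix_measure G) = A \<rightarrow>\<^sub>E UNIV"
  by (simp add: space_PiM mix_measure_def)

lemma measurable_PiM_mix_measure:
  "finite A \<Longrightarrow> f \<in> measurable (\<Pi>\<^sub>M i\<in>A. mix_measure G) borel"
  by (auto simp: measurable_def sets_PiM_mix_measure space_PiM_mix_measure)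

lemma snd_eb_joint_measurable_mix: "snd \<in> measurable (eb_joint G) (mix_measure G)"
proof -
  have "sets (mix_measure G) = sets (count_space UNIV)" by (simp add: mix_measure_def)
  from snd_eb_joint_measurable show ?thesis
    unfolding measurable_cong_sets[OF refl \<open>sets (mix_measure G) = _\<close>] .
qed

lemma distr_sample:
  "distr (\<Pi>\<^sub>M i\<in>{..<k}. eb_joint G) (\<Pi>\<^sub>M i\<in>{..<k}. mix_measure G) (compose {..<k} snd) = mix_sample k G"
proof -
  have d: "distr (eb_joint G) (mix_measure G) snd = mix_measure G"
    by (subst distr_eb_joint[symmetric]) (intro distr_cong, auto simp: mix_measure_def)
  show ?thesis
    using distr_PiM_finite_prob_space'[of "{..<k}" "\<lambda>_. eb_joint G" "\<lambda>_. mix_measure G" snd]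
      prob_space_eb_joint prob_space_mix_measure snd_eb_joint_measurable_mix d
    by (simp add: mix_sample_def)
qed

lemma compose_snd_measurable:
  "compose {..<k} snd \<in> measurable (\<Pi>\<^sub>M i\<in>{..<k}. eb_joint G) (\<Pi>\<^sub>M i\<in>{..<k}. mix_measure G)"
proof -
  have "(\<lambda>\<omega>. \<lambda>i\<in>{..<k}. snd (\<omega> i)) \<in> measurable (\<Pi>\<^sub>M i\<in>{..<k}. eb_joint G) (\<Pi>\<^sub>M i\<in>{..<k}. mix_measure G)"
  proof (rule measurable_restrict)
    fix i assume "i \<in> {..<k}"
    then show "(\<lambda>\<omega>. snd (\<omega> i)) \<in> measurable (\<Pi>\<^sub>M i\<in>{..<k}. eb_joint G) (mix_measure G)"
      by (intro measurable_compose[where f = "\<lambda>\<omega>. \<omega> i", OF _ snd_eb_joint_measurable_mix]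
          measurable_component_singleton)
  qed
  then show ?thesis by (simp add: compose_def[abs_def])
qed

text \<open>Tonelli with the last pair integrated first. H depends only on the first k observations,
  so the inner integral is the risk of a fixed rule, to which \<open>risk_decomposition\<close>
  applies; the mmse does not depend on the sample.\<close>

lemma eb_risk_g_estimator:
  "eb_risk (Suc k) (g_estimator (Suc k) H \<rho>) G = mmse G
     + (\<integral>\<^sup>+ ys. (\<integral>\<^sup>+ y. ennreal ((reg_bayes_rule (H ys) \<rho> y - bayes_rule G y)\<^sup>2) \<partial>mix_measure G) \<partial>mix_sample k G)"
proof -
  let ?J = "eb_joint G"
  interpret J: prob_space ?J by (rule prob_space_eb_joint)
  interpret P: product_prob_space "\<lambda>_. ?J"
    by (rule product_prob_spaceI) (rule prob_space_eb_joint)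
  define est where "est = g_estimator (Suc k) H \<rho>"
  define f where "f \<omega> = ennreal ((est (\<lambda>i\<in>{..<Suc k}. snd (\<omega> i)) - fst (\<omega> k))\<^sup>2)" for \<omega> :: "nat \<Rightarrow> real \<times> nat"
  define R where "R ys = (\<integral>\<^sup>+ y. ennreal ((reg_bayes_rule (H ys) \<rho> y - bayes_rule G y)\<^sup>2) \<partial>mix_measure G)" for ys
  have fst_meas: "fst \<in> borel_measurable ?J"
  proof -
    have "fst \<in> measurable (G \<Otimes>\<^sub>M count_space (UNIV :: nat set)) G" by (rule measurable_fst)
    then have "(\<lambda>x. fst x) \<in> borel_measurable (G \<Otimes>\<^sub>M count_space (UNIV :: nat set))"
      by (rule measurable_compose[where g = "\<lambda>x. x"]) (rule borel_measurable_G, simp)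
    then show ?thesis by (simp only: measurable_cong_sets[OF sets_eb_joint refl])
  qed
  have f: "f \<in> borel_measurable (\<Pi>\<^sub>M i\<in>insert k {..<k}. ?J)"
  proof -
    have "(\<lambda>\<omega>. est (compose {..<Suc k} snd \<omega>)) \<in> borel_measurable (\<Pi>\<^sub>M i\<in>{..<Suc k}. ?J)"
      by (rule measurable_compose[OF compose_snd_measurable measurable_PiM_mix_measure]) auto
    moreover have "(\<lambda>\<omega>. fst (\<omega> k)) \<in> borel_measurable (\<Pi>\<^sub>M i\<in>{..<Suc k}. ?J)"
      by (rule measurable_compose[where f = "\<lambda>\<omega>. \<omega> k", OF _ fst_meas])
         (rule measurable_component_singleton, simp)
    ultimately have "(\<lambda>\<omega>. ennreal ((est (compose {..<Suc k} snd \<omega>) - fst (\<omega> k))\<^sup>2)) \<in> borel_measurable (\<Pi>\<^sub>M i\<in>{..<Suc k}. ?J)"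
      by measurable
    then show ?thesis by (simp add: f_def[abs_def] compose_def lessThan_Suc)
  qed
  have upd: "f (x(k := z)) = (case z of (\<theta>, y) \<Rightarrow> ennreal ((reg_bayes_rule (H (compose {..<k} snd x)) \<rho> y - \<theta>)\<^sup>2))" for x z
  proof -
    have "restrict (\<lambda>i\<in>{..<Suc k}. snd ((x(k := z)) i)) {..<k} = compose {..<k} snd x"
      by (auto simp: compose_def restrict_def fun_eq_iff)
    then show ?thesis
      by (cases z) (simp add: f_def est_def g_estimator_def)
  qed
  have "eb_risk (Suc k) est G = integral\<^sup>N (\<Pi>\<^sub>M i\<in>insert k {..<k}. ?J) f"
    by (simp add: eb_risk_def f_def[abs_def] lessThan_Suc)
  also have "\<dots> = (\<integral>\<^sup>+ x. (\<integral>\<^sup>+ z. f (x(k := z)) \<partial>?J) \<partial>(\<Pi>\<^sub>M i\<in>{..<k}. ?J))"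
    by (rule P.product_nn_integral_insert[OF _ _ f]) auto
  also have "\<dots> = (\<integral>\<^sup>+ x. mmse G + R (compose {..<k} snd x) \<partial>(\<Pi>\<^sub>M i\<in>{..<k}. ?J))"
    unfolding upd risk_decomposition R_def ..
  also have "\<dots> = (\<integral>\<^sup>+ ys. mmse G + R ys \<partial>mix_sample k G)"
    unfolding distr_sample[symmetric]
    by (subst nn_integral_distr[OF compose_snd_measurable]) (simp_all add: measurable_PiM_mix_measure)
  also have "\<dots> = (\<integral>\<^sup>+ ys. mmse G \<partial>mix_sample k G) + (\<integral>\<^sup>+ ys. R ys \<partial>mix_sample k G)"
    unfolding mix_sample_def by (intro nn_integral_add measurable_PiM_mix_measure) auto
  also have "(\<integral>\<^sup>+ ys. mmse G \<partial>mix_sample k G) = mmse G"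
  proof -
    interpret Q: prob_space "mix_sample k G"
      unfolding mix_sample_def by (intro prob_space_PiM prob_space_mix_measure)
    show ?thesis by (simp add: Q.emeasure_space_1)
  qed
  finally show ?thesis by (simp add: est_def R_def)
qed

end

context moment_mixture
begin

text \<open>The rule y + 1 has conditional risk \<theta> + 1, which is integrable. Finiteness allows
  the mmse to be cancelled in the regret.\<close>

lemma mmse_finite: "mmse G < \<infinity>"
proof -
  have "mmse G \<le> (\<integral>\<^sup>+ (\<theta>, y). ennreal (((real y + 1) - \<theta>)\<^sup>2) \<partial>eb_joint G)"
    unfolding risk_decomposition by simp
  also have "\<dots> = (\<Sum>y. \<integral>\<^sup>+ \<theta>. ennreal (poi y \<theta>) * ennreal ((real y + 1 - \<theta>)\<^sup>2) \<partial>G)"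
    by (intro nn_integral_eb_joint) measurable
  also have "\<dots> = (\<integral>\<^sup>+ \<theta>. (\<Sum>y. ennreal (poi y \<theta>) * ennreal ((real y + 1 - \<theta>)\<^sup>2)) \<partial>G)"
    by (intro nn_integral_suminf[symmetric])
       (auto intro!: borel_measurable_times_ennreal measurable_compose[OF _ measurable_ennreal] borel_measurable_G)
  also have "\<dots> = (\<integral>\<^sup>+ \<theta>. ennreal (\<theta> + 1) \<partial>G)"
  proof (intro nn_integral_cong)
    fix \<theta> assume "\<theta> \<in> space G"
    then have t: "0 \<le> \<theta>" by (simp add: space_G)
    have "ennreal (poi y \<theta>) * ennreal ((real y + 1 - \<theta>)\<^sup>2) = ennreal ((\<theta> - real y - 1)\<^sup>2 * poi y \<theta>)" for y
      using t poi_nonneg[OF t, of y]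
      by (simp add: ennreal_mult[symmetric] power2_commute[of "real y + 1"] diff_diff_eq mult.commute)
    then have "(\<Sum>y. ennreal (poi y \<theta>) * ennreal ((real y + 1 - \<theta>)\<^sup>2)) = ennreal (\<Sum>y. (\<theta> - real y - 1)\<^sup>2 * poi y \<theta>)"
      using t by (simp add: suminf_ennreal2 sums_summable[OF sums_poi_sq_dev] poi_nonneg)
    then show "(\<Sum>y. ennreal (poi y \<theta>) * ennreal ((real y + 1 - \<theta>)\<^sup>2)) = ennreal (\<theta> + 1)"
      by (simp add: sums_unique[OF sums_poi_sq_dev, symmetric])
  qed
  also have "\<dots> = ennreal (\<integral>\<theta>. \<theta> + 1 \<partial>G)"
    using mean by (intro nn_integral_eq_integral AE_I2) (auto simp: space_G)
  also have "\<dots> < \<infinity>" by simp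
  finally show ?thesis .
qed

end

text \<open>The risk bound is in terms of \<open>reg_log\<close>, which never falls below 4, while
  the claim has the plain logarithm. With |ln \<rho>| \<ge> \<delta>, the two differ by the factor 1
  + 4 / \<delta> at most.\<close>

lemma oracle_inequality:
  fixes \<delta> \<rho> p M :: real
  assumes \<delta>: "0 < \<delta>" and \<rho>: "0 < \<rho>" "\<delta> \<le> \<bar>ln \<rho>\<bar>" and p: "1 < p" and M: "0 < M" and G: "G \<in> moment_class p M"
    and H: "H \<in> samples (n - 1) \<rightarrow> Rplus_probs" and ys: "ys \<in> samples (n - 1)"
  shows "(\<integral>\<^sup>+ y. ennreal ((g_estimator n H \<rho> (ys(n - 1 := y)) - bayes_rule G y)\<^sup>2) \<partial>mix_measure G)
       \<le> ennreal (10 ^ 14 * (1 + 4 / \<delta>) ^ 4 * (INF y0\<in>{1::nat..}.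
            (ln (1 / \<rho>)) ^ 4 *
              (M * real y0 powr (- (p - 1)) + real y0 * hellinger_sq (mix G) (mix (H ys)))
            + remainder 1 p M y0 \<rho>))"
proof -
  define \<Lambda> where "\<Lambda> = 1 + 4 / \<delta>"
  have \<Lambda>: "1 \<le> \<Lambda>" using \<delta> by (simp add: \<Lambda>_def)
  define K where "K = 10 ^ 14 * \<Lambda> ^ 4"
  have K: "0 < K" using \<Lambda> by (simp add: K_def)
  interpret moment_two_mixtures G "H ys" \<rho> p M
    using G H ys \<rho> p M by (intro moment_two_mixturesI) auto
  define X where "X y0 = (ln (1 / \<rho>)) ^ 4 * (M * real y0 powr (- (p - 1)) + real y0 * hell) + remainder 1 p M y0 \<rho>" for y0
  define L where "L = \<bar>ln \<rho>\<bar>"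
  have L2: "(ln (1 / \<rho>))\<^sup>2 = L\<^sup>2" "(ln (1 / \<rho>)) ^ 4 = L ^ 4"
    using \<rho> by (simp_all add: L_def ln_div)
  \<comment> \<open>ys is \<open>undefined\<close> outside {..<n - 1}, so setting the entry n - 1
    and restricting again gives back ys.\<close>
  have "restrict (ys(n - 1 := y)) {..<n - 1} = ys" for y
    using ys by (auto simp: samples_def PiE_def extensional_def restrict_def fun_eq_iff)
  then have risk: "(\<integral>\<^sup>+ y. ennreal ((g_estimator n H \<rho> (ys(n - 1 := y)) - bayes_rule G y)\<^sup>2) \<partial>mix_measure G) = risk"
    by (simp add: g_estimator_def risk_def)
  have "reg_log \<rho> \<le> 4 + L" using \<rho> by (auto simp: reg_log_def L_def ln_div)
  also have "4 + L \<le> \<Lambda> * L"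
    using \<rho>(2) \<delta> by (simp add: \<Lambda>_def L_def field_simps)
  finally have l: "reg_log \<rho> \<le> \<Lambda> * L" .
  have l4: "reg_log \<rho> ^ 4 \<le> \<Lambda> ^ 4 * L ^ 4"
    using power_mono[OF l, of 4] reg_log_ge[of \<rho>] by (simp add: power_mult_distrib)
  have "\<Lambda>\<^sup>2 \<le> \<Lambda> ^ 4" using \<Lambda> by (intro power_increasing) auto
  then have "\<Lambda>\<^sup>2 * L\<^sup>2 \<le> \<Lambda> ^ 4 * L\<^sup>2" by (intro mult_right_mono) auto
  then have l2: "(reg_log \<rho>)\<^sup>2 \<le> \<Lambda> ^ 4 * L\<^sup>2"
    using power_mono[OF l, of 2] reg_log_ge[of \<rho>] by (simp add: power_mult_distrib)
  have \<Lambda>4: "1 \<le> \<Lambda> ^ 4" using \<Lambda> by (rule one_le_power)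
  have X: "risk \<le> ennreal (K * X y0)" if "1 \<le> y0" for y0
  proof (rule order_trans[OF risk_le[OF that] ennreal_leI])
    have "reg_log \<rho> ^ 4 * (M * real y0 powr (1 - p) + real y0 * hell)
         + G.m * exp (- real y0) + real y0 * \<rho> ^ 10 + (real y0)\<^sup>2 * \<rho> * (reg_log \<rho>)\<^sup>2
       \<le> \<Lambda> ^ 4 * L ^ 4 * (M * real y0 powr (1 - p) + real y0 * hell)
         + \<Lambda> ^ 4 * (G.m * exp (- real y0)) + \<Lambda> ^ 4 * (real y0 * \<rho> ^ 10) + (real y0)\<^sup>2 * \<rho> * (\<Lambda> ^ 4 * L\<^sup>2)"
    proof (intro add_mono)
      show "G.m * exp (- real y0) \<le> \<Lambda> ^ 4 * (G.m * exp (- real y0))"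
        using mult_right_mono[OF \<Lambda>4, of "G.m * exp (- real y0)"] G.m_pos by simp
      show "real y0 * \<rho> ^ 10 \<le> \<Lambda> ^ 4 * (real y0 * \<rho> ^ 10)"
        using mult_right_mono[OF \<Lambda>4, of "real y0 * \<rho> ^ 10"] \<rho> by simp
    qed (use l4 l2 M hell_nonneg \<rho> in \<open>auto intro!: mult_right_mono mult_left_mono\<close>)
    also have "\<dots> = \<Lambda> ^ 4 * X y0"
      unfolding X_def L2 remainder_def G.m_def by (simp add: algebra_simps)
    finally show "10 ^ 14 * (reg_log \<rho> ^ 4 * (M * real y0 powr (1 - p) + real y0 * hell)
         + G.m * exp (- real y0) + real y0 * \<rho> ^ 10 + (real y0)\<^sup>2 * \<rho> * (reg_log \<rho>)\<^sup>2) \<le> K * X y0"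
      unfolding K_def by simp
  qed
  have X_nonneg: "0 \<le> X y0" for y0
    using M \<rho> hell_nonneg by (simp add: X_def remainder_def L2)
  \<comment> \<open>The infimum is taken in the reals, so the risk is first recognised as a real
    number, by its bound at y0 = 1.\<close>
  have "risk \<le> ennreal (K * X 1)" by (rule X) simp
  then have "risk < top" by (rule le_less_trans) simp
  then obtain r where r: "0 \<le> r" "risk = ennreal r" by (cases risk) auto
  have "r / K \<le> X y0" if "1 \<le> y0" for y0
    using X[OF that] r K X_nonneg[of y0] by (simp add: ennreal_le_iff divide_le_eq mult.commute)
  then have "r / K \<le> (INF y0\<in>{1::nat..}. X y0)"
    by (intro cINF_greatest) auto
  then have "risk \<le> ennreal (K * (INF y0\<in>{1::nat..}. X y0))"
    unfolding r(2) using K by (intro ennreal_leI) (simp add: divide_le_eq mult.commute)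
  then show ?thesis unfolding risk X_def K_def \<Lambda>_def .
qed

section \<open>Rates\<close>

text \<open>The cutoff \<open>ys\<close> solves M y^(1-p) = y A, where A is the nonparametric
  Hellinger rate, and B is the common value. The last identity shows that A exceeds 1 / N exactly
  when M N exceeds 1.\<close>

lemma rate_balance:
  fixes M N p :: real
  assumes "0 < M" "0 < N" "1 < p"
  defines "q \<equiv> 2 * p + 1"
  defines "B \<equiv> N powr (- (2 * (p - 1) / q)) * M powr (3 / q)"
    and "A \<equiv> N powr (- (2 * p / q)) * M powr (1 / q)"
    and "ys \<equiv> (M * N) powr (2 / q)"
  shows "M * ys powr (1 - p) = B" "ys * A = B" "A = (M * N) powr (1 / q) / N"
proof -
  have q: "0 < q" using assms by (simp add: q_def)
  have MN: "ln (M * N) = ln M + ln N" using assms by (simp add: ln_mult)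
  have pos: "x powr a = exp (a * ln x)" if "0 < x" for x a :: real
    using that by (simp add: powr_def)
  have MN0: "0 < M * N" using assms by simp
  have lM: "M = exp (ln M)" and lN: "N = exp (ln N)" using assms by auto
  have ys: "ys = exp (2 / q * (ln M + ln N))" unfolding ys_def by (simp only: pos[OF MN0] MN)
  have A: "A = exp (- (2 * p / q) * ln N + 1 / q * ln M)"
    unfolding A_def by (simp only: pos[OF assms(1)] pos[OF assms(2)] exp_add)
  have B: "B = exp (- (2 * (p - 1) / q) * ln N + 3 / q * ln M)"
    unfolding B_def by (simp only: pos[OF assms(1)] pos[OF assms(2)] exp_add)
  have "ys powr (1 - p) = exp ((1 - p) * (2 / q * (ln M + ln N)))"
    unfolding ys by (simp add: pos)
  then have "M * ys powr (1 - p) = exp (ln M + (1 - p) * (2 / q * (ln M + ln N)))"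
    using assms by (simp add: exp_add)
  also have "ln M + (1 - p) * (2 / q * (ln M + ln N)) = - (2 * (p - 1) / q) * ln N + 3 / q * ln M"
  proof -
    have "q * (ln M + (1 - p) * (2 / q * (ln M + ln N))) = q * (- (2 * (p - 1) / q) * ln N + 3 / q * ln M)"
    proof -
      have "q * (ln M + (1 - p) * (2 / q * (ln M + ln N))) = q * ln M + (1 - p) * (2 * (ln M + ln N))"
        using q by (simp add: distrib_left)
      also have "\<dots> = - (2 * (p - 1)) * ln N + 3 * ln M" by (simp add: q_def algebra_simps)
      also have "\<dots> = q * (- (2 * (p - 1) / q) * ln N + 3 / q * ln M)"
        using q by (simp add: field_simps)
      finally show ?thesis .
    qed
    then show ?thesis using q by simp
  qed
  finally show "M * ys powr (1 - p) = B" by (simp only: B)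
  have "ys * A = exp (2 / q * (ln M + ln N) + (- (2 * p / q) * ln N + 1 / q * ln M))"
    unfolding ys A by (simp only: exp_add)
  also have "2 / q * (ln M + ln N) + (- (2 * p / q) * ln N + 1 / q * ln M) = - (2 * (p - 1) / q) * ln N + 3 / q * ln M"
    using q by (simp add: field_simps)
  finally show "ys * A = B" by (simp only: B)
  have "(M * N) powr (1 / q) / N = exp (1 / q * (ln M + ln N) - ln N)"
    unfolding pos[OF MN0] MN using assms by (simp add: exp_diff)
  also have "1 / q * (ln M + ln N) - ln N = - (2 * p / q) * ln N + 1 / q * ln M"
    using q by (simp add: field_simps) (simp add: q_def algebra_simps)
  finally show "A = (M * N) powr (1 / q) / N" by (simp only: A)
qed

text \<open>This covers the term m exp (- y0) for y0 \<ge> log n. For M \<ge> 1 the exponents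
  compare by 1 / p \<le> 3 / (2 p + 1) and 2 (p - 1) / (2 p + 1) \<le> 1; for M < 1 the term 1 / N
  takes over.\<close>

lemma moment_div_le_rate:
  fixes M N p :: real
  assumes "0 < M" "1 \<le> N" "1 < p"
  shows "M powr (1 / p) / N \<le> max (N powr (- (2 * (p - 1) / (2 * p + 1))) * M powr (3 / (2 * p + 1))) (1 / N)"
proof (cases "1 \<le> M")
  case True
  have "M powr (1 / p) \<le> M powr (3 / (2 * p + 1))"
    using True assms by (intro powr_mono) (auto simp: field_simps)
  moreover have "1 / N \<le> N powr (- (2 * (p - 1) / (2 * p + 1)))"
  proof -
    have "N powr (- 1) \<le> N powr (- (2 * (p - 1) / (2 * p + 1)))"
      using assms by (intro powr_mono) (auto simp: field_simps)
    then show ?thesis using assms by (simp add: powr_minus_divide)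
  qed
  ultimately have "1 / N * M powr (1 / p) \<le> N powr (- (2 * (p - 1) / (2 * p + 1))) * M powr (3 / (2 * p + 1))"
    using assms by (intro mult_mono) auto
  then show ?thesis by (simp add: le_max_iff_disj)
next
  case False
  then have "M powr (1 / p) \<le> 1" using assms by (simp add: powr_le1)
  then show ?thesis using assms by (simp add: le_max_iff_disj divide_right_mono)
qed

text \<open>With q = 2 p + 1, the assumption turns N^(2 (p - 1) / q) into at most m^((p - 1) / q),
  and 1 / p + (p - 1) / (p q) = 3 / q.\<close>

lemma large_moment_le_rate:
  fixes M N p :: real
  assumes "0 < M" "1 \<le> N" "1 < p" "N\<^sup>2 \<le> M powr (1 / p)"
  shows "M powr (1 / p) \<le> N powr (- (2 * (p - 1) / (2 * p + 1))) * M powr (3 / (2 * p + 1))"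
proof -
  define q where "q = 2 * p + 1"
  have q: "0 < q" using assms by (simp add: q_def)
  define r where "r = (p - 1) / q"
  have r: "0 \<le> r" using assms q by (simp add: r_def)
  have "N powr (2 * r) = (N\<^sup>2) powr r"
    using assms by (simp add: powr_powr flip: powr_numeral)
  also have "\<dots> \<le> (M powr (1 / p)) powr r" using assms r by (intro powr_mono2) auto
  also have "\<dots> = M powr (r / p)" by (simp add: powr_powr)
  finally have 1: "N powr (2 * r) \<le> M powr (r / p)" .
  have "M powr (1 / p) = M powr (1 / p) * (N powr (- (2 * r)) * N powr (2 * r))"
    using assms by (simp add: powr_add[symmetric])
  also have "\<dots> \<le> M powr (1 / p) * (N powr (- (2 * r)) * M powr (r / p))"
    using 1 by (intro mult_left_mono) auto
  also have "\<dots> = N powr (- (2 * r)) * M powr (1 / p + r / p)"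
    by (simp add: powr_add)
  also have "1 / p + r / p = 3 / q"
  proof -
    have "1 / p + r / p = (q + (p - 1)) / (p * q)" using assms q by (simp add: r_def field_simps)
    also have "q + (p - 1) = 3 * p" by (simp add: q_def)
    also have "3 * p / (p * q) = 3 / q" using assms by simp
    finally show ?thesis .
  qed
  finally show ?thesis by (simp add: r_def q_def)
qed

lemma reg_log_le_ln:
  assumes "0 < c" "2 \<le> N"
  shows "reg_log (c * N powr (- 10)) \<le> ((4 + \<bar>ln c\<bar>) / ln 2 + 10) * ln N"
proof -
  have l2: "0 < ln (2 :: real)" "ln 2 \<le> ln N" using assms by auto
  have "ln (1 / (c * N powr (- 10))) = 10 * ln N - ln c"
    using assms by (simp add: ln_div ln_mult ln_powr)
  moreover have "0 \<le> 10 * ln N" using l2 by linarith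
  ultimately have "reg_log (c * N powr (- 10)) \<le> 4 + \<bar>ln c\<bar> + 10 * ln N"
    unfolding reg_log_def by linarith
  also have "4 + \<bar>ln c\<bar> = (4 + \<bar>ln c\<bar>) / ln 2 * ln 2" using l2 by simp
  also have "\<dots> \<le> (4 + \<bar>ln c\<bar>) / ln 2 * ln N"
    using l2 by (intro mult_left_mono) auto
  finally show ?thesis by (simp add: distrib_right)
qed

definition log_const :: "real \<Rightarrow> real" where
  "log_const c = (4 + \<bar>ln c\<bar>) / ln 2 + 10"

text \<open>The 2 collects the moment terms M y0^(1-p) and m exp (- y0). The terms 5 c2^10 and 25 c2
  come from the two \<rho> terms with y0 \<le> 5 N^2. The coefficient 62 bounds the Hellinger term
  for both cutoffs: 50 + 10 + 1 is needed for the logarithmic one, 2 for the balancing one.\<close>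

definition rate_const :: "real \<Rightarrow> real \<Rightarrow> real" where
  "rate_const c1 c2 = 10 ^ 14 * log_const c2 ^ 4 * (2 + 5 * c2 ^ 10 + 25 * c2 + 62 * c1)"

lemma log_const_ge: "10 \<le> log_const c"
  by (simp add: log_const_def)

lemma rate_const_pos: "0 < c1 \<Longrightarrow> 0 < c2 \<Longrightarrow> 0 < rate_const c1 c2"
  using log_const_ge[of c2] unfolding rate_const_def by (intro mult_pos_pos add_pos_pos) auto

text \<open>The cutoff \<open>y0\<close> balances moment and Hellinger term, except that it is at least \<open>log n\<close>.  When the latter
  is in force, the bound \<open>risk_le_small\<close> avoids the extra logarithm that \<open>risk_le\<close> would give.\<close>

lemma risk_rate:
  fixes N p M c1 c2 :: real
  assumes c: "0 < c1" "0 < c2" and N: "2 \<le> N" and p: "1 < p" and M: "0 < M"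
  defines "\<rho> \<equiv> c2 * N powr (- 10)"
    and "Tg \<equiv> max (N powr (- (2 * (p - 1) / (2 * p + 1))) * M powr (3 / (2 * p + 1))) (1 / N)"
    and "Am \<equiv> max (N powr (- (2 * p / (2 * p + 1))) * M powr (1 / (2 * p + 1))) (1 / N)"
  obtains a b where "0 \<le> a" "0 \<le> b"
    "\<And>G H. G \<in> moment_class p M \<Longrightarrow> H \<in> Rplus_probs \<Longrightarrow>
       (\<integral>\<^sup>+ y. ennreal ((reg_bayes_rule H \<rho> y - bayes_rule G y)\<^sup>2) \<partial>mix_measure G)
         \<le> ennreal (a + b * hellinger_sq (mix G) (mix H))"
    "\<And>w. 0 \<le> w \<Longrightarrow> a + b * (c1 * Am * w) \<le> rate_const c1 c2 * Tg * ln N ^ 4 * (1 + w)"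
proof -
  define W where "W = ln N"
  define l where "l = reg_log \<rho>"
  define k where "k = log_const c2"
  define B where "B = N powr (- (2 * (p - 1) / (2 * p + 1))) * M powr (3 / (2 * p + 1))"
  define A where "A = N powr (- (2 * p / (2 * p + 1))) * M powr (1 / (2 * p + 1))"
  define ystar where "ystar = (M * N) powr (2 / (2 * p + 1))"
  define m where "m = M powr (1 / p)"
  have \<rho>: "0 < \<rho>" using c N by (simp add: \<rho>_def)
  have W2: "1 / 2 \<le> W"
  proof -
    have "ln 2 \<le> W" using N by (simp add: W_def)
    moreover have "1 / 2 \<le> ln (2 :: real)" using ln_le_minus_one[of "1 / 2 :: real"] by (simp add: ln_div)
    ultimately show ?thesis by simp
  qed
  have l: "4 \<le> l" "l \<le> k * W"
    using reg_log_ge reg_log_le_ln[OF c(2) N] by (auto simp: l_def k_def log_const_def W_def \<rho>_def)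
  have k: "10 \<le> k" by (simp add: k_def log_const_ge)
  have l4: "l ^ 4 \<le> k ^ 4 * W ^ 4" using power_mono[OF l(2), of 4] l(1) by (simp add: power_mult_distrib)
  have l24: "l\<^sup>2 \<le> l ^ 4" using l by (intro power_increasing) auto
  have l14: "1 \<le> l ^ 4" using l by (intro one_le_power) auto
  have Tg: "B \<le> Tg" "1 / N \<le> Tg" "0 < Tg"
    using N by (auto simp: Tg_def B_def less_max_iff_disj)
  have m: "0 < m" using M by (simp add: m_def)
  have B: "0 \<le> B" by (simp add: B_def)
  have Am: "Am = max A (1 / N)" "0 \<le> Am" using N by (auto simp: Am_def A_def le_max_iff_disj)
  let ?risk = "\<lambda>G H. \<integral>\<^sup>+ y. ennreal ((reg_bayes_rule H \<rho> y - bayes_rule G y)\<^sup>2) \<partial>mix_measure G"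
  let ?h = "\<lambda>G H. hellinger_sq (mix G) (mix H)"
  show ?thesis
  \<comment> \<open>For m \<ge> N^2 the target rate exceeds m, and the trivial bound with b = 0
    suffices. Otherwise the balancing cutoff is at most N^2, so that \<rho> = c2 N^(-10) makes y0
    \<rho>^10 and y0^2 \<rho> of order 1 / N.\<close>
  proof (cases "N\<^sup>2 \<le> m")
    case True
    have 1: "1 \<le> N\<^sup>2" using N by (intro one_le_power) auto
    have "m \<le> B" unfolding m_def B_def using True N M p by (intro large_moment_le_rate) (auto simp: m_def)
    then have mB: "m + 1 \<le> 2 * Tg" using Tg True 1 by linarith
    show ?thesis
    proof (rule that[of "20 * (l ^ 4 * Tg)" 0])
      fix G H assume GH: "G \<in> moment_class p M" "H \<in> Rplus_probs"
      interpret moment_two_mixtures G H \<rho> p M using GH \<rho> p M by (rule moment_two_mixturesI)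
      have "?risk G H \<le> ennreal (10 * (l\<^sup>2 * (m + 1)))"
        using risk_le_trivial by (simp add: risk_def l_def m_def G.m_def)
      also have "\<dots> \<le> ennreal (20 * (l ^ 4 * Tg) + 0 * ?h G H)"
      proof (rule ennreal_leI)
        have "l\<^sup>2 * (m + 1) \<le> l ^ 4 * (2 * Tg)" using l24 mB m by (intro mult_mono) auto
        then show "10 * (l\<^sup>2 * (m + 1)) \<le> 20 * (l ^ 4 * Tg) + 0 * ?h G H" by (simp add: mult.commute)
      qed
      finally show "?risk G H \<le> ennreal (20 * (l ^ 4 * Tg) + 0 * ?h G H)" .
    next
      fix w :: real assume w: "0 \<le> w"
      have "20 * (l ^ 4 * Tg) \<le> 20 * (k ^ 4 * W ^ 4 * Tg)"
        using l4 Tg by (intro mult_left_mono mult_right_mono) auto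
      also have "\<dots> \<le> rate_const c1 c2 * Tg * W ^ 4"
      proof -
        have "20 * k ^ 4 \<le> 10 ^ 14 * k ^ 4 * (2 + 5 * c2 ^ 10 + 25 * c2 + 62 * c1)"
        proof -
          have "20 \<le> 10 ^ 14 * (2 + 5 * c2 ^ 10 + 25 * c2 + 62 * c1)"
            using c by (simp add: add_increasing2)
          from mult_right_mono[OF this, of "k ^ 4"] show ?thesis by (simp add: mult_ac)
        qed
        then have "20 * k ^ 4 * (Tg * W ^ 4) \<le> rate_const c1 c2 * (Tg * W ^ 4)"
          unfolding rate_const_def k_def using Tg by (intro mult_right_mono) auto
        then show ?thesis by (simp add: mult_ac)
      qed
      also have "\<dots> \<le> rate_const c1 c2 * Tg * W ^ 4 * (1 + w)"
        using mult_left_mono[of 1 "1 + w" "rate_const c1 c2 * Tg * W ^ 4"] w rate_const_pos[OF c] Tg by simp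
      finally show "20 * (l ^ 4 * Tg) + 0 * (c1 * Am * w) \<le> rate_const c1 c2 * Tg * ln N ^ 4 * (1 + w)"
        by (simp add: W_def)
    qed (use Tg in auto)
  next
    case False
    have N0: "0 < N" using N by simp
    note bal = rate_balance[OF M N0 p, folded B_def A_def ystar_def]
    have ypos: "0 < ystar" using M N by (simp add: ystar_def)
    \<comment> \<open>M < N^(2 p) gives M N \<le> N^(2 p + 1), and the exponent 2 / (2 p + 1) turns
      this into N^2.\<close>
    have ystar_le: "ystar \<le> N\<^sup>2"
    proof -
      have "M = m powr p" using M p by (simp add: m_def powr_powr)
      also have "\<dots> \<le> (N\<^sup>2) powr p" using False m p by (intro powr_mono2) auto
      also have "\<dots> = N powr (2 * p)" using N by (simp add: powr_powr flip: powr_numeral)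
      finally have "M * N \<le> N powr (2 * p) * N powr 1" using N by (intro mult_mono) auto
      also have "\<dots> = N powr (2 * p + 1)" by (simp add: powr_add)
      finally have "ystar \<le> (N powr (2 * p + 1)) powr (2 / (2 * p + 1))"
        unfolding ystar_def using M N p by (intro powr_mono2) auto
      also have "\<dots> = N\<^sup>2"
      proof -
        have "(2 * p + 1) * (2 / (2 * p + 1)) = 2" using p by (simp add: divide_eq_eq)
        then show ?thesis using N by (simp only: powr_powr) simp
      qed
      finally show ?thesis .
    qed
    have AT: "Am \<le> Tg"
    proof -
      have "A \<le> Tg"
      proof (cases "1 \<le> M * N")
        case True
        then have "1 \<le> ystar" unfolding ystar_def using p by (intro ge_one_powr_ge_zero) auto
        then have "A \<le> ystar * A" using mult_right_mono[of 1 ystar A] by (simp add: A_def)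
        then show ?thesis using bal(2) Tg by simp
      next
        case False
        then have "(M * N) powr (1 / (2 * p + 1)) \<le> 1" using M N p by (intro powr_le1) auto
        then have "A \<le> 1 / N" unfolding bal(3) using N by (simp add: divide_right_mono)
        then show ?thesis using Tg by simp
      qed
      then show ?thesis using Tg by (simp add: Am)
    qed
    have mT: "m / N \<le> Tg"
      unfolding m_def Tg_def using M N p by (intro moment_div_le_rate) auto
    define S where "S = 10 ^ 14 * (Tg * l ^ 4 * (2 + 5 * c2 ^ 10 + 25 * c2))"
    have S0: "0 \<le> S" using Tg c by (simp add: S_def)
    text \<open>All terms but the Hellinger term are the same for both choices of the cutoff.\<close>
    have common: "10 ^ 14 * (l ^ 4 * (M * real y0 powr (1 - p)) + m * exp (- real y0) + real y0 * \<rho> ^ 10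
         + (real y0)\<^sup>2 * \<rho> * l\<^sup>2) \<le> S"
      if y0: "ystar \<le> real y0" "W \<le> real y0" "real y0 \<le> 5 * N\<^sup>2" for y0
    proof -
      have "real y0 powr (1 - p) \<le> ystar powr (1 - p)"
        using y0 ypos p by (intro powr_mono2') auto
      then have "M * real y0 powr (1 - p) \<le> M * ystar powr (1 - p)" using M by (intro mult_left_mono) auto
      also have "\<dots> \<le> Tg" using bal(1) Tg by simp
      finally have 1: "l ^ 4 * (M * real y0 powr (1 - p)) \<le> l ^ 4 * Tg"
        by (intro mult_left_mono) auto
      have "exp (- real y0) \<le> exp (- W)" using y0 by simp
      also have "\<dots> = 1 / N" using N by (simp add: W_def exp_minus field_simps)
      finally have "m * exp (- real y0) \<le> m * (1 / N)" using m by (intro mult_left_mono) auto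
      also have "\<dots> \<le> Tg" using mT by simp
      also have "\<dots> \<le> l ^ 4 * Tg" using l14 Tg mult_right_mono[of 1 "l ^ 4" Tg] by simp
      finally have 2: "m * exp (- real y0) \<le> l ^ 4 * Tg" .
      have \<rho>N: "\<rho> = c2 / N ^ 10" using N by (simp add: \<rho>_def powr_minus_divide powr_realpow[of N 10, simplified])
      have "real y0 * \<rho> ^ 10 \<le> 5 * N\<^sup>2 * \<rho> ^ 10" using y0 \<rho> by (intro mult_right_mono) auto
      also have "\<dots> = 5 * c2 ^ 10 * (N\<^sup>2 / N ^ 100)"
        by (simp add: \<rho>N power_divide power_mult[symmetric])
      also have "N\<^sup>2 / N ^ 100 \<le> 1 / N"
        using N power_increasing[of 3 100 N] by (simp add: field_simps power2_eq_square power3_eq_cube)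
      finally have "real y0 * \<rho> ^ 10 \<le> 5 * c2 ^ 10 * (1 / N)" using c by (simp add: mult_left_mono)
      also have "\<dots> \<le> 5 * c2 ^ 10 * (l ^ 4 * Tg)"
        using Tg l14 c mult_mono[of 1 "l ^ 4" "1 / N" Tg] N by (intro mult_left_mono) auto
      finally have 3: "real y0 * \<rho> ^ 10 \<le> 5 * c2 ^ 10 * (l ^ 4 * Tg)" .
      have "(real y0)\<^sup>2 * \<rho> \<le> (5 * N\<^sup>2)\<^sup>2 * \<rho>" using y0 \<rho> by (intro mult_right_mono power_mono) auto
      also have "\<dots> = 25 * c2 * (N ^ 4 / N ^ 10)" by (simp add: \<rho>N power_mult_distrib power_mult[symmetric])
      also have "N ^ 4 / N ^ 10 \<le> 1 / N"
        using N power_increasing[of 5 10 N] by (simp add: field_simps flip: power_Suc)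
      finally have "(real y0)\<^sup>2 * \<rho> \<le> 25 * c2 * Tg"
        using c Tg mult_left_mono[of "N ^ 4 / N ^ 10" Tg "25 * c2"]
        by (meson mult_left_mono order_trans less_imp_le mult_nonneg_nonneg zero_le_numeral)
      from mult_mono[OF this l24] have "(real y0)\<^sup>2 * \<rho> * l\<^sup>2 \<le> 25 * c2 * Tg * l ^ 4"
        using c Tg by simp
      with 1 2 3 show ?thesis unfolding S_def by (simp add: algebra_simps)
    qed
    \<comment> \<open>Here w stands for (log n)^\<kappa>. It is kept free so that the constant does
      not depend on \<kappa>; since S lacks this factor, the bound is stated with 1 + w.\<close>
    have S_le: "S + b * (c1 * Am * w) \<le> rate_const c1 c2 * Tg * W ^ 4 * (1 + w)"
      if b: "b * Am \<le> 10 ^ 14 * (62 * k ^ 4 * W ^ 4 * Tg)" and w: "0 \<le> w" for b w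
    proof -
      define Z where "Z = k ^ 4 * (Tg * W ^ 4)"
      have Z: "0 \<le> Z" using Tg by (simp add: Z_def)
      have "S \<le> 10 ^ 14 * (Tg * (k ^ 4 * W ^ 4) * (2 + 5 * c2 ^ 10 + 25 * c2))"
        unfolding S_def using l4 Tg c by (intro mult_left_mono mult_right_mono) auto
      also have "\<dots> = 10 ^ 14 * (Z * (2 + 5 * c2 ^ 10 + 25 * c2))" by (simp add: Z_def mult_ac)
      finally have 1: "S \<le> 10 ^ 14 * (Z * (2 + 5 * c2 ^ 10 + 25 * c2))" .
      have "b * Am * (c1 * w) \<le> 10 ^ 14 * (62 * k ^ 4 * W ^ 4 * Tg) * (c1 * w)"
        using b c w by (intro mult_right_mono) auto
      then have 2: "b * (c1 * Am * w) \<le> 10 ^ 14 * (62 * (Z * (c1 * w)))" by (simp add: Z_def mult_ac)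
      have "rate_const c1 c2 * Tg * W ^ 4 * (1 + w) = 10 ^ 14 * (Z * (2 + 5 * c2 ^ 10 + 25 * c2 + 62 * c1) * (1 + w))"
        by (simp add: rate_const_def Z_def k_def)
      also have "Z * (2 + 5 * c2 ^ 10 + 25 * c2 + 62 * c1) * (1 + w)
          = Z * (2 + 5 * c2 ^ 10 + 25 * c2) + 62 * (Z * (c1 * w))
            + (62 * (Z * c1) + Z * (2 + 5 * c2 ^ 10 + 25 * c2) * w)"
        by (simp add: algebra_simps)
      finally have eq: "rate_const c1 c2 * Tg * W ^ 4 * (1 + w) = 10 ^ 14 * (Z * (2 + 5 * c2 ^ 10 + 25 * c2))
          + 10 ^ 14 * (62 * (Z * (c1 * w))) + 10 ^ 14 * (62 * (Z * c1) + Z * (2 + 5 * c2 ^ 10 + 25 * c2) * w)"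
        by (simp only: distrib_left)
      have "0 \<le> 10 ^ 14 * (62 * (Z * c1) + Z * (2 + 5 * c2 ^ 10 + 25 * c2) * w)"
        using Z c w by simp
      with 1 2 show ?thesis unfolding eq by linarith
    qed
    have N1: "N \<le> N\<^sup>2" using N by (simp add: power2_eq_square)
    show ?thesis
    proof (cases "W + 1 \<le> ystar")
      case True
      define y0 where "y0 = nat \<lceil>ystar\<rceil>"
      have y1: "ystar \<le> real y0" "real y0 \<le> ystar + 1" unfolding y0_def using ypos by linarith+
      have y: "W \<le> real y0" "1 \<le> y0" "real y0 \<le> 2 * ystar" using y1 True W2 by linarith+
      then have y5: "real y0 \<le> 5 * N\<^sup>2" using ystar_le by simp
      define b where "b = 10 ^ 14 * (l ^ 4 * real y0)"
      show ?thesis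
      proof (rule that[of S b])
        show "0 \<le> b" by (simp add: b_def)
        fix G H assume GH: "G \<in> moment_class p M" "H \<in> Rplus_probs"
        interpret moment_two_mixtures G H \<rho> p M using GH \<rho> p M by (rule moment_two_mixturesI)
        have "?risk G H \<le> ennreal (10 ^ 14 * (l ^ 4 * (M * real y0 powr (1 - p) + real y0 * ?h G H)
            + m * exp (- real y0) + real y0 * \<rho> ^ 10 + (real y0)\<^sup>2 * \<rho> * l\<^sup>2))"
          using risk_le[OF y(2)] by (simp only: risk_def l_def m_def G.m_def)
        also have "\<dots> = ennreal (10 ^ 14 * (l ^ 4 * (M * real y0 powr (1 - p)) + m * exp (- real y0) + real y0 * \<rho> ^ 10
         + (real y0)\<^sup>2 * \<rho> * l\<^sup>2) + b * ?h G H)"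
          by (simp add: b_def algebra_simps)
        also have "\<dots> \<le> ennreal (S + b * ?h G H)"
          by (intro ennreal_leI add_right_mono common y1 y y5)
        finally show "?risk G H \<le> ennreal (S + b * ?h G H)" .
      next
        fix w :: real assume w: "0 \<le> w"
        have "1 \<le> ystar" using True W2 by simp
        \<comment> \<open>A cutoff above 1 forces M N \<ge> 1. Then the maximum in \<open>Am\<close>
          is A, not 1 / N, and the balance y0 A = O(B) applies.\<close>
        have "1 \<le> M * N"
        proof (rule ccontr)
          assume "\<not> 1 \<le> M * N"
          then have "ystar < 1 powr (2 / (2 * p + 1))"
            unfolding ystar_def using M N p by (intro powr_less_mono2) auto
          then show False using \<open>1 \<le> ystar\<close> by simp
        qed
        then have "1 \<le> (M * N) powr (1 / (2 * p + 1))" using p by (intro ge_one_powr_ge_zero) auto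
        then have "Am = A" unfolding Am bal(3) using N by (simp add: max_absorb1 divide_right_mono)
        then have "real y0 * Am \<le> 2 * (ystar * A)"
          using mult_right_mono[OF y(3), of A] by (simp add: A_def mult_ac)
        also have "\<dots> \<le> 2 * Tg" using bal(2) Tg by simp
        finally have yA: "real y0 * Am \<le> 2 * Tg" .
        have "l ^ 4 * (real y0 * Am) \<le> k ^ 4 * W ^ 4 * (2 * Tg)"
          by (rule mult_mono[OF l4 yA]) (use Am(2) in auto)
        also have "\<dots> \<le> 62 * k ^ 4 * W ^ 4 * Tg"
          using Tg by (simp add: mult_ac)
        finally have "b * Am \<le> 10 ^ 14 * (62 * k ^ 4 * W ^ 4 * Tg)"
          by (simp add: b_def mult_ac)
        from S_le[OF this w] show "S + b * (c1 * Am * w) \<le> rate_const c1 c2 * Tg * ln N ^ 4 * (1 + w)"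
          by (simp add: W_def)
      qed (rule S0)
    next
      case False
      define y0 where "y0 = nat \<lceil>W + 1\<rceil>"
      \<comment> \<open>W \<ge> 1/2 absorbs the rounding, by W + 2 \<le> 5 W.\<close>
      have y1: "W + 1 \<le> real y0" "real y0 \<le> W + 2" unfolding y0_def using W2 by linarith+
      have y: "W \<le> real y0" "1 \<le> y0" "ystar \<le> real y0" "real y0 \<le> 5 * W" using y1 False W2 by linarith+
      have "W \<le> N" unfolding W_def using N ln_le_minus_one[of N] by simp
      then have y5: "real y0 \<le> 5 * N\<^sup>2" using y N1 by linarith
      define b where "b = 10 ^ 14 * ((real y0)\<^sup>2 * l + real y0 * l\<^sup>2 + l ^ 4)"
      show ?thesis
      proof (rule that[of S b])
        show "0 \<le> b" using l by (simp add: b_def)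
        fix G H assume GH: "G \<in> moment_class p M" "H \<in> Rplus_probs"
        interpret moment_two_mixtures G H \<rho> p M using GH \<rho> p M by (rule moment_two_mixturesI)
        have "?risk G H \<le> ennreal (10 ^ 14 * (l ^ 4 * (M * real y0 powr (1 - p))
            + ((real y0)\<^sup>2 * l + real y0 * l\<^sup>2 + l ^ 4) * ?h G H
            + m * exp (- real y0) + (real y0)\<^sup>2 * \<rho> * l\<^sup>2))"
          using risk_le_small[OF y(2)] by (simp only: risk_def l_def m_def G.m_def)
        also have "\<dots> = ennreal (10 ^ 14 * (l ^ 4 * (M * real y0 powr (1 - p)) + m * exp (- real y0) + 0
         + (real y0)\<^sup>2 * \<rho> * l\<^sup>2) + b * ?h G H)"
          by (simp add: b_def algebra_simps)
        also have "\<dots> \<le> ennreal (10 ^ 14 * (l ^ 4 * (M * real y0 powr (1 - p)) + m * exp (- real y0) + real y0 * \<rho> ^ 10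
         + (real y0)\<^sup>2 * \<rho> * l\<^sup>2) + b * ?h G H)"
          using \<rho> by (intro ennreal_leI add_right_mono mult_left_mono add_left_mono) auto
        also have "\<dots> \<le> ennreal (S + b * ?h G H)"
          by (intro ennreal_leI add_right_mono common y1 y y5)
        finally show "?risk G H \<le> ennreal (S + b * ?h G H)" .
      next
        fix w :: real assume w: "0 \<le> w"
        have W34: "W ^ 3 \<le> 2 * W ^ 4"
          using mult_right_mono[of 1 "2 * W" "W ^ 3"] W2 by (simp add: power3_eq_cube power4_eq_xxxx mult_ac)
        have kk: "k \<le> k ^ 4" "k\<^sup>2 \<le> k ^ 4" using k power_increasing[of 1 4 k] power_increasing[of 2 4 k] by auto
        have "(real y0)\<^sup>2 * l \<le> (5 * W)\<^sup>2 * (k * W)" using y l W2 by (intro mult_mono power_mono) auto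
        also have "\<dots> = 25 * k * W ^ 3" by (simp add: power2_eq_square power3_eq_cube)
        also have "\<dots> \<le> 25 * k ^ 4 * (2 * W ^ 4)" using kk W34 W2 k by (intro mult_mono) auto
        finally have 1: "(real y0)\<^sup>2 * l \<le> 50 * (k ^ 4 * W ^ 4)" by simp
        have "real y0 * l\<^sup>2 \<le> (5 * W) * (k * W)\<^sup>2" using y l W2 by (intro mult_mono power_mono) auto
        also have "\<dots> = 5 * k\<^sup>2 * W ^ 3" by (simp add: power2_eq_square power3_eq_cube)
        also have "\<dots> \<le> 5 * k ^ 4 * (2 * W ^ 4)" using kk W34 W2 k by (intro mult_mono) auto
        finally have 2: "real y0 * l\<^sup>2 \<le> 10 * (k ^ 4 * W ^ 4)" by simp
        have "(real y0)\<^sup>2 * l + real y0 * l\<^sup>2 + l ^ 4 \<le> 62 * (k ^ 4 * W ^ 4)"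
          using 1 2 l4 by (smt (verit) zero_le_mult_iff zero_le_even_power even_numeral)
        then have "((real y0)\<^sup>2 * l + real y0 * l\<^sup>2 + l ^ 4) * Am \<le> 62 * (k ^ 4 * W ^ 4) * Tg"
          by (rule mult_mono[OF _ AT]) (use Am(2) in auto)
        then have "10 ^ 14 * (((real y0)\<^sup>2 * l + real y0 * l\<^sup>2 + l ^ 4) * Am) \<le> 10 ^ 14 * (62 * (k ^ 4 * W ^ 4) * Tg)"
          by (rule mult_left_mono) simp
        then have "b * Am \<le> 10 ^ 14 * (62 * k ^ 4 * W ^ 4 * Tg)"
          unfolding b_def by (simp only: mult.assoc)
        from S_le[OF this w] show "S + b * (c1 * Am * w) \<le> rate_const c1 c2 * Tg * ln N ^ 4 * (1 + w)"
          by (simp add: W_def)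
      qed (rule S0)
    qed
  qed
qed

section \<open>The degenerate sample size one\<close>

lemma return_moment_class:
  assumes "0 \<le> t" "t powr p \<le> M"
  shows "return (restrict_space borel {0..}) t \<in> moment_class p M"
    and "mix (return (restrict_space borel {0..}) t) y = poi y t"
proof -
  let ?S = "restrict_space borel {0::real..}"
  have t: "t \<in> space ?S" using assms by (simp add: space_restrict_space)
  have meas: "f \<in> borel_measurable borel \<Longrightarrow> f \<in> borel_measurable ?S" for f :: "real \<Rightarrow> 'a :: topological_space"
    by (rule measurable_restrict_space1)
  have "(\<integral>\<^sup>+ u. ennreal (u powr p) \<partial>return ?S t) = ennreal (t powr p)"
    by (rule nn_integral_return[OF t]) (rule meas, measurable)
  then show "return ?S t \<in> moment_class p M"
    using assms t by (auto simp: moment_class_def Rplus_probs_def space_prob_algebra intro: prob_space_return ennreal_leI)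
  show "mix (return ?S t) y = poi y t"
    unfolding mix_def by (rule integral_return[OF t]) (rule meas, measurable)
qed

lemma hellinger_sq_pos:
  assumes "G \<in> Rplus_probs" "H \<in> Rplus_probs" "mix G y \<noteq> mix H y"
  shows "0 < hellinger_sq (mix G) (mix H)"
proof -
  interpret two_mixtures G H 1
    using assms by (simp add: two_mixtures_def two_mixtures_axioms_def rplus_probI)
  have "0 < hterm y" using assms(3) G.mix_nonneg[of y] H.mix_nonneg[of y] by simp
  also have "\<dots> \<le> hell" using sum_hterm_le[of "{y}"] by simp
  finally show ?thesis .
qed

text \<open>The class contains the point masses at 0 and at M^(1/p), whose mixtures differ at y = 0;
  a single H cannot match both.\<close>

lemma no_zero_hellinger_class:
  assumes "0 < M" "0 < p" "H \<in> Rplus_probs"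
  shows "\<exists>G\<in>moment_class p M. 0 < hellinger_sq (mix G) (mix H)"
proof -
  define t where "t = M powr (1 / p)"
  have t: "0 < t" "t powr p \<le> M" using assms by (auto simp: t_def powr_powr)
  define D where "D = return (restrict_space borel {0::real..})"
  have D: "D 0 \<in> moment_class p M" "D t \<in> moment_class p M" "mix (D 0) 0 = 1" "mix (D t) 0 = exp (- t)"
    using return_moment_class[of 0 p M] return_moment_class[of t p M] t assms by (auto simp: D_def poi_def)
  have "exp (- t) \<noteq> 1" using t by simp
  then have "mix (D 0) 0 \<noteq> mix H 0 \<or> mix (D t) 0 \<noteq> mix H 0" unfolding D by auto
  then show ?thesis
    using D(1,2) hellinger_sq_pos[OF _ assms(3), of _ 0] unfolding moment_class_def by blast
qed

section \<open>From risk to regret\<close>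

lemma g_estimator_risk_le:
  assumes "G \<in> moment_class p M" "1 < p" "0 < M" "0 \<le> a" "0 \<le> b" "0 \<le> e"
    and H: "H \<in> samples k \<rightarrow> Rplus_probs"
    and risk: "\<And>H'. H' \<in> Rplus_probs \<Longrightarrow>
       (\<integral>\<^sup>+ y. ennreal ((reg_bayes_rule H' \<rho> y - bayes_rule G y)\<^sup>2) \<partial>mix_measure G)
         \<le> ennreal (a + b * hellinger_sq (mix G) (mix H'))"
    and hell: "(\<integral>\<^sup>+ ys. ennreal (hellinger_sq (mix G) (mix (H ys))) \<partial>mix_sample k G) \<le> ennreal e"
  shows "enn2ereal (eb_risk (Suc k) (g_estimator (Suc k) H \<rho>) G) - enn2ereal (mmse G) \<le> ereal (a + b * e)"
proof -
  interpret moment_mixture G p M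
    using moment_classD[OF assms(1,3)] assms(2,3) by (simp add: moment_mixture_def moment_mixture_axioms_def)
  interpret Q: prob_space "mix_sample k G"
    unfolding mix_sample_def by (intro prob_space_PiM prob_space_mix_measure)
  let ?R = "\<lambda>ys. \<integral>\<^sup>+ y. ennreal ((reg_bayes_rule (H ys) \<rho> y - bayes_rule G y)\<^sup>2) \<partial>mix_measure G"
  let ?D = "\<integral>\<^sup>+ ys. ?R ys \<partial>mix_sample k G"
  have meas: "f \<in> borel_measurable (mix_sample k G)" for f :: "(nat \<Rightarrow> nat) \<Rightarrow> ennreal"
    unfolding mix_sample_def by (intro measurable_PiM_mix_measure) simp
  have "?D \<le> (\<integral>\<^sup>+ ys. ennreal a + ennreal b * ennreal (hellinger_sq (mix G) (mix (H ys))) \<partial>mix_sample k G)"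
  proof (intro nn_integral_mono)
    fix ys assume "ys \<in> space (mix_sample k G)"
    then have "H ys \<in> Rplus_probs"
      using H by (auto simp: mix_sample_def space_PiM_mix_measure samples_def)
    then have "?R ys \<le> ennreal (a + b * hellinger_sq (mix G) (mix (H ys)))" by (rule risk)
    also have "\<dots> \<le> ennreal a + ennreal (b * hellinger_sq (mix G) (mix (H ys)))"
      using assms by (simp add: ennreal_plus_if)
    finally show "?R ys \<le> ennreal a + ennreal b * ennreal (hellinger_sq (mix G) (mix (H ys)))"
      using assms by (simp add: ennreal_mult')
  qed
  also have "\<dots> = ennreal a + ennreal b * (\<integral>\<^sup>+ ys. ennreal (hellinger_sq (mix G) (mix (H ys))) \<partial>mix_sample k G)"
    by (simp add: nn_integral_add nn_integral_cmult meas Q.emeasure_space_1)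
  also have "\<dots> \<le> ennreal a + ennreal b * ennreal e"
    by (intro add_left_mono mult_left_mono hell) simp
  also have "\<dots> = ennreal (a + b * e)"
    using assms by (simp add: ennreal_mult ennreal_plus)
  finally have D: "?D \<le> ennreal (a + b * e)" .
  obtain r where r: "0 \<le> r" "mmse G = ennreal r" using mmse_finite by (cases "mmse G") auto
  have "enn2ereal (eb_risk (Suc k) (g_estimator (Suc k) H \<rho>) G) = ereal r + enn2ereal ?D"
    unfolding eb_risk_g_estimator r(2) using r(1) by (simp add: plus_ennreal.rep_eq)
  then have "enn2ereal (eb_risk (Suc k) (g_estimator (Suc k) H \<rho>) G) - enn2ereal (mmse G) = enn2ereal ?D"
    using r by (cases "enn2ereal ?D") auto
  also have "\<dots> \<le> enn2ereal (ennreal (a + b * e))"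
    using D by (simp add: less_eq_ennreal.rep_eq)
  also have "\<dots> = ereal (a + b * e)" using assms by (intro enn2ereal_ennreal) auto
  finally show ?thesis .
qed

lemma regret_bound:
  fixes c1 c2 \<kappa> p M :: real
  assumes c: "0 < c1" "0 < c2" and \<kappa>: "0 < \<kappa>" and p: "1 < p" and M: "0 < M" and n: "1 \<le> n"
    and H: "H \<in> samples (n - 1) \<rightarrow> Rplus_probs"
    and "\<forall>G \<in> moment_class p M.
        (\<integral>\<^sup>+ ys. ennreal (hellinger_sq (mix G) (mix (H ys))) \<partial>mix_sample (n - 1) G)
        \<le> ennreal (c1 * max (real n powr (- (2 * p / (2 * p + 1))) * M powr (1 / (2 * p + 1))) (1 / real n)
             * ln (real n) powr \<kappa>)"
  defines "C0 \<equiv> rate_const c1 c2"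
  shows "regret n (g_estimator n H (c2 * real n powr (- 10))) (moment_class p M)
     \<le> ereal ((if n \<ge> 3 then 2 * C0 else C0 * (1 + ln 2 powr (- \<kappa>))) *
          max (real n powr (- (2 * (p - 1) / (2 * p + 1))) * M powr (3 / (2 * p + 1))) (1 / real n)
          * ln (real n) powr (\<kappa> + 4))"
proof -
  define C' where "C' = C0 * (1 + ln 2 powr (- \<kappa>))"
  have C0: "0 < C0" unfolding C0_def using c by (rule rate_const_pos)
  define Tg where "Tg = max (real n powr (- (2 * (p - 1) / (2 * p + 1))) * M powr (3 / (2 * p + 1))) (1 / real n)"
  define Am where "Am = max (real n powr (- (2 * p / (2 * p + 1))) * M powr (1 / (2 * p + 1))) (1 / real n)"
  define W where "W = ln (real n)"
  define k where "k = n - 1"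
  have nk: "n = Suc k" using n by (simp add: k_def)
  have hell: "(\<integral>\<^sup>+ ys. ennreal (hellinger_sq (mix G) (mix (H ys))) \<partial>mix_sample k G)
      \<le> ennreal (c1 * Am * W powr \<kappa>)" if "G \<in> moment_class p M" for G
    using that assms(8) by (simp add: Am_def W_def k_def)
  have "regret n (g_estimator n H (c2 * real n powr (- 10))) (moment_class p M)
    \<le> ereal ((if n \<ge> 3 then 2 * C0 else C') * Tg * W powr (\<kappa> + 4))"
  proof (cases "n = 1")
    \<comment> \<open>Since ln 1 = 0 and 0 powr \<kappa> = 0, the hypothesis bounds the Hellinger
      distance by 0. The only sample of size 0 is the function \<open>undefined\<close> everywhere,
      so a single H is tested against the whole class, a contradiction.\<close>
    case True
    then have k: "k = 0" "W = 0" by (auto simp: k_def W_def)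
    let ?u = "\<lambda>_ :: nat. undefined :: nat"
    have "H ?u \<in> Rplus_probs" using H True by (auto simp: samples_def)
    from no_zero_hellinger_class[OF M _ this, of p] p
    obtain G where G: "G \<in> moment_class p M" "0 < hellinger_sq (mix G) (mix (H ?u))" by auto
    have "(\<integral>\<^sup>+ ys. ennreal (hellinger_sq (mix G) (mix (H ys))) \<partial>mix_sample k G)
        = ennreal (hellinger_sq (mix G) (mix (H ?u)))"
      by (simp add: mix_sample_def k PiM_empty nn_integral_count_space_finite)
    with hell[OF G(1)] G(2) k show ?thesis by simp
  next
    case False
    with n have n2: "2 \<le> real n" by simp
    from risk_rate[OF c n2 p M, folded Tg_def Am_def W_def]
    obtain a b where ab: "0 \<le> a" "0 \<le> b"
      "\<And>G H. G \<in> moment_class p M \<Longrightarrow> H \<in> Rplus_probs \<Longrightarrow>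
         (\<integral>\<^sup>+ y. ennreal ((reg_bayes_rule H (c2 * real n powr (- 10)) y - bayes_rule G y)\<^sup>2) \<partial>mix_measure G)
           \<le> ennreal (a + b * hellinger_sq (mix G) (mix H))"
      "\<And>w. 0 \<le> w \<Longrightarrow> a + b * (c1 * Am * w) \<le> C0 * Tg * W ^ 4 * (1 + w)"
      unfolding C0_def by blast
    have W: "ln 2 \<le> W" "0 < W"
    proof -
      show "ln 2 \<le> W" using n2 by (simp add: W_def)
      then show "0 < W" using ln_gt_zero[of "2 :: real"] by linarith
    qed
    have Am: "0 \<le> Am" by (simp add: Am_def le_max_iff_disj)
    have Tg: "0 < Tg" using n2 by (simp add: Tg_def less_max_iff_disj)
    have "enn2ereal (eb_risk n (g_estimator n H (c2 * real n powr (- 10))) G) - enn2ereal (mmse G)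
       \<le> ereal (a + b * (c1 * Am * W powr \<kappa>))" if "G \<in> moment_class p M" for G
    proof -
      have e: "0 \<le> c1 * Am * W powr \<kappa>" using c Am by simp
      have Hk: "H \<in> samples k \<rightarrow> Rplus_probs" using H by (simp add: k_def)
      show ?thesis
        using g_estimator_risk_le[OF that p M ab(1,2) e Hk ab(3)[OF that] hell[OF that]]
        unfolding nk[symmetric] .
    qed
    then have "regret n (g_estimator n H (c2 * real n powr (- 10))) (moment_class p M)
       \<le> ereal (a + b * (c1 * Am * W powr \<kappa>))"
      unfolding regret_def by (intro SUP_least)
    also have "\<dots> \<le> ereal (C0 * Tg * W ^ 4 * (1 + W powr \<kappa>))"
      using ab(4)[of "W powr \<kappa>"] by simp
    also have "\<dots> \<le> ereal ((if n \<ge> 3 then 2 * C0 else C') * Tg * W powr (\<kappa> + 4))"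
    proof -
      have Wp: "W powr (\<kappa> + 4) = W ^ 4 * W powr \<kappa>"
        using W by (simp add: powr_add powr_realpow[of W 4, simplified])
      have "C0 * (1 + W powr \<kappa>) \<le> (if n \<ge> 3 then 2 * C0 else C') * W powr \<kappa>"
      \<comment> \<open>For n \<ge> 3, log n \<ge> 1 and the summand 1 is absorbed by (log
        n)^\<kappa>. For n = 2 it is absorbed only at the price of (ln 2)^(-\<kappa>).\<close>
      proof (cases "3 \<le> n")
        case True
        have "1 = ln (exp 1 :: real)" by simp
        also have "\<dots> \<le> W" unfolding W_def using True exp_le by (intro ln_mono) auto
        finally have "1 \<le> W powr \<kappa>" using \<kappa> by (intro ge_one_powr_ge_zero) auto
        then have "C0 * (1 + W powr \<kappa>) \<le> C0 * (2 * W powr \<kappa>)" using C0 by (intro mult_left_mono) auto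
        then show ?thesis using True by simp
      next
        case 3: False
        with \<open>n \<noteq> 1\<close> n have "n = 2" by simp
        then have "W = ln 2" by (simp add: W_def)
        then have "(1 + ln 2 powr (- \<kappa>)) * W powr \<kappa> = 1 + W powr \<kappa>"
          using W by (simp add: distrib_right powr_minus field_simps)
        then show ?thesis using 3 by (simp add: C'_def mult.assoc)
      qed
      then have "Tg * W ^ 4 * (C0 * (1 + W powr \<kappa>)) \<le> Tg * W ^ 4 * ((if n \<ge> 3 then 2 * C0 else C') * W powr \<kappa>)"
        using Tg by (intro mult_left_mono) auto
      then show ?thesis unfolding Wp by (simp only: ereal_less_eq mult_ac)
    qed
    finally show ?thesis .
  qed
  then show ?thesis by (simp only: Tg_def W_def C'_def)
qed

theorem theorem4:
  shows
    "(\<exists>c0>0. \<forall>\<delta>>0. \<exists>K>0. \<forall>p>1. \<forall>M>0. \<forall>n\<ge>1.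
        \<forall>G \<in> moment_class p M. \<forall>H \<in> samples (n - 1) \<rightarrow> Rplus_probs. \<forall>ys \<in> samples (n - 1).
        \<forall>\<rho>>0. \<bar>ln \<rho>\<bar> \<ge> \<delta> \<longrightarrow>
          (\<integral>\<^sup>+ y. ennreal ((g_estimator n H \<rho> (ys(n - 1 := y)) - bayes_rule G y)\<^sup>2)
             \<partial>mix_measure G)
          \<le> ennreal (K * (INF y0\<in>{1::nat..}.
               (ln (1 / \<rho>)) ^ 4 *
                 (M * real y0 powr (- (p - 1))
                   + real y0 * hellinger_sq (mix G) (mix (H ys)))
               + remainder c0 p M y0 \<rho>)))
     \<and>
     (\<forall>c1>0. \<forall>c2>0. \<exists>C>0. \<forall>\<kappa>>0. \<exists>C'>0. \<forall>p>1. \<forall>M>0. \<forall>n\<ge>1.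
        \<forall>H \<in> samples (n - 1) \<rightarrow> Rplus_probs.
        (\<forall>G \<in> moment_class p M.
           (\<integral>\<^sup>+ ys. ennreal (hellinger_sq (mix G) (mix (H ys))) \<partial>mix_sample (n - 1) G)
           \<le> ennreal (c1 *
                max (real n powr (- (2 * p / (2 * p + 1))) * M powr (1 / (2 * p + 1)))
                    (1 / real n)
                * ln (real n) powr \<kappa>)) \<longrightarrow>
        regret n (g_estimator n H (c2 * real n powr (- 10))) (moment_class p M)
        \<le> ereal ((if n \<ge> 3 then C else C') *
             max (real n powr (- (2 * (p - 1) / (2 * p + 1))) * M powr (3 / (2 * p + 1)))
                 (1 / real n)
             * ln (real n) powr (\<kappa> + 4)))"
  apply (rule conjI)
  subgoal
    \<comment> \<open>The value c0 = 1 comes from \<open>sum_half_power_le\<close>: the geometric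
      tail beyond 64 y0 is below 2 exp (- y0).\<close>
    apply (rule exI[of _ 1])
    apply (intro conjI allI impI)
     apply simp
    subgoal for \<delta>
      by (rule exI[of _ "10 ^ 14 * (1 + 4 / \<delta>) ^ 4"])
        (intro conjI allI impI ballI oracle_inequality mult_pos_pos zero_less_power add_pos_pos; simp)
    done
  subgoal
    apply (intro allI impI)
    subgoal for c1 c2
      apply (rule exI[of _ "2 * rate_const c1 c2"])
      apply (intro conjI allI impI)
       apply (simp add: rate_const_pos)
      subgoal for \<kappa>
        by (rule exI[of _ "rate_const c1 c2 * (1 + ln 2 powr (- \<kappa>))"])
          (intro conjI allI impI ballI regret_bound; simp add: rate_const_pos add_pos_nonneg)
      done
    done
  done

end
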